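(* Let $n\ge 5$ and $l\ge 1$ be integers, let $\Omega\subseteq\mathbb{R}^n$ be a bounded domain, and let $\lambda^{(l)}_1\le\lambda^{(l)}_2\le\cdots$ be the eigenvalues of the Dirichlet problem for the poly-Laplacian $(-\Delta)^l$ on $\Omega$. Let $k\ge 1$ be an integer with $k\geq \max\{\tilde{k}_1^{n/2},\tilde{k}_2^{n/2},\tilde{k}_3,\tilde{k}_4\}$, where $\tilde k_1,\tilde k_2,\tilde k_3,\tilde k_4$ are the constants depending only on $n$ and $l$ defined in the context. Then $$\sum_{i=1}^k\lambda^{(l)}_i\geq \frac{n}{n+2l}\frac{(2\pi)^{2l}}{(\omega_nV)^{\frac{2l}{n}}}k^{\frac{2l+n}{n}}+\frac{nl}{12\rho^{2}}\omega_n^{-\frac{2l-2}{n}}\alpha^{\frac{2n-2l+2}{n}}k^{\frac{2l+n-2}{n}}+ \tilde{C}_1k^{\frac{2l+n-3}{n}}+ \tilde{C}_2 k^{\frac{2l+n-4}{n}}+\tilde{C}_3k^{\frac{2l+n-5}{n}},$$ where $$\tilde{C}_1=-\frac{n(12l+7n-13)(2l+n-1)}{48\rho^3\omega_n^{\frac{2l-3}{n}}}\alpha^{\frac{-2l+3n+3}{n}},$$ $$\tilde{C}_2=\frac{n(2l+2n-3)(2l+n-1)(2l+n-2)}{96\rho^4\omega_n^{\frac{2l-4}{n}}}\alpha^{\frac{-2l+4n+4}{n}},$$ $$\tilde{C}_3=-\frac{n(2l+n-1)(2l+n-2)(2l+n-3)(2l+n-4)}{288\rho^5\omega_n^{\f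rac{2l-5}{n}}}\alpha^{\frac{-2l+5n+5}{n}}.$$
   Context: Eigenvalue problem: $(-\Delta)^l u=\lambda^{(l)}u$ in $\Omega$, $u=\frac{\partial u}{\partial\nu}=\cdots=\frac{\partial^{l-1}u}{\partial\nu^{l-1}}=0$ on $\partial\Omega$ (Dirichlet conditions, understood in the usual weak sense $u\in H^l_0(\Omega)$). The spectrum is real and discrete, $0<\lambda^{(l)}_1\le\lambda^{(l)}_2\le\cdots\to\infty$, each eigenvalue repeated according to its finite multiplicity. Notation: $V=V(\Omega)$ is the volume of $\Omega$; $\omega_n$ is the volume of the unit ball of $\mathbb{R}^n$; $I=I(\Omega)=\int_\Omega|x|^2dx$; $\alpha=(2\pi)^{-n}V$; $\rho=2(2\pi)^{-n}\sqrt{VI}$; $C^m_n=\frac{n!}{m!(n-m)!}$ is the binomial coefficient. Constants: $$\tilde{k}_1=\frac{9375}{149n(n-1)^3}\max_{4\leq i\leq n+1}C^i_{n+1},\qquad \tilde{k}_2=\frac{50}{317\tilde{c}_1}\max_{6\leq i\leq n+1}C^i_{n+1},\qquad \tilde c_1=\frac{(n-1)(n-3)(2n+1)}{576000000},$$ $$\tilde{k}_3=\frac{\omega_n^2}{(4\pi)^n}\left(\frac{n+2}{n}\right)^{\frac n2}\max_{1\leq i\leq 2l+n-1}\{c_{i,2l+n},c_{i,2l+n-1},c_{i,2l+n-2}\},$$ where for $a\in\{2l+n,2l+n-1,2l+n-2\}$ $$c_{i,a}=\left(\frac{n-1}{24\bar t_1}\frac{C^{i+1}_{a}}{C^i_{a}}+\frac12\right)^n,\qquad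 \bar t_1=\frac{4\pi}{\omega_n^{2/n}}\left(\frac{n}{n+2}\right)^{\frac12},$$ $$\tilde{k}_4=\frac{\omega_n^2}{(4\pi)^n}\left(\frac{n+2}{n}\right)^{\frac n2}\max_{1\leq i\leq 2l+n-1}\left\{\left(\frac{C^{i+1}_{2l+n}}{2C^i_{2l+n}}\right)^n,\left(\frac{C^{i+1}_{2l+n-1}}{2C^i_{2l+n-1}}\right)^n,\left(\frac{C^{i+1}_{2l+n-2}}{2C^i_{2l+n-2}}\right)^n\right\}.$$ Here $C^{m}_{a}=0$ for $m>a$, and in the maxima terms with a zero denominator ($C^i_a$ with $i>a$) are omitted. *)

theory Defs
  imports "HOL-Analysis.Analysis"
begin

section \<open>Test functions and Sobolev spaces\<close>

definition partial_deriv :: "'n::finite \<Rightarrow> (real^'n \<Rightarrow> real) \<Rightarrow> real^'n \<Rightarrow> real" where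
  "partial_deriv i f x = frechet_derivative f (at x) (axis i 1)"

text \<open>A multi-index of order \<open>m\<close> is encoded as a list of \<open>m\<close> coordinate directions; the order of
  the entries is immaterial for the smooth functions to which this is applied.\<close>

definition partial_derivs :: "'n::finite list \<Rightarrow> (real^'n \<Rightarrow> real) \<Rightarrow> real^'n \<Rightarrow> real" where
  "partial_derivs is f = foldr partial_deriv is f"

text \<open>All iterated partial derivatives exist and are (totally) differentiable, hence continuous:
  this is \<open>C\<^sup>\<infinity>\<close>.\<close>

definition smooth :: "(real^'n::finite \<Rightarrow> real) \<Rightarrow> bool" where
  "smooth f \<longleftrightarrow> (\<forall>is. partial_derivs is f differentiable_on UNIV)"

definition test_function :: "(real^'n::finite) set \<Rightarrow> (real^'n \<Rightarrow> real) \<Rightarrow> bool" where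
  "test_function \<Omega> \<phi> \<longleftrightarrow>
     smooth \<phi> \<and> compact (closure {x. \<phi> x \<noteq> 0}) \<and> closure {x. \<phi> x \<noteq> 0} \<subseteq> \<Omega>"

text \<open>Elements of \<open>L\<^sup>2\<close> are represented by functions on the whole space of which only the values
  on \<open>\<Omega>\<close> matter; equality in \<open>L\<^sup>2\<close> is equality almost everywhere on \<open>\<Omega>\<close>.\<close>

definition L2 :: "(real^'n::finite) set \<Rightarrow> (real^'n \<Rightarrow> real) set" where
  "L2 \<Omega> = {u. u \<in> borel_measurable (lebesgue_on \<Omega>) \<and> integrable (lebesgue_on \<Omega>) (\<lambda>x. (u x)\<^sup>2)}"

definition weak_deriv ::
  "(real^'n::finite) set \<Rightarrow> 'n list \<Rightarrow> (real^'n \<Rightarrow> real) \<Rightarrow> (real^'n \<Rightarrow> real) \<Rightarrow> bool" where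
  "weak_deriv \<Omega> is u v \<longleftrightarrow>
     (\<forall>\<phi>. test_function \<Omega> \<phi> \<longrightarrow>
        (LINT x|lebesgue_on \<Omega>. u x * partial_derivs is \<phi> x) =
        (-1) ^ length is * (LINT x|lebesgue_on \<Omega>. v x * \<phi> x))"

definition sobolev_H :: "nat \<Rightarrow> (real^'n::finite) set \<Rightarrow> (real^'n \<Rightarrow> real) set" where
  "sobolev_H l \<Omega> =
     {u \<in> L2 \<Omega>. \<forall>is. length is \<le> l \<longrightarrow> (\<exists>v\<in>L2 \<Omega>. weak_deriv \<Omega> is u v)}"

text \<open>The closure of the test functions in the norm of \<open>sobolev_H l \<Omega>\<close>.\<close>

definition sobolev_H0 :: "nat \<Rightarrow> (real^'n::finite) set \<Rightarrow> (real^'n \<Rightarrow> real) set" where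
  "sobolev_H0 l \<Omega> =
     {u \<in> sobolev_H l \<Omega>. \<exists>\<phi> :: nat \<Rightarrow> real^'n \<Rightarrow> real. (\<forall>j. test_function \<Omega> (\<phi> j)) \<and>
        (\<forall>is. length is \<le> l \<longrightarrow> (\<forall>v\<in>L2 \<Omega>. weak_deriv \<Omega> is u v \<longrightarrow>
           (\<lambda>j. LINT x|lebesgue_on \<Omega>. (partial_derivs is (\<phi> j) x - v x)\<^sup>2) \<longlonglongrightarrow> 0))}"


section \<open>Dirichlet eigenvalues of the poly-Laplacian\<close>

definition neg_laplacian :: "(real^'n::finite \<Rightarrow> real) \<Rightarrow> real^'n \<Rightarrow> real" where
  "neg_laplacian f x = - (\<Sum>i\<in>UNIV. partial_deriv i (partial_deriv i f) x)"

text \<open>The weak solutions \<open>u\<close> in \<open>sobolev_H0 l \<Omega>\<close> of \<open>(-\<Delta>)\<^sup>l u = \<mu> u\<close> in \<open>\<Omega>\<close>, the zero function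
  included; the equation is tested against \<open>C\<^sub>c\<^sup>\<infinity>(\<Omega>)\<close>.\<close>

definition eigenspace :: "nat \<Rightarrow> (real^'n::finite) set \<Rightarrow> real \<Rightarrow> (real^'n \<Rightarrow> real) set" where
  "eigenspace l \<Omega> \<mu> =
     {u \<in> sobolev_H0 l \<Omega>. \<forall>\<phi>. test_function \<Omega> \<phi> \<longrightarrow>
        (LINT x|lebesgue_on \<Omega>. u x * (neg_laplacian ^^ l) \<phi> x) =
        \<mu> * (LINT x|lebesgue_on \<Omega>. u x * \<phi> x)}"

text \<open>\<open>E\<close>, taken modulo almost everywhere equality on \<open>\<Omega>\<close>, has a basis with \<open>m\<close> elements.\<close>

definition has_ae_dim :: "(real^'n::finite) set \<Rightarrow> (real^'n \<Rightarrow> real) set \<Rightarrow> nat \<Rightarrow> bool" where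
  "has_ae_dim \<Omega> E m \<longleftrightarrow>
     (\<exists>b :: nat \<Rightarrow> real^'n \<Rightarrow> real.
        (\<forall>j<m. b j \<in> E) \<and>
        (\<forall>u\<in>E. \<exists>c. AE x in lebesgue_on \<Omega>. u x = (\<Sum>j<m. c j * b j x)) \<and>
        (\<forall>c. (AE x in lebesgue_on \<Omega>. (\<Sum>j<m. c j * b j x) = 0) \<longrightarrow> (\<forall>j<m. c j = 0)))"

text \<open>\<open>\<Lambda> 1 \<le> \<Lambda> 2 \<le> \<dots>\<close> lists all eigenvalues, each as often as its (finite) multiplicity; a real
  number that is not an eigenvalue has multiplicity 0 and does not occur. The value \<open>\<Lambda> 0\<close> is
  irrelevant.\<close>

definition dirichlet_eigenvalues :: "nat \<Rightarrow> (real^'n::finite) set \<Rightarrow> (nat \<Rightarrow> real) \<Rightarrow> bool" where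
  "dirichlet_eigenvalues l \<Omega> \<Lambda> \<longleftrightarrow>
     mono_on {1..} \<Lambda> \<and>
     (\<forall>\<mu>. finite {i. 1 \<le> i \<and> \<Lambda> i = \<mu>} \<and>
          has_ae_dim \<Omega> (eigenspace l \<Omega> \<mu>) (card {i. 1 \<le> i \<and> \<Lambda> i = \<mu>}))"


section \<open>Geometric quantities\<close>

text \<open>The volume \<open>\<omega>\<^sub>n\<close> of the unit ball is \<open>unit_ball_vol n\<close> from the library.\<close>

definition vol :: "(real^'n::finite) set \<Rightarrow> real" where
  "vol \<Omega> = measure lebesgue \<Omega>"

definition second_moment :: "(real^'n::finite) set \<Rightarrow> real" where
  "second_moment \<Omega> = (LINT x|lebesgue_on \<Omega>. (norm x)\<^sup>2)"

definition alpha :: "(real^'n::finite) set \<Rightarrow> real" where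
  "alpha \<Omega> = vol \<Omega> / (2 * pi) ^ CARD('n)"

definition rho :: "(real^'n::finite) set \<Rightarrow> real" where
  "rho \<Omega> = 2 / (2 * pi) ^ CARD('n) * sqrt (vol \<Omega> * second_moment \<Omega>)"


section \<open>The constants in the threshold for the number of eigenvalues\<close>

definition k1 :: "nat \<Rightarrow> real" where
  "k1 n = 9375 / (149 * real n * (real n - 1) ^ 3) * Max {real ((n + 1) choose i) | i. i \<in> {4..n + 1}}"

definition c1 :: "nat \<Rightarrow> real" where
  "c1 n = (real n - 1) * (real n - 3) * (2 * real n + 1) / 576000000"

definition k2 :: "nat \<Rightarrow> real" where
  "k2 n = 50 / (317 * c1 n) * Max {real ((n + 1) choose i) | i. i \<in> {6..n + 1}}"

definition t1 :: "nat \<Rightarrow> real" where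
  "t1 n = 4 * pi / unit_ball_vol n powr (2 / real n) * sqrt (real n / (real n + 2))"

definition c_coeff :: "nat \<Rightarrow> nat \<Rightarrow> nat \<Rightarrow> real" where
  "c_coeff n i a =
     ((real n - 1) / (24 * t1 n) * (real (a choose (i + 1)) / real (a choose i)) + 1 / 2) ^ n"

text \<open>The side condition \<open>a choose i \<noteq> 0\<close> drops the terms with a vanishing denominator.\<close>

definition k3 :: "nat \<Rightarrow> nat \<Rightarrow> real" where
  "k3 n l = (unit_ball_vol n)\<^sup>2 / (4 * pi) ^ n * ((real n + 2) / real n) powr (real n / 2) *
     Max {c_coeff n i a | i a. i \<in> {1..2 * l + n - 1} \<and>
            a \<in> {2 * l + n, 2 * l + n - 1, 2 * l + n - 2} \<and> a choose i \<noteq> 0}"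

definition k4 :: "nat \<Rightarrow> nat \<Rightarrow> real" where
  "k4 n l = (unit_ball_vol n)\<^sup>2 / (4 * pi) ^ n * ((real n + 2) / real n) powr (real n / 2) *
     Max {(real (a choose (i + 1)) / (2 * real (a choose i))) ^ n | i a. i \<in> {1..2 * l + n - 1} \<and>
            a \<in> {2 * l + n, 2 * l + n - 1, 2 * l + n - 2} \<and> a choose i \<noteq> 0}"


section \<open>The coefficients of the lower order terms\<close>

definition C1 :: "nat \<Rightarrow> (real^'n::finite) set \<Rightarrow> real" where
  "C1 l \<Omega> = (let n = real CARD('n); l = real l; \<omega> = unit_ball_vol n in
     - (n * (12 * l + 7 * n - 13) * (2 * l + n - 1) / (48 * rho \<Omega> ^ 3 * \<omega> powr ((2 * l - 3) / n))) *
       alpha \<Omega> powr ((- 2 * l + 3 * n + 3) / n))"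

definition C2 :: "nat \<Rightarrow> (real^'n::finite) set \<Rightarrow> real" where
  "C2 l \<Omega> = (let n = real CARD('n); l = real l; \<omega> = unit_ball_vol n in
     n * (2 * l + 2 * n - 3) * (2 * l + n - 1) * (2 * l + n - 2) /
       (96 * rho \<Omega> ^ 4 * \<omega> powr ((2 * l - 4) / n)) *
       alpha \<Omega> powr ((- 2 * l + 4 * n + 4) / n))"

definition C3 :: "nat \<Rightarrow> (real^'n::finite) set \<Rightarrow> real" where
  "C3 l \<Omega> = (let n = real CARD('n); l = real l; \<omega> = unit_ball_vol n in
     - (n * (2 * l + n - 1) * (2 * l + n - 2) * (2 * l + n - 3) * (2 * l + n - 4) /
       (288 * rho \<Omega> ^ 5 * \<omega> powr ((2 * l - 5) / n))) *
       alpha \<Omega> powr ((- 2 * l + 5 * n + 5) / n))"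

end

theory Submission
  imports Defs "HOL-Probability.Characteristic_Functions"
begin

text \<open>
  Let \<open>u\<^sub>1, \<dots>, u\<^sub>k\<close> be orthonormal eigenfunctions, extended by zero, and let \<open>f(\<xi>)\<close> be \<open>(2\<pi>)\<^sup>-\<^sup>n\<close> times the sum of
  the squared moduli of their Fourier transforms at \<open>\<xi>\<close>. Bessel's inequality applied to plane waves on \<open>\<Omega>\<close> shows that
  \<open>0 \<le> f \<le> \<alpha>\<close> and that \<open>f\<close> is \<open>\<rho>\<close>-Lipschitz; Plancherel's theorem gives \<open>\<integral>f = k\<close> and
  \<open>\<integral>|\<xi>|\<^sup>2\<^sup>l f = \<Lambda>\<^sub>1 + \<dots> + \<Lambda>\<^sub>k\<close>. Under these constraints the moment \<open>\<integral>|\<xi>|\<^sup>2\<^sup>l f\<close> is at least that of the radial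
  function of the same mass which is \<open>\<alpha>\<close> for \<open>|\<xi>| \<le> t\<close> and then decreases with slope \<open>\<rho>\<close> to \<open>0\<close>: along every ray
  the difference of the two is nonnegative beyond the ramp, nonpositive before it and nondecreasing on it, so that no
  rearrangement of \<open>f\<close> is necessary. The moments of the ramp are means of powers over an interval of
  length \<open>\<delta> = \<alpha> / \<rho>\<close>, and a Taylor expansion compares the mean of the power \<open>n + 2l\<close> with the mean of the
  power \<open>n\<close>. The moment \<open>I(\<Omega>)\<close> is at least that of a ball, hence \<open>k \<ge> k4\<close> bounds \<open>\<delta>\<close> in terms of \<open>k\<close>, which is
  what makes the terms of higher order absorb the error.
\<close>


section \<open>Means of powers over an interval\<close>

text \<open>The governing length is \<open>x\<close>, the radius of the ball on which the constant
  density \<alpha> has mass \<open>k\<close>. In units of \<open>x\<close> the ramp has width e =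
  \<alpha> / (\<rho> x), and the claimed bound becomes \<omega> \<alpha> x^(n+2l) times a polynomial
  of degree 5 in e. When the mean of the n-th power is normalized to 1, the quadratic term comes
  from e^2/12, the least mean of (s - 1)^2 over an interval of length e, and it is matched exactly.
  The claimed cubic term is more negative than Taylor's formula demands; the surplus pays for the
  positive quartic term while (n + 2l - 1) e \<le> 4, and the entry i = 1, a = 2l + n of the maximum
  in \<open>k4\<close> gives precisely this smallness. The analytic obstacle is that eigenfunctions
  are given weakly and modulo null sets. Each is replaced by a family of Borel functions, itself and
  all its derivatives up to order l, approximated simultaneously by one sequence of test functions.
  Continuity of translations and the transforms of derivatives are known for test functions and pass
  to the limit in L2.\<close>

lemma power_gap_taylor:
  fixes n p :: nat and s :: real
  assumes "3 \<le> n" "n \<le> p" "0 < s"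
  defines "h \<equiv> \<lambda>s. real n * s ^ p - real p * s ^ n + (real p - real n)
                      - real n * real p * (real p - real n) / 2 * (s - 1)\<^sup>2"
  shows "\<exists>u. (if s \<le> 1 then s \<le> u \<and> u \<le> 1 else 1 \<le> u \<and> u \<le> s) \<and>
     h s = (real n * real p * ((real p - 1) * (real p - 2) * u ^ (p - 3) - (real n - 1) * (real n - 2) * u ^ (n - 3))) / 6 * (s - 1) ^ 3"
proof (cases "s = 1")
  case True
  then show ?thesis by (auto simp: h_def)
next
  case False
  \<comment> \<open>The derivatives of \<open>h\<close> up to the third. Those of order 0, 1 and 2
    vanish at 1, so Taylor's formula around 1 leaves only the remainder.\<close>
  define D where "D = (\<lambda>m::nat. if m = 0 then h else
     if m = 1 then (\<lambda>s. real n * real p * s ^ (p - 1) - real p * real n * s ^ (n - 1) - real n * real p * (real p - real n) * (s - 1)) else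
     if m = 2 then (\<lambda>s. real n * real p * ((real p - 1) * s ^ (p - 2) - (real n - 1) * s ^ (n - 2)) - real n * real p * (real p - real n))
     else (\<lambda>s. real n * real p * ((real p - 1) * (real p - 2) * s ^ (p - 3) - (real n - 1) * (real n - 2) * s ^ (n - 3))))"
  \<comment> \<open>All truncated subtractions here are genuine because 3 \<le> n \<le> p.\<close>
  have e: "real (p - 1) = real p - 1" "real (p - 2) = real p - 2" "real (n - 1) = real n - 1" "real (n - 2) = real n - 2"
    "real (p - Suc 0) = real p - 1" "real (n - Suc 0) = real n - 1"
    "p - 2 - Suc 0 = p - 3" "n - 2 - Suc 0 = n - 3" "p - Suc 0 - Suc 0 = p - 2" "n - Suc 0 - Suc 0 = n - 2"
    "p - Suc (Suc 0) = p - 2" "n - Suc (Suc 0) = n - 2"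
    "p - Suc (Suc (Suc 0)) = p - 3" "n - Suc (Suc (Suc 0)) = n - 3"
    using assms by (auto simp: of_nat_diff)
  have d: "DERIV (D m) x :> D (Suc m) x" if "m < 3" for m x
  proof -
    consider "m = 0" | "m = 1" | "m = 2" using \<open>m < 3\<close> by linarith
    then show ?thesis
    proof cases
      case 1
      show ?thesis unfolding 1 D_def h_def
        by (auto intro!: derivative_eq_intros simp: field_simps)
    next
      case 2
      show ?thesis unfolding 2 D_def
        by (auto intro!: derivative_eq_intros simp: e algebra_simps)
    next
      case 3
      show ?thesis unfolding 3 D_def
        by (auto intro!: derivative_eq_intros simp: e algebra_simps)
    qed
  qed
  have z: "D 0 1 = 0" "D 1 1 = 0" "D 2 1 = 0"
    using assms by (auto simp: D_def h_def algebra_simps)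
  from Taylor[of 3 D h "min s 1" "max s 1" 1 s] d False
  obtain u where u: "(if s < 1 then s < u \<and> u < 1 else 1 < u \<and> u < s)"
    "h s = (\<Sum>m<3. D m 1 / fact m * (s - 1) ^ m) + D 3 u / fact 3 * (s - 1) ^ 3"
    by (auto simp: D_def)
  have "h s = D 3 u / fact 3 * (s - 1) ^ 3"
    using u(2) z by (simp add: eval_nat_numeral)
  then show ?thesis using u(1) unfolding D_def
    by (intro exI[of _ u]) (auto simp: fact_numeral split: if_splits)
qed

text \<open>Averaged over an interval on which \<open>s ^ n\<close> has mean 1, the left side is n
  times the excess over 1 of the mean of \<open>s ^ p\<close>; hence the interest in a pointwise
  bound. Measuring the error from the right endpoint \<open>R\<close> instead of from 1 makes its
  integral depend on the length of the interval alone, wherever 1 lies inside.\<close>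

lemma power_taylor_ge:
  fixes n p :: nat and s R :: real
  assumes "3 \<le> n" "n \<le> p" "0 < s" "s \<le> R" "1 \<le> R"
  shows "real n * s ^ p - real p * s ^ n + (real p - real n)
       \<ge> real n * real p * (real p - real n) / 2 * (s - 1)\<^sup>2
         - real n * real p * (real p - 1) * (real p - 2) / 6 * (R - s) ^ 3"
proof -
  define h where "h = real n * s ^ p - real p * s ^ n + (real p - real n)
       - real n * real p * (real p - real n) / 2 * (s - 1)\<^sup>2"
  obtain u where u: "if s \<le> 1 then s \<le> u \<and> u \<le> 1 else 1 \<le> u \<and> u \<le> s"
    and hs: "h = (real n * real p * ((real p - 1) * (real p - 2) * u ^ (p - 3) - (real n - 1) * (real n - 2) * u ^ (n - 3))) / 6 * (s - 1) ^ 3"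
    using power_gap_taylor[OF assms(1-3)] unfolding h_def by auto
  define Q where "Q = (real p - 1) * (real p - 2) * u ^ (p - 3) - (real n - 1) * (real n - 2) * u ^ (n - 3)"
  have K0: "0 \<le> real n * real p * (real p - 1) * (real p - 2) / 6"
    using assms by auto
  \<comment> \<open>Left of 1 the cube is negative, so \<open>Q\<close> is bounded from above: its
    n-part only lowers it and u \<le> 1 controls the p-part. Right of 1 both the cube and
    \<open>Q\<close> are nonnegative.\<close>
  have "h \<ge> - (real n * real p * (real p - 1) * (real p - 2) / 6 * (R - s) ^ 3)"
  proof (cases "s \<le> 1")
    case True
    have "u \<ge> 0" "u \<le> 1" using u True assms by auto
    then have "u ^ (p - 3) \<le> 1" by (simp add: power_le_one)
    then have "(real p - 1) * (real p - 2) * u ^ (p - 3) \<le> (real p - 1) * (real p - 2) * 1"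
      using assms by (intro mult_left_mono) auto
    moreover have "0 \<le> (real n - 1) * (real n - 2) * u ^ (n - 3)"
      using assms \<open>u \<ge> 0\<close> by auto
    ultimately have Q: "Q \<le> (real p - 1) * (real p - 2)" unfolding Q_def by linarith
    have eq: "(s - 1) ^ 3 = - ((1 - s) ^ 3)" by (simp add: power3_eq_cube algebra_simps)
    have "real n * real p * Q / 6 * (1 - s) ^ 3 \<le> real n * real p * ((real p - 1) * (real p - 2)) / 6 * (1 - s) ^ 3"
      using Q True assms by (intro mult_right_mono divide_right_mono mult_left_mono) auto
    also have "\<dots> \<le> real n * real p * ((real p - 1) * (real p - 2)) / 6 * (R - s) ^ 3"
      using True assms by (intro mult_left_mono power_mono) auto
    finally show ?thesis unfolding hs eq Q_def[symmetric] by (simp add: mult.assoc)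
  next
    case False
    then have "u \<ge> 1" using u by auto
    then have "u ^ (n - 3) \<le> u ^ (p - 3)" using assms by (intro power_increasing) auto
    moreover have "(real n - 1) * (real n - 2) \<le> (real p - 1) * (real p - 2)"
      using assms by (intro mult_mono) auto
    ultimately have "Q \<ge> 0" unfolding Q_def using assms \<open>u \<ge> 1\<close> by (simp add: mult_mono)
    then have "h \<ge> 0" unfolding hs Q_def[symmetric] using False by auto
    moreover have "real n * real p * (real p - 1) * (real p - 2) / 6 * (R - s) ^ 3 \<ge> 0"
      using K0 assms by auto
    ultimately show ?thesis by linarith
  qed
  then show ?thesis unfolding h_def by linarith
qed

text \<open>The equation says that \<open>s ^ n\<close> has mean 1 over \<open>[a, a + e]\<close>.
  By Bernoulli's inequality the mean is at most 1 for a = 1 - e and at least 1 for a = 1; a position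
  in between exists by the intermediate value theorem and keeps 1 inside the interval.\<close>

lemma unit_mean_power_exists:
  fixes e :: real
  assumes "0 < e" "e < 1"
  obtains a where "0 < a" "a \<le> 1" "1 \<le> a + e" "(a + e) ^ Suc n - a ^ Suc n = (real n + 1) * e"
proof -
  let ?g = "\<lambda>a. (a + e) ^ Suc n - a ^ Suc n"
  have "1 + real (Suc n) * (- e) \<le> (1 + (- e)) ^ Suc n"
    using assms by (intro Bernoulli_inequality) auto
  then have 1: "?g (1 - e) \<le> (real n + 1) * e" by (simp add: algebra_simps)
  have "1 + real (Suc n) * e \<le> (1 + e) ^ Suc n"
    using assms by (intro Bernoulli_inequality) auto
  then have 2: "(real n + 1) * e \<le> ?g 1" by (simp add: algebra_simps)
  have "\<exists>a. 1 - e \<le> a \<and> a \<le> 1 \<and> ?g a = (real n + 1) * e"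
    by (rule IVT'[of ?g, OF 1 2]) (use assms in \<open>auto intro!: continuous_intros\<close>)
  then show ?thesis using that assms by force
qed

lemma mean_power_ge:
  fixes n p :: nat and a e :: real
  assumes "3 \<le> n" "n \<le> p" "0 < a" "0 < e" "a \<le> 1" "1 \<le> a + e"
    and mean: "(a + e) ^ Suc n - a ^ Suc n = (real n + 1) * e"
  shows "((a + e) ^ Suc p - a ^ Suc p) / ((real p + 1) * e)
      \<ge> 1 + real p * (real p - real n) / 24 * e\<^sup>2 - real p * (real p - 1) * (real p - 2) / 24 * e ^ 3"
proof -
  define R where "R = a + e"
  define K where "K = real n * real p * (real p - 1) * (real p - 2) / 6"
  define A where "A = real n * real p * (real p - real n) / 2"
  \<comment> \<open>An antiderivative of the nonnegative difference of the two sides of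
    \<open>power_taylor_ge\<close>; its increase over \<open>[a, R]\<close> is the integrated
    bound.\<close>
  define G where "G = (\<lambda>s. real n * (s ^ Suc p / (real p + 1)) - real p * (s ^ Suc n / (real n + 1))
     + (real p - real n) * s - A * ((s - 1) ^ 3 / 3) - K * ((R - s) ^ 4 / 4))"
  have deriv: "(G has_real_derivative (real n * s ^ p - real p * s ^ n + (real p - real n)
      - A * (s - 1)\<^sup>2 + K * (R - s) ^ 3)) (at s)" for s
  proof -
    have pow: "((\<lambda>s. s ^ Suc m / (real m + 1)) has_real_derivative s ^ m) (at s)" for m
      by (rule DERIV_cong[OF DERIV_cdivide[OF DERIV_pow]]) (simp add: add.commute)
    define A' B' where "A' = (\<lambda>s. s ^ Suc p / (real p + 1))" and "B' = (\<lambda>s. s ^ Suc n / (real n + 1))"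
    have [derivative_intros]: "(A' has_real_derivative s ^ p) (at s)" "(B' has_real_derivative s ^ n) (at s)"
      unfolding A'_def B'_def by (rule pow)+
    have "((\<lambda>s. real n * A' s - real p * B' s + (real p - real n) * s - A * ((s - 1) ^ 3 / 3) - K * ((R - s) ^ 4 / 4))
      has_real_derivative (real n * s ^ p - real p * s ^ n + (real p - real n) - A * (s - 1)\<^sup>2 + K * (R - s) ^ 3)) (at s)"
      by (auto intro!: derivative_eq_intros)
    then show ?thesis unfolding G_def A'_def B'_def .
  qed
  have "G a \<le> G R"
  proof (rule DERIV_nonneg_imp_nondecreasing[of a R G])
    show "a \<le> R" using assms by (simp add: R_def)
    fix s assume s: "a \<le> s" "s \<le> R"
    have "real n * s ^ p - real p * s ^ n + (real p - real n)
      - A * (s - 1)\<^sup>2 + K * (R - s) ^ 3 \<ge> 0"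
      using power_taylor_ge[of n p s R] s assms unfolding A_def K_def R_def by auto
    with deriv show "\<exists>y. (G has_real_derivative y) (at s) \<and> 0 \<le> y" by blast
  qed
  define M where "M = ((a + e) ^ Suc p - a ^ Suc p) / ((real p + 1) * e)"
  have M: "R ^ Suc p / (real p + 1) - a ^ Suc p / (real p + 1) = M * e"
    using assms unfolding M_def R_def by (simp add: diff_divide_distrib[symmetric] del: power_Suc)
  have N: "R ^ Suc n / (real n + 1) - a ^ Suc n / (real n + 1) = e"
    using mean unfolding R_def by (simp add: diff_divide_distrib[symmetric])
  \<comment> \<open>Three times the integral of (s - 1)^2 over the interval. It is smallest when the
    interval is centred at 1, with value e^3/4.\<close>
  have c: "(R - 1) ^ 3 - (a - 1) ^ 3 \<ge> e ^ 3 / 4"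
  proof -
    have "(R - 1) ^ 3 - (a - 1) ^ 3 - e ^ 3 / 4 = 3 * e * (R - 1 - e / 2)\<^sup>2"
      unfolding R_def by (simp add: power2_eq_square power3_eq_cube field_simps)
    moreover have "\<dots> \<ge> 0" using assms by simp
    ultimately show ?thesis by linarith
  qed
  have A0: "A \<ge> 0" unfolding A_def using assms by auto
  have "0 \<le> G R - G a" using \<open>G a \<le> G R\<close> by simp
  also have "G R - G a = real n * (M * e) - real p * e + (real p - real n) * e
      - A * (((R - 1) ^ 3 - (a - 1) ^ 3) / 3) + K * e ^ 4 / 4"
  proof -
    have M': "R ^ Suc p / (real p + 1) = M * e + a ^ Suc p / (real p + 1)"
      and N': "R ^ Suc n / (real n + 1) = e + a ^ Suc n / (real n + 1)"
      using M N by linarith+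
    show ?thesis unfolding G_def M' N' by (simp add: R_def algebra_simps diff_divide_distrib del: power_Suc)
  qed
  also have "\<dots> \<le> real n * (M * e) - real p * e + (real p - real n) * e - A * (e ^ 3 / 4 / 3) + K * e ^ 4 / 4"
    using mult_left_mono[OF divide_right_mono[OF c, of 3] A0] by simp
  also have "\<dots> = real n * e * (M - (1 + real p * (real p - real n) / 24 * e\<^sup>2 - real p * (real p - 1) * (real p - 2) / 24 * e ^ 3))"
    unfolding A_def K_def by (simp add: field_simps eval_nat_numeral)
  finally have "0 \<le> real n * e * (M - (1 + real p * (real p - real n) / 24 * e\<^sup>2 - real p * (real p - 1) * (real p - 2) / 24 * e ^ 3))" .
  moreover have "0 < real n * e" using assms by simp
  ultimately show ?thesis unfolding M_def[symmetric] by (simp add: zero_le_mult_iff)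
qed

text \<open>In terms of P = n + 2l the quadratic coefficient is that of
  \<open>mean_power_ge\<close>. The cubic coefficient of the claim is larger than the one found
  there, and by \<open>small\<close> the difference absorbs the quartic term; the quintic term only
  lowers the right side.\<close>

lemma mean_power_ge_polynomial:
  fixes n l :: nat and a e :: real
  assumes n: "5 \<le> n" and l: "1 \<le> l" and "0 < a" "0 < e" "a \<le> 1" "1 \<le> a + e"
    and mean: "(a + e) ^ Suc n - a ^ Suc n = (real n + 1) * e"
    and small: "(2 * real l + real n - 1) * e \<le> 4"
  defines "N \<equiv> real n" and "L \<equiv> real l" and "p \<equiv> n + 2 * l"
  shows "N / (N + 2 * L) * (((a + e) ^ Suc p - a ^ Suc p) / ((real p + 1) * e))
      \<ge> N / (N + 2 * L) + N * L / 12 * e\<^sup>2 - N * (12 * L + 7 * N - 13) * (2 * L + N - 1) / 48 * e ^ 3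
        + N * (2 * L + 2 * N - 3) * (2 * L + N - 1) * (2 * L + N - 2) / 96 * e ^ 4
        - N * (2 * L + N - 1) * (2 * L + N - 2) * (2 * L + N - 3) * (2 * L + N - 4) / 288 * e ^ 5"
proof -
  define P where "P = real p"
  have P: "P = N + 2 * L" and P': "real p = P" by (simp_all add: P_def p_def N_def L_def)
  have NL: "N \<ge> 5" "L \<ge> 1" using n l by (simp_all add: N_def L_def)
  have Pe: "(P - 1) * e \<le> 4" using small by (simp add: P L_def N_def algebra_simps)
  define M where "M = ((a + e) ^ Suc p - a ^ Suc p) / ((real p + 1) * e)"
  have M: "M \<ge> 1 + P * (P - N) / 24 * e\<^sup>2 - P * (P - 1) * (P - 2) / 24 * e ^ 3"
    using mean_power_ge[of n p a e] assms(1-7) unfolding M_def P_def N_def by (auto simp: p_def)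
  have "N / P * M \<ge> N / P * (1 + P * (P - N) / 24 * e\<^sup>2 - P * (P - 1) * (P - 2) / 24 * e ^ 3)"
    using M NL P by (intro mult_left_mono) auto
  also have "N / P * (1 + P * (P - N) / 24 * e\<^sup>2 - P * (P - 1) * (P - 2) / 24 * e ^ 3)
      = N / P + N * L / 12 * e\<^sup>2 - N * (P - 1) * (P - 2) / 24 * e ^ 3"
    using NL P by (simp add: field_simps)
  finally have 1: "N / P * M \<ge> N / P + N * L / 12 * e\<^sup>2 - N * (P - 1) * (P - 2) / 24 * e ^ 3" .
  \<comment> \<open>In units of N (P - 1) e^3 / 96, the cubic term supplies 2 (6 P + N - 13) and the
    quartic term costs at most 4 (P + N - 3). What remains is at least 4 (P - 2), the cubic error of
    \<open>mean_power_ge\<close>.\<close>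
  have "(P - 2) * e \<le> 4" using Pe \<open>0 < e\<close> by (simp add: algebra_simps)
  then have "(P + N - 3) * ((P - 2) * e) \<le> (P + N - 3) * 4"
    using NL P by (intro mult_left_mono) auto
  then have "(6 * P + N - 13) * 2 - (P + N - 3) * ((P - 2) * e) \<ge> 4 * (P - 2)"
    using NL P by (simp add: algebra_simps)
  then have "N * (P - 1) * e ^ 3 / 96 * ((6 * P + N - 13) * 2 - (P + N - 3) * ((P - 2) * e)) \<ge> N * (P - 1) * e ^ 3 / 96 * (4 * (P - 2))"
    using NL P \<open>0 < e\<close> by (intro mult_left_mono) auto
  moreover have "N * (P - 1) * e ^ 3 / 96 * ((6 * P + N - 13) * 2 - (P + N - 3) * ((P - 2) * e))
      = N * (6 * P + N - 13) * (P - 1) / 48 * e ^ 3 - N * (P + N - 3) * (P - 1) * (P - 2) / 96 * e ^ 4"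
    by (simp add: eval_nat_numeral field_simps)
  ultimately have "N * (6 * P + N - 13) * (P - 1) / 48 * e ^ 3 - N * (P + N - 3) * (P - 1) * (P - 2) / 96 * e ^ 4
      \<ge> N * (P - 1) * e ^ 3 / 96 * (4 * (P - 2))"
    by linarith
  also have "N * (P - 1) * e ^ 3 / 96 * (4 * (P - 2)) = N * (P - 1) * (P - 2) / 24 * e ^ 3"
    by simp
  finally have 2: "N * (6 * P + N - 13) * (P - 1) / 48 * e ^ 3 - N * (P + N - 3) * (P - 1) * (P - 2) / 96 * e ^ 4
      \<ge> N * (P - 1) * (P - 2) / 24 * e ^ 3" .
  have 3: "N * (P - 1) * (P - 2) * (P - 3) * (P - 4) / 288 * e ^ 5 \<ge> 0"
    using NL P \<open>0 < e\<close> by auto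
  have eqs: "12 * L + 7 * N - 13 = 6 * P + N - 13" "2 * L + N - 1 = P - 1" "2 * L + 2 * N - 3 = P + N - 3"
    "2 * L + N - 2 = P - 2" "2 * L + N - 3 = P - 3" "2 * L + N - 4 = P - 4" "N + 2 * L = P"
    by (simp_all add: P)
  show ?thesis unfolding eqs M_def[symmetric] using 1 2 3 by linarith
qed

section \<open>The threshold for k and the arithmetic of the final bound\<close>

text \<open>The entry \<open>i = 1\<close>, \<open>a = 2 * l + n\<close> of the maximum equals the
  n-th power of (a - 1)/4, because C(a,2) / (2 C(a,1)) = (a - 1)/4.\<close>

lemma k4_ge:
  assumes "1 \<le> l"
  shows "k4 n l \<ge> (unit_ball_vol n)\<^sup>2 / (4 * pi) ^ n * ((real n + 2) / real n) powr (real n / 2) * ((2 * real l + real n - 1) / 4) ^ n"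
proof -
  let ?S = "{(real (a choose (i + 1)) / (2 * real (a choose i))) ^ n | i a. i \<in> {1..2 * l + n - 1} \<and>
            a \<in> {2 * l + n, 2 * l + n - 1, 2 * l + n - 2} \<and> a choose i \<noteq> 0}"
  have "?S \<subseteq> (\<lambda>(i, a). (real (a choose (i + 1)) / (2 * real (a choose i))) ^ n) ` ({1..2 * l + n - 1} \<times> {2 * l + n, 2 * l + n - 1, 2 * l + n - 2})"
    by auto
  then have fin: "finite ?S" by (rule finite_subset) auto
  have "(real ((2 * l + n) choose (1 + 1)) / (2 * real ((2 * l + n) choose 1))) ^ n \<in> ?S"
    using assms by (intro CollectI exI[of _ "1::nat"] exI[of _ "2 * l + n"]) auto
  then have le: "(real ((2 * l + n) choose (1 + 1)) / (2 * real ((2 * l + n) choose 1))) ^ n \<le> Max ?S"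
    using fin by (rule Max_ge[rotated])
  have eq: "real ((2 * l + n) choose (1 + 1)) / (2 * real ((2 * l + n) choose 1)) = (2 * real l + real n - 1) / 4"
  proof -
    have "2 * real (m choose 2) = real m * (real m - 1)" for m :: nat
      by (induction m) (auto simp: numeral_2_eq_2 algebra_simps)
    from this[of "2 * l + n"] show ?thesis using assms by (simp add: numeral_2_eq_2 field_simps)
  qed
  have "0 \<le> (unit_ball_vol n)\<^sup>2 / (4 * pi) ^ n * ((real n + 2) / real n) powr (real n / 2)" by simp
  from mult_left_mono[OF le[unfolded eq] this] show ?thesis unfolding k4_def .
qed

text \<open>Once the number of eigenvalues is written as \<omega> \<alpha> x^n, the exponents of
  \<omega> add up to 1, those of \<alpha> to j + 1 and those of x to n + 2L - j. This homogeneity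
  explains the exponents in \<open>C1\<close>, \<open>C2\<close> and \<open>C3\<close>.\<close>

lemma powr_scaling_term:
  fixes \<omega> \<alpha> x n L :: real and j m :: nat
  assumes "0 < \<omega>" "0 < \<alpha>" "0 < x" "0 < n" "real m = 2 * L + n - real j"
  shows "\<omega> powr (- ((2 * L - real j) / n)) * \<alpha> powr ((- 2 * L + real j * n + real j) / n)
      * (\<omega> * \<alpha> * x powr n) powr ((2 * L + n - real j) / n) = \<omega> * \<alpha> ^ Suc j * x ^ m"
proof -
  define q where "q = (2 * L + n - real j) / n"
  define u v where "u = - ((2 * L - real j) / n)" and "v = (- 2 * L + real j * n + real j) / n"
  have e: "n * q = real m" "u + q = 1" "v + q = real (Suc j)"
    using assms by (simp add: q_def, simp_all add: q_def u_def v_def field_simps)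
  have "\<omega> powr u * \<alpha> powr v * (\<omega> * \<alpha> * x powr n) powr q = \<omega> powr u * \<alpha> powr v * (\<omega> powr q * \<alpha> powr q * x powr (n * q))"
    using assms by (simp add: powr_mult powr_powr)
  also have "\<dots> = \<omega> powr (u + q) * \<alpha> powr (v + q) * x powr (n * q)"
    by (simp add: powr_add mult_ac)
  also have "\<dots> = \<omega> * \<alpha> ^ Suc j * x ^ m"
    using assms(1-3) unfolding e by (simp add: powr_realpow del: of_nat_Suc power_Suc)
  finally show ?thesis by (simp only: q_def u_def v_def)
qed

text \<open>The passage from the ramp to the closed formula is pure arithmetic: \<open>S\<close>
  stands for the sum of eigenvalues, \<open>r\<close> for the radius of the ball of volume
  \<open>V\<close>, and the last hypothesis is the moment bound for every ramp of mass
  \<open>K\<close>.\<close>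

lemma eigenvalue_sum_bound_from_ramp:
  fixes n l k :: nat and V I S r :: real
  defines "\<omega> \<equiv> unit_ball_vol (real n)" and "p \<equiv> n + 2 * l"
  defines "\<alpha> \<equiv> V / (2 * pi) ^ n" and "\<rho> \<equiv> 2 / (2 * pi) ^ n * sqrt (V * I)"
  defines "N \<equiv> real n" and "L \<equiv> real l" and "K \<equiv> real k"
  assumes n: "5 \<le> n" and l: "1 \<le> l" and k: "1 \<le> k" "real k \<ge> k4 n l"
    and r: "0 < r" and V: "V = \<omega> * r ^ n" and I: "I \<ge> N / (N + 2) * V * r\<^sup>2"
    and S: "\<And>t R. 0 < t \<Longrightarrow> t < R \<Longrightarrow> \<alpha> = \<rho> * (R - t) \<Longrightarrow> K = \<omega> * \<rho> * (R ^ Suc n - t ^ Suc n) / (N + 1) \<Longrightarrow>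
      S \<ge> N / real p * \<omega> * \<rho> * (R ^ Suc p - t ^ Suc p) / (real p + 1)"
  shows "S \<ge> N / (N + 2 * L) * ((2 * pi) ^ (2 * l) / (\<omega> * V) powr (2 * L / N)) * K powr ((2 * L + N) / N)
      + N * L / (12 * \<rho>\<^sup>2) * \<omega> powr (- ((2 * L - 2) / N)) * \<alpha> powr ((2 * N - 2 * L + 2) / N) * K powr ((2 * L + N - 2) / N)
      + - (N * (12 * L + 7 * N - 13) * (2 * L + N - 1) / (48 * \<rho> ^ 3 * \<omega> powr ((2 * L - 3) / N))) *
       \<alpha> powr ((- 2 * L + 3 * N + 3) / N) * K powr ((2 * L + N - 3) / N)
      + N * (2 * L + 2 * N - 3) * (2 * L + N - 1) * (2 * L + N - 2) /
       (96 * \<rho> ^ 4 * \<omega> powr ((2 * L - 4) / N)) *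
       \<alpha> powr ((- 2 * L + 4 * N + 4) / N) * K powr ((2 * L + N - 4) / N)
      + - (N * (2 * L + N - 1) * (2 * L + N - 2) * (2 * L + N - 3) * (2 * L + N - 4) /
       (288 * \<rho> ^ 5 * \<omega> powr ((2 * L - 5) / N))) *
       \<alpha> powr ((- 2 * L + 5 * N + 5) / N) * K powr ((2 * L + N - 5) / N)"
proof -
  have \<omega>: "0 < \<omega>" by (simp add: \<omega>_def)
  have V0: "0 < V" using \<omega> r V by simp
  have I0: "0 < I" 
  proof -
    have "0 < N / (N + 2) * V * r\<^sup>2" using n r V0 by (simp add: N_def)
    then show ?thesis using I by linarith
  qed
  have \<alpha>: "0 < \<alpha>" and \<rho>: "0 < \<rho>" using V0 I0 by (simp_all add: \<alpha>_def \<rho>_def)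
  have K0: "0 < K" using k by (simp add: K_def)
  have N5: "N \<ge> 5" and L1: "L \<ge> 1" using n l by (simp_all add: N_def L_def)
  \<comment> \<open>The radius of the ball on which the constant density \<alpha> has mass
    \<open>K\<close>.\<close>
  define x where "x = (K / (\<omega> * \<alpha>)) powr (1 / N)"
  have x0: "0 < x" using K0 \<omega> \<alpha> by (simp add: x_def)
  have xN: "x powr N = K / (\<omega> * \<alpha>)" using K0 \<omega> \<alpha> N5 by (simp add: x_def powr_powr)
  then have Kx: "K = \<omega> * \<alpha> * x powr N" using \<omega> \<alpha> by simp
  have xn: "x ^ n = K / (\<omega> * \<alpha>)" using xN x0 by (simp add: N_def powr_realpow)
  then have Kxn: "K = \<omega> * \<alpha> * x ^ n" using \<omega> \<alpha> by simp
  \<comment> \<open>The width \<alpha> / \<rho> of the ramp in units of \<open>x\<close>.\<close>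
  define e where "e = \<alpha> / (\<rho> * x)"
  have e0: "0 < e" using \<alpha> \<rho> x0 by (simp add: e_def)
  have \<rho>e: "\<rho> * e * x = \<alpha>" using \<rho> x0 by (simp add: e_def)
  define w where "w = sqrt ((N + 2) / N)"
  have w0: "0 < w" using N5 by (simp add: w_def)
  \<comment> \<open>As \<open>I\<close> is at least the second moment of the ball of radius
    \<open>r\<close>, the slope satisfies \<rho> \<ge> 2 r \<alpha> / w.\<close>
  have ele: "e \<le> w / (2 * r * x)"
  proof -
    have "\<rho> = 2 * \<alpha> / V * sqrt (V * I)" using V0 by (simp add: \<rho>_def \<alpha>_def)
    have "r * V \<le> w * sqrt (V * I)"
    proof -
      have "V\<^sup>2 * r\<^sup>2 \<le> (N + 2) / N * (V * I)"
      proof -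
        have "V\<^sup>2 * r\<^sup>2 = (N + 2) / N * V * (N / (N + 2) * V * r\<^sup>2)"
          using N5 by (simp add: power2_eq_square)
        also have "\<dots> \<le> (N + 2) / N * V * I" using N5 V0 by (intro mult_left_mono I) auto
        finally show ?thesis by (simp add: mult.assoc)
      qed
      then have "sqrt (V\<^sup>2 * r\<^sup>2) \<le> sqrt ((N + 2) / N * (V * I))" by (rule real_sqrt_le_mono)
      moreover have "sqrt (V\<^sup>2 * r\<^sup>2) = r * V" using V0 r by (simp add: real_sqrt_mult)
      ultimately show ?thesis unfolding w_def real_sqrt_mult[symmetric] by simp
    qed
    then have "2 * \<alpha> / V * (r * V) \<le> 2 * \<alpha> / V * (w * sqrt (V * I))"
      using \<alpha> V0 by (intro mult_left_mono) auto
    then have "2 * r * \<alpha> \<le> w * \<rho>" unfolding \<open>\<rho> = _\<close> using V0 by (simp add: mult_ac)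
    then show ?thesis using \<rho> x0 r by (simp add: e_def field_simps)
  qed
  \<comment> \<open>In the n-th power of \<open>c * e\<close>, inserting
    \<open>x ^ n = K / (\<omega> * \<alpha>)\<close> and \<open>V = \<omega> * r ^ n\<close> cancels
    all powers of \<open>r\<close>. What is left is the lower bound of \<open>k4_ge\<close> divided
    by \<open>K\<close>.\<close>
  have small: "(2 * L + N - 1) * e \<le> 4"
  proof -
    define c where "c = (2 * L + N - 1) / 4"
    have c0: "0 < c" using N5 L1 by (simp add: c_def)
    have "(c * e) ^ n \<le> (c * (w / (2 * r * x))) ^ n"
      using c0 e0 ele by (intro power_mono mult_left_mono) auto
    also have "\<dots> = c ^ n * w ^ n / (2 ^ n * r ^ n * x ^ n)"
      by (simp add: power_mult_distrib power_divide)
    also have "\<dots> = (c ^ n * w ^ n * \<omega> * V) / (2 ^ n * r ^ n * (2 * pi) ^ n * K)"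
    proof -
      have "a / (b * (K / (\<omega> * (V / d)))) = a * \<omega> * V / (b * d * K)" for a b d :: real
        by (simp add: mult_ac)
      then show ?thesis unfolding xn \<alpha>_def by this
    qed
    also have "\<dots> = (c ^ n * w ^ n * \<omega>\<^sup>2) / ((4 * pi) ^ n * K)"
    proof -
      have "(4 * pi) ^ n = 2 ^ n * (2 * pi) ^ n" unfolding power_mult_distrib[symmetric] by simp
      then have "(c ^ n * w ^ n * \<omega> * V) / (2 ^ n * r ^ n * (2 * pi) ^ n * K) = (c ^ n * w ^ n * \<omega>\<^sup>2) * r ^ n / ((4 * pi) ^ n * K * r ^ n)"
        unfolding V power2_eq_square by (simp only: mult_ac)
      then show ?thesis using r by simp
    qed
    also have "\<dots> \<le> 1"
    proof -
      have "w ^ n = ((N + 2) / N) powr (N / 2)"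
        using N5 w0 by (simp add: w_def N_def powr_half_sqrt[symmetric] powr_powr flip: powr_realpow)
      then have "\<omega>\<^sup>2 / (4 * pi) ^ n * w ^ n * c ^ n \<le> K"
        using order_trans[OF k4_ge[OF l, of n] k(2)] unfolding \<omega>_def c_def N_def L_def K_def by (simp only:)
      then have "(c ^ n * w ^ n * \<omega>\<^sup>2) / (4 * pi) ^ n \<le> K" by (simp add: mult_ac)
      then show ?thesis using K0 by (simp flip: divide_divide_eq_left)
    qed
    finally have "(c * e) ^ n \<le> 1" .
    then have "c * e \<le> 1" using power_le_one_iff[of "c * e" n] c0 e0 n by auto
    then show ?thesis by (simp add: c_def)
  qed
  have e1: "e < 1"
  proof -
    have "6 * e \<le> (2 * L + N - 1) * e" using N5 L1 e0 by (intro mult_right_mono) auto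
    then show ?thesis using small by linarith
  qed
  obtain a where a: "0 < a" "a \<le> 1" "1 \<le> a + e" "(a + e) ^ Suc n - a ^ Suc n = (real n + 1) * e"
    using unit_mean_power_exists[OF e0 e1] by blast
  define M where "M = ((a + e) ^ Suc p - a ^ Suc p) / ((real p + 1) * e)"
  have M: "N / (N + 2 * L) * M \<ge> N / (N + 2 * L) + N * L / 12 * e\<^sup>2 - N * (12 * L + 7 * N - 13) * (2 * L + N - 1) / 48 * e ^ 3
        + N * (2 * L + 2 * N - 3) * (2 * L + N - 1) * (2 * L + N - 2) / 96 * e ^ 4
        - N * (2 * L + N - 1) * (2 * L + N - 2) * (2 * L + N - 3) * (2 * L + N - 4) / 288 * e ^ 5"
    unfolding M_def N_def L_def p_def
    by (rule mean_power_ge_polynomial[OF n l a(1) e0 a(2,3,4)]) (use small in \<open>simp add: L_def N_def\<close>)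
  define A where "A = \<omega> * \<alpha> * x ^ p"
  have A0: "0 \<le> A" using \<omega> \<alpha> x0 by (simp add: A_def)
  \<comment> \<open>The ramp runs from \<open>x * a\<close> to \<open>x * (a + e)\<close>; the
    choice of \<open>a\<close> gives it the mass \<open>K\<close>.\<close>
  have "S \<ge> N / real p * \<omega> * \<rho> * ((x * (a + e)) ^ Suc p - (x * a) ^ Suc p) / (real p + 1)"
  proof (rule S)
    show "0 < x * a" "x * a < x * (a + e)" using x0 a e0 by auto
    show "\<alpha> = \<rho> * (x * (a + e) - x * a)" using \<rho>e by (simp add: algebra_simps)
    have "\<omega> * \<rho> * ((x * (a + e)) ^ Suc n - (x * a) ^ Suc n) / (N + 1) = \<omega> * \<rho> * x ^ Suc n * ((a + e) ^ Suc n - a ^ Suc n) / (N + 1)"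
      by (simp only: power_mult_distrib right_diff_distrib mult.assoc)
    also have "\<dots> = \<omega> * (\<rho> * e * x) * x ^ n" unfolding a(4) using N5 by (simp add: N_def add_nonneg_eq_0_iff field_simps)
    also have "\<dots> = K" unfolding \<rho>e Kxn ..
    finally show "K = \<omega> * \<rho> * ((x * (a + e)) ^ Suc n - (x * a) ^ Suc n) / (N + 1)" ..
  qed
  also have "N / real p * \<omega> * \<rho> * ((x * (a + e)) ^ Suc p - (x * a) ^ Suc p) / (real p + 1)
      = A * (N / (N + 2 * L) * M)"
  proof -
    have "(x * (a + e)) ^ Suc p - (x * a) ^ Suc p = x ^ Suc p * (M * ((real p + 1) * e))"
      using e0 unfolding M_def power_mult_distrib by (simp del: power_Suc add: right_diff_distrib)
    then have "N / real p * \<omega> * \<rho> * ((x * (a + e)) ^ Suc p - (x * a) ^ Suc p) / (real p + 1)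
       = N / real p * \<omega> * (\<rho> * e * x) * x ^ p * M" by simp
    then show ?thesis unfolding \<rho>e A_def by (simp add: p_def N_def L_def)
  qed
  finally have main: "S \<ge> A * (N / (N + 2 * L) * M)" .
  \<comment> \<open>The term of index \<open>j\<close> carries the factor 1/\<rho>^j, so after this
    identity it is a numerical multiple of \<open>A * e ^ j\<close>.\<close>
  have tm: "\<omega> powr (- ((2 * L - real j) / N)) * \<alpha> powr ((- 2 * L + real j * N + real j) / N) * K powr ((2 * L + N - real j) / N)
      = \<rho> ^ j * (A * e ^ j)" if "j \<le> p" for j
  proof -
    have "\<omega> powr (- ((2 * L - real j) / N)) * \<alpha> powr ((- 2 * L + real j * N + real j) / N) * K powr ((2 * L + N - real j) / N)
       = \<omega> * \<alpha> ^ Suc j * x ^ (p - j)"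
      unfolding Kx using \<omega> \<alpha> x0 N5 that
      by (intro powr_scaling_term) (auto simp: p_def N_def L_def of_nat_diff)
    also have "\<dots> = \<rho> ^ j * (A * e ^ j)"
    proof -
      have "x ^ p = x ^ j * x ^ (p - j)" using that by (simp flip: power_add)
      moreover have "\<alpha> ^ j = \<rho> ^ j * e ^ j * x ^ j" by (simp flip: \<rho>e add: power_mult_distrib)
      ultimately show ?thesis unfolding A_def by simp
    qed
    finally show ?thesis .
  qed
  have p7: "p \<ge> 7" using n l by (simp add: p_def)
  \<comment> \<open>The case j = 0 of \<open>tm\<close>: the power of 2 pi is absorbed by V = (2
    pi)^n \<alpha>.\<close>
  have t0: "(2 * pi) ^ (2 * l) / (\<omega> * V) powr (2 * L / N) * K powr ((2 * L + N) / N) = A"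
  proof -
    have "V = \<alpha> * (2 * pi) powr N" using V0 by (simp add: \<alpha>_def N_def powr_realpow)
    then have "(\<omega> * V) powr (2 * L / N) = \<omega> powr (2 * L / N) * \<alpha> powr (2 * L / N) * (2 * pi) powr (2 * L)"
      using \<omega> \<alpha> N5 by (simp add: powr_mult powr_powr)
    moreover have "(2 * pi) powr (2 * L) = (2 * pi) ^ (2 * l)"
      using powr_realpow[of "2 * pi" "2 * l"] by (simp add: L_def)
    ultimately have "(2 * pi) ^ (2 * l) / (\<omega> * V) powr (2 * L / N) = \<omega> powr (- (2 * L / N)) * \<alpha> powr (- (2 * L / N))"
    proof -
      have "P / (u * v * P) = inverse u * inverse v" if "P \<noteq> 0" for P u v :: real
        using that by (simp add: divide_inverse)
      moreover have "(2 * pi) ^ (2 * l) \<noteq> 0" by simp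
      ultimately show ?thesis using \<open>(\<omega> * V) powr (2 * L / N) = _\<close> \<open>(2 * pi) powr (2 * L) = _\<close>
        by (simp only: powr_minus)
    qed
    then show ?thesis using tm[of 0] by simp
  qed
  have tj: "c / (d * \<rho> ^ j * \<omega> powr ((2 * L - real j) / N)) * \<alpha> powr ((- 2 * L + real j * N + real j) / N) * K powr ((2 * L + N - real j) / N)
     = c / d * (A * e ^ j)" if "j \<le> p" for c d j
  proof -
    have "c / (d * \<rho> ^ j * \<omega> powr ((2 * L - real j) / N)) * \<alpha> powr ((- 2 * L + real j * N + real j) / N) * K powr ((2 * L + N - real j) / N)
      = c / (d * \<rho> ^ j) * (\<omega> powr (- ((2 * L - real j) / N)) * \<alpha> powr ((- 2 * L + real j * N + real j) / N) * K powr ((2 * L + N - real j) / N))"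
      by (simp add: powr_minus divide_inverse mult_ac)
    also have "\<dots> = c / d * (A * e ^ j)" unfolding tm[OF that] using \<rho> by simp
    finally show ?thesis .
  qed
  define c3 where "c3 = N * (12 * L + 7 * N - 13) * (2 * L + N - 1)"
  define c4 where "c4 = N * (2 * L + 2 * N - 3) * (2 * L + N - 1) * (2 * L + N - 2)"
  define c5 where "c5 = N * (2 * L + N - 1) * (2 * L + N - 2) * (2 * L + N - 3) * (2 * L + N - 4)"
  have T1: "N / (N + 2 * L) * ((2 * pi) ^ (2 * l) / (\<omega> * V) powr (2 * L / N)) * K powr ((2 * L + N) / N) = N / (N + 2 * L) * A"
    by (simp only: mult.assoc t0)
  have T2: "N * L / (12 * \<rho>\<^sup>2) * \<omega> powr (- ((2 * L - 2) / N)) * \<alpha> powr ((2 * N - 2 * L + 2) / N) * K powr ((2 * L + N - 2) / N)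
     = N * L / 12 * (A * e\<^sup>2)"
  proof -
    have "2 * N - 2 * L + 2 = - 2 * L + 2 * N + 2" by simp
    then show ?thesis using tm[of 2] p7 \<rho> unfolding of_nat_numeral by (simp only: mult.assoc) simp
  qed
  have T3: "- (c3 / (48 * \<rho> ^ 3 * \<omega> powr ((2 * L - 3) / N))) * \<alpha> powr ((- 2 * L + 3 * N + 3) / N) * K powr ((2 * L + N - 3) / N)
     = - (c3 / 48 * (A * e ^ 3))"
    using tj[of 3 c3 48, unfolded of_nat_numeral] p7 by (simp only: mult_minus_left)
  have T4: "c4 / (96 * \<rho> ^ 4 * \<omega> powr ((2 * L - 4) / N)) * \<alpha> powr ((- 2 * L + 4 * N + 4) / N) * K powr ((2 * L + N - 4) / N)
     = c4 / 96 * (A * e ^ 4)"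
    by (rule tj[of 4 c4 96, unfolded of_nat_numeral]) (use p7 in simp)
  have T5: "- (c5 / (288 * \<rho> ^ 5 * \<omega> powr ((2 * L - 5) / N))) * \<alpha> powr ((- 2 * L + 5 * N + 5) / N) * K powr ((2 * L + N - 5) / N)
     = - (c5 / 288 * (A * e ^ 5))"
    using tj[of 5 c5 288, unfolded of_nat_numeral] p7 by (simp only: mult_minus_left)
  have "A * (N / (N + 2 * L) + N * L / 12 * e\<^sup>2 - c3 / 48 * e ^ 3 + c4 / 96 * e ^ 4 - c5 / 288 * e ^ 5)
      \<le> A * (N / (N + 2 * L) * M)"
    using M A0 unfolding c3_def c4_def c5_def by (rule mult_left_mono)
  moreover have "A * (N / (N + 2 * L) + N * L / 12 * e\<^sup>2 - c3 / 48 * e ^ 3 + c4 / 96 * e ^ 4 - c5 / 288 * e ^ 5)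
     = N / (N + 2 * L) * A + N * L / 12 * (A * e\<^sup>2) + - (c3 / 48 * (A * e ^ 3)) + c4 / 96 * (A * e ^ 4) + - (c5 / 288 * (A * e ^ 5))"
  proof -
    have "A * (d1 + d2 * f2 - d3 * f3 + d4 * f4 - d5 * f5) = d1 * A + d2 * (A * f2) + - (d3 * (A * f3)) + d4 * (A * f4) + - (d5 * (A * f5))"
      for d1 d2 d3 d4 d5 f2 f3 f4 f5 :: real by (simp add: algebra_simps)
    then show ?thesis .
  qed
  ultimately show ?thesis
    using main unfolding T1 T2 c3_def[symmetric] c4_def[symmetric] c5_def[symmetric] T3 T4 T5 by linarith
qed


section \<open>Radial integration and comparison with a ramp\<close>

lemma cball_in_sets_borel [measurable]: "cball (x::'a::euclidean_space) r \<in> sets borel"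
  by (simp add: borel_closed)

lemma nn_integral_cball_homogeneous:
  fixes H :: "'a::euclidean_space \<Rightarrow> ennreal"
  assumes [measurable]: "H \<in> borel_measurable borel"
    and hom: "\<And>c x. 0 < c \<Longrightarrow> H (c *\<^sub>R x) = H x" and r: "0 < r"
  shows "(\<integral>\<^sup>+x. H x * indicator (cball 0 r) x \<partial>lborel) =
    ennreal (r ^ DIM('a)) * (\<integral>\<^sup>+x. H x * indicator (cball 0 1) x \<partial>lborel)"
proof -
  have "(\<integral>\<^sup>+x. H x * indicator (cball 0 r) x \<partial>lborel) =
     (\<integral>\<^sup>+x. H x * indicator (cball 0 r) x \<partial>(density (distr lborel borel (\<lambda>x. 0 + r *\<^sub>R x)) (\<lambda>_. ennreal (\<bar>r\<bar> ^ DIM('a)))))"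
    using lborel_affine[of r "0::'a"] r by simp
  also have "\<dots> = (\<integral>\<^sup>+x. ennreal (r ^ DIM('a)) * (H (r *\<^sub>R x) * indicator (cball 0 r) (r *\<^sub>R x)) \<partial>lborel)"
    using r by (subst nn_integral_density; (subst nn_integral_distr)?) auto
  also have "\<dots> = (\<integral>\<^sup>+x. ennreal (r ^ DIM('a)) * (H x * indicator (cball 0 1) x) \<partial>lborel)"
    using r by (intro nn_integral_cong) (auto simp: hom indicator_def)
  also have "\<dots> = ennreal (r ^ DIM('a)) * (\<integral>\<^sup>+x. H x * indicator (cball 0 1) x \<partial>lborel)"
    by (rule nn_integral_cmult) simp
  finally show ?thesis .
qed

text \<open>Integration along rays: a weight that is homogeneous of degree 0 takes the place of a function on the sphere.\<close>

lemma distr_norm_homogeneous: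
  fixes H :: "'a::euclidean_space \<Rightarrow> real"
  assumes [measurable]: "H \<in> borel_measurable borel"
    and hom: "\<And>c x. 0 < c \<Longrightarrow> H (c *\<^sub>R x) = H x" and H0: "\<And>x. 0 \<le> H x" and R: "0 < R"
    and K: "(\<integral>\<^sup>+x. ennreal (H x) * indicator (cball 0 1) x \<partial>lborel) = ennreal K" "0 \<le> K"
  shows "distr (density lborel (\<lambda>x. ennreal (H x) * indicator (cball 0 R) x)) borel norm
    = density lborel (\<lambda>r. ennreal (K * DIM('a) * r ^ (DIM('a) - 1)) * indicator {0..R} r)"
    (is "?M = ?N")
proof (rule measure_eqI_lessThan)
  let ?n = "DIM('a)"
  let ?h = "\<lambda>x. ennreal (H x)"
  have ball: "(\<integral>\<^sup>+x. ?h x * indicator (cball 0 r) x \<partial>lborel) = ennreal (r ^ ?n * K)" if "0 < r" for r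
    using nn_integral_cball_homogeneous[of ?h r] hom that K by (simp add: ennreal_mult')
  have ball0: "(\<integral>\<^sup>+x. ?h x * indicator (cball 0 0) x \<partial>lborel) = 0"
  proof -
    have "AE x in lborel. x \<noteq> (0::'a)" by (rule AE_lborel_singleton)
    then have "(\<integral>\<^sup>+x. ?h x * indicator (cball 0 0) x \<partial>lborel) = (\<integral>\<^sup>+(x::'a). 0 \<partial>lborel)"
      by (intro nn_integral_cong_AE) (auto simp: indicator_def)
    then show ?thesis by simp
  qed
  have ball': "(\<integral>\<^sup>+x. ?h x * indicator (cball 0 r) x \<partial>lborel) = ennreal (r ^ ?n * K)" if "0 \<le> r" for r
    using ball[of r] ball0 that by (cases "r = 0") (auto simp: zero_power)
  have M: "emeasure ?M {s<..} = (\<integral>\<^sup>+x. ?h x * indicator (cball 0 R) x * indicator {x. s < norm x} x \<partial>lborel)" for s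
    by (subst emeasure_distr, simp, simp, subst emeasure_density) (auto simp: vimage_def intro!: nn_integral_cong)
  have N: "emeasure ?N {s<..} = (\<integral>\<^sup>+r. ennreal (K * ?n * r ^ (?n - 1)) * indicator {0..R} r * indicator {s<..} r \<partial>lborel)" for s
    by (subst emeasure_density) auto
  have FTC: "(\<integral>\<^sup>+r. ennreal (K * ?n * r ^ (?n - 1)) * indicator {a..b} r \<partial>lborel) = ennreal (b ^ ?n * K - a ^ ?n * K)"
    if "0 \<le> a" "a \<le> b" for a b
    using that K(2)
    by (intro nn_integral_FTC_Icc[where F="\<lambda>r. r ^ ?n * K"]) (auto intro!: derivative_eq_intros)
  show "emeasure ?M {s<..} < \<infinity>" for s
  proof -
    have "emeasure ?M {s<..} \<le> (\<integral>\<^sup>+x. ?h x * indicator (cball 0 R) x \<partial>lborel)"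
      unfolding M by (intro nn_integral_mono) (auto simp: indicator_def)
    also have "\<dots> < \<infinity>" unfolding ball[OF R] by simp
    finally show ?thesis .
  qed
  \<comment> \<open>For s in [0, R] both sides are K (R^n - s^n) with n the dimension: on the left
    by subtracting the ball of radius s, on the right by \<open>FTC\<close>.\<close>
  show "emeasure ?M {s<..} = emeasure ?N {s<..}" for s
  proof -
    consider "s < 0" | "0 \<le> s" "s \<le> R" | "R < s" by linarith
    then show ?thesis
    proof cases
      case 1
      have "emeasure ?M {s<..} = (\<integral>\<^sup>+x. ?h x * indicator (cball 0 R) x \<partial>lborel)"
        unfolding M using 1 by (intro nn_integral_cong) (auto simp: indicator_def less_le_trans[OF _ norm_ge_zero])
      moreover have "emeasure ?N {s<..} = (\<integral>\<^sup>+r. ennreal (K * ?n * r ^ (?n - 1)) * indicator {0..R} r \<partial>lborel)"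
        unfolding N using 1 by (intro nn_integral_cong) (auto simp: indicator_def)
      ultimately show ?thesis using FTC[of 0 R] ball[OF R] R by (simp add: zero_power)
    next
      case 2
      have "ennreal (R ^ ?n * K) = (\<integral>\<^sup>+x. (?h x * indicator (cball 0 R) x * indicator {x. s < norm x} x)
         + ?h x * indicator (cball 0 s) x \<partial>lborel)"
        unfolding ball[OF R, symmetric] using 2 by (intro nn_integral_cong) (auto simp: indicator_def)
      also have "\<dots> = emeasure ?M {s<..} + ennreal (s ^ ?n * K)"
        unfolding M ball'[OF 2(1), symmetric] by (subst nn_integral_add) auto
      finally have *: "ennreal (R ^ ?n * K) = emeasure ?M {s<..} + ennreal (s ^ ?n * K)" .
      have "emeasure ?N {s<..} = (\<integral>\<^sup>+r. ennreal (K * ?n * r ^ (?n - 1)) * indicator {s..R} r \<partial>lborel)"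
        unfolding N using 2 AE_lborel_singleton[of s]
        by (intro nn_integral_cong_AE) (auto elim!: eventually_mono simp: indicator_def)
      also have "\<dots> = ennreal (R ^ ?n * K) - ennreal (s ^ ?n * K)"
        using FTC[OF 2] 2 K(2) by (subst ennreal_minus) auto
      also have "\<dots> = emeasure ?M {s<..}" unfolding * by (rule ennreal_add_diff_cancel_right) simp
      finally show ?thesis by simp
    next
      case 3
      then have "(\<integral>\<^sup>+x. ?h x * indicator (cball 0 R) x * indicator {x. s < norm x} x \<partial>lborel) = (\<integral>\<^sup>+(x::'a). 0 \<partial>lborel)"
        "(\<integral>\<^sup>+r. ennreal (K * ?n * r ^ (?n - 1)) * indicator {0..R} r * indicator {s<..} r \<partial>lborel) = (\<integral>\<^sup>+(r::real). 0 \<partial>lborel)"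
        by - (rule nn_integral_cong, simp add: indicator_def)+
      then show ?thesis unfolding M N by simp
    qed
  qed
qed auto

text \<open>Polar coordinates for a weight that may change sign. A density must be nonnegative, so
  the bounded weight \<open>H\<close> is shifted by \<open>B\<close> and the contribution of the
  constant is subtracted afterwards.\<close>

lemma integral_homogeneous_power:
  fixes H :: "'a::euclidean_space \<Rightarrow> real"
  assumes [measurable]: "H \<in> borel_measurable borel"
    and hom: "\<And>c x. 0 < c \<Longrightarrow> H (c *\<^sub>R x) = H x" and bnd: "\<And>x. \<bar>H x\<bar> \<le> B" and R: "0 < R"
  shows "integrable lborel (\<lambda>x. indicator (cball 0 R) x * (H x * norm x ^ q))" (is ?int)
    and "(LBINT x. indicator (cball 0 R) x * (H x * norm x ^ q)) =
      (LBINT x. indicator (cball 0 1) x * H x) * real DIM('a) / (real DIM('a) + real q) * R ^ (DIM('a) + q)" (is ?eq)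
proof -
  let ?n = "DIM('a)"
  have finball: "emeasure lborel (cball (0::'a) r) < \<infinity>" for r
    using emeasure_bounded_finite[of "cball (0::'a) r"] by simp
  have intg: "integrable lborel (\<lambda>x. indicator (cball 0 r) x * (G x * norm x ^ q))"
    if [measurable]: "G \<in> borel_measurable borel" and b: "\<And>x. \<bar>G x\<bar> \<le> C" for G :: "'a \<Rightarrow> real" and C r q
  proof (rule Bochner_Integration.integrable_bound[where f="\<lambda>x. indicator (cball 0 r) x * (C * (max r 0) ^ q)"])
    show "integrable lborel (\<lambda>x. indicator (cball (0::'a) r) x * (C * (max r 0) ^ q))"
      using finball[of r] by (intro integrable_mult_left) (auto simp: integrable_indicator_iff)
    show "AE x in lborel. norm (indicator (cball 0 r) x * (G x * norm x ^ q)) \<le> norm (indicator (cball 0 r) x * (C * (max r 0) ^ q))"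
    proof (rule AE_I2)
      fix x :: 'a
      show "norm (indicator (cball 0 r) x * (G x * norm x ^ q)) \<le> norm (indicator (cball 0 r) x * (C * (max r 0) ^ q))"
      proof (cases "x \<in> cball 0 r")
        case True
        then have "\<bar>G x\<bar> * norm x ^ q \<le> C * (max r 0) ^ q"
          using b[of x] by (intro mult_mono power_mono) auto
        then show ?thesis using b[of x] True by (auto simp: abs_mult)
      qed simp
    qed
  qed measurable
  show ?int by (rule intg[OF _ bnd]) simp
  have pos: "(LBINT x. indicator (cball 0 R) x * (G x * norm x ^ q)) =
      (LBINT x. indicator (cball 0 1) x * G x) * real ?n / (real ?n + real q) * R ^ (?n + q)"
    if Gm[measurable]: "G \<in> borel_measurable borel" and b: "\<And>x. \<bar>G x\<bar> \<le> C" and G0: "\<And>x. 0 \<le> G x"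
      and Gh: "\<And>c x. 0 < c \<Longrightarrow> G (c *\<^sub>R x) = G x" for G :: "'a \<Rightarrow> real" and C
  proof -
    define K where "K = (LBINT x. indicator (cball 0 1) x * G x)"
    have ei: "ennreal (indicator S x * G x) = ennreal (G x) * indicator S x"
      "ennreal (G x * indicator S x) = ennreal (G x) * indicator S x" for S :: "'a set" and x
      by (auto simp: indicator_def)
    have ei': "ennreal (c * indicator S r) = ennreal c * indicator S r" for c r and S :: "real set"
      by (auto simp: indicator_def)
    have K0: "0 \<le> K" unfolding K_def by (intro integral_nonneg_AE) (auto simp: G0)
    have "(\<integral>\<^sup>+x. ennreal (indicator (cball 0 1) x * G x) \<partial>lborel) = ennreal K"
      unfolding K_def using intg[OF Gm b, of 1 0] G0 by (intro nn_integral_eq_integral) auto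
    then have K: "(\<integral>\<^sup>+x. ennreal (G x) * indicator (cball 0 1) x \<partial>lborel) = ennreal K"
      by (simp add: ei)
    let ?N = "density lborel (\<lambda>r. ennreal (K * ?n * r ^ (?n - 1) * indicator {0..R} r))"
    have D: "distr (density lborel (\<lambda>x. ennreal (G x * indicator (cball 0 R) x))) borel norm = ?N"
      using distr_norm_homogeneous[OF Gm Gh G0 R K K0] G0
      by (simp add: ei ei')
    have "(LBINT x. indicator (cball 0 R) x * (G x * norm x ^ q)) =
       (LINT x|density lborel (\<lambda>x. ennreal (G x * indicator (cball 0 R) x)). norm x ^ q)"
      using G0 by (subst integral_density) (auto simp: mult_ac)
    also have "\<dots> = (LINT r|distr (density lborel (\<lambda>x. ennreal (G x * indicator (cball 0 R) x))) borel norm. r ^ q)"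
      by (subst integral_distr) auto
    also have "\<dots> = (LINT r|?N. r ^ q)" unfolding D ..
    also have "\<dots> = (LBINT r. (K * ?n * r ^ (?n - 1) * indicator {0..R} r) * r ^ q)"
      using K0 by (subst integral_density) (auto simp: indicator_def)
    also have "\<dots> = (LBINT r. K * ?n * r ^ (?n - 1 + q) * indicator {0..R} r)"
      unfolding power_add by (intro Bochner_Integration.integral_cong) (auto simp: mult_ac)
    also have "\<dots> = K * ?n / (?n + q) * R ^ (?n + q) - K * ?n / (?n + q) * 0 ^ (?n + q)"
    proof (rule integral_FTC_Icc_real[where F="\<lambda>r. K * real ?n / real (?n + q) * r ^ (?n + q)"])
      show "0 \<le> R" using R by simp
      have n: "?n > 0" by simp
      show "((\<lambda>r. K * real ?n / real (?n + q) * r ^ (?n + q)) has_real_derivative K * real ?n * x ^ (?n - 1 + q)) (at x)" for x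
      proof -
        have "?n + q - Suc 0 = ?n - 1 + q" using n by linarith
        moreover have "real (?n + q) \<noteq> 0" using n by linarith
        ultimately show ?thesis
          by (auto intro!: derivative_eq_intros simp: of_nat_add[symmetric] simp del: of_nat_add)
      qed
    qed auto
    finally show ?thesis unfolding K_def by (simp add: zero_power)
  qed
  define H' where "H' = (\<lambda>x. H x + B)"
  have [measurable]: "H' \<in> borel_measurable borel" by (simp add: H'_def)
  have H': "\<bar>H' x\<bar> \<le> 2 * B" "0 \<le> H' x" for x using bnd[of x] by (auto simp: H'_def)
  have B0: "0 \<le> B" using bnd[of 0] by linarith
  have int1: "integrable lborel (\<lambda>x. indicator (cball 0 r) x * (H' x * norm x ^ q))" for r q
    by (rule intg[OF _ H'(1)]) simp
  have int2: "integrable lborel (\<lambda>x. indicator (cball (0::'a) r) x * (B * norm x ^ q))" for r q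
    by (rule intg[where C=B]) (use B0 in auto)
  have split: "(LBINT x. indicator (cball 0 r) x * (H x * norm x ^ q)) =
      (LBINT x. indicator (cball 0 r) x * (H' x * norm x ^ q)) -
      (LBINT x. indicator (cball (0::'a) r) x * (B * norm x ^ q))" for r q
    by (subst Bochner_Integration.integral_diff[symmetric, OF int1 int2])
       (auto intro!: Bochner_Integration.integral_cong simp: H'_def algebra_simps)
  have p1: "(LBINT x. indicator (cball 0 R) x * (H' x * norm x ^ q)) =
      (LBINT x. indicator (cball 0 1) x * H' x) * real ?n / (real ?n + real q) * R ^ (?n + q)"
    by (rule pos[OF _ H']) (auto simp: H'_def hom)
  have p2: "(LBINT x. indicator (cball (0::'a) R) x * (B * norm x ^ q)) =
      (LBINT x. indicator (cball (0::'a) 1) x * B) * real ?n / (real ?n + real q) * R ^ (?n + q)"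
    by (rule pos[where C=B]) (use B0 in auto)
  have h: "(LBINT x. indicator (cball 0 1) x * H x) =
      (LBINT x. indicator (cball 0 1) x * H' x) - (LBINT x. indicator (cball (0::'a) 1) x * B)"
    using split[of 1 0] by simp
  show ?eq unfolding split p1 p2 h by (simp only: left_diff_distrib diff_divide_distrib)
qed

lemma integral_cball_power:
  assumes "0 < R"
  shows "integrable lborel (\<lambda>x::'a::euclidean_space. indicator (cball 0 R) x * norm x ^ q)"
    and "(LBINT x. indicator (cball (0::'a) R) x * norm x ^ q) =
      unit_ball_vol (real DIM('a)) * real DIM('a) / (real DIM('a) + real q) * R ^ (DIM('a) + q)"
proof -
  have "(LBINT x. indicator (cball (0::'a) 1) x * (1::real)) = unit_ball_vol (real DIM('a))"
    by (simp add: content_cball)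
  then show "integrable lborel (\<lambda>x::'a. indicator (cball 0 R) x * norm x ^ q)"
    "(LBINT x. indicator (cball (0::'a) R) x * norm x ^ q) =
      unit_ball_vol (real DIM('a)) * real DIM('a) / (real DIM('a) + real q) * R ^ (DIM('a) + q)"
    using integral_homogeneous_power[of "\<lambda>_::'a. 1" 1 R q] assms by simp_all
qed

text \<open>The constant \<open>c\<close> in the proof is chosen such that \<open>r\<^sup>n\<^sup>-\<^sup>1 (r\<^sup>2\<^sup>l - c)\<close> has integral 0 over the ramp \<open>[t, R]\<close>; on the
  ramp, \<open>f - g\<close> may then be replaced on every ray by its value at the zero \<open>r0\<close> of \<open>r\<^sup>2\<^sup>l - c\<close>.\<close>

lemma ramp_moment_comparison:
  fixes f :: "'a::euclidean_space \<Rightarrow> real" and l :: nat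
  defines "n \<equiv> DIM('a)" and "\<omega> \<equiv> unit_ball_vol (real DIM('a))" and "p \<equiv> DIM('a) + 2 * l"
  assumes f: "\<And>x. 0 \<le> f x" "\<And>x. f x \<le> \<alpha>" and lip: "\<And>x y. \<bar>f x - f y\<bar> \<le> \<rho> * norm (x - y)"
    and int: "integrable lborel f" "integrable lborel (\<lambda>x. norm x ^ (2 * l) * f x)"
    and l: "1 \<le> l" and t: "0 < t" "t < R" and \<alpha>: "\<alpha> = \<rho> * (R - t)" and \<rho>: "0 < \<rho>"
    and mass: "(LBINT x. f x) = \<omega> * \<rho> * (R ^ Suc n - t ^ Suc n) / (real n + 1)"
  shows "(LBINT x. norm x ^ (2 * l) * f x) \<ge>
     real n / real p * \<omega> * \<rho> * (R ^ Suc p - t ^ Suc p) / (real p + 1)"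
proof -
  have n0: "n > 0" "p > 0" by (simp_all add: n_def p_def)
  have R: "0 < R" using t by simp
  have "\<rho>-lipschitz_on UNIV f"
    using lip \<rho> by (intro lipschitz_onI) (auto simp: dist_real_def dist_norm)
  then have "continuous_on UNIV f" by (rule lipschitz_on_continuous_on)
  then have [measurable]: "f \<in> borel_measurable borel" by (rule borel_measurable_continuous_onI)
  \<comment> \<open>Cauchy's mean value theorem for \<open>r ^ p\<close> and \<open>r ^ n\<close> on
    \<open>[t, R]\<close>. The quotient of the derivatives at \<open>r0\<close> is p/n times
    \<open>r0 ^ (2 * l)\<close>, so \<open>c\<close> can be taken as that power, with its zero
    inside the ramp.\<close>
  obtain r0 where r0: "t < r0" "r0 < R"
    and gm: "(R ^ p - t ^ p) * (real n * r0 ^ (n - 1)) = (R ^ n - t ^ n) * (real p * r0 ^ (p - 1))"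
    using GMVT'[of t R "\<lambda>r. r ^ p" "\<lambda>r. r ^ n" "\<lambda>r. real n * r ^ (n - 1)" "\<lambda>r. real p * r ^ (p - 1)"] t
    by (auto intro!: continuous_intros derivative_eq_intros)
  define c where "c = r0 ^ (2 * l)"
  have "p - 1 = n - 1 + 2 * l" using n0 by (simp add: p_def n_def)
  then have "r0 ^ (n - 1) * ((R ^ p - t ^ p) * real n) = r0 ^ (n - 1) * ((R ^ n - t ^ n) * real p * c)"
    using gm by (simp add: power_add c_def mult_ac)
  then have c: "(R ^ p - t ^ p) * real n = (R ^ n - t ^ n) * real p * c"
    using r0 t by simp
  \<comment> \<open>The ramp: constant \<rho> (R - t) up to \<open>t\<close>, then of slope -\<rho>
    down to 0 at \<open>R\<close>. Being a difference of two truncated cones, it has moments that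
    reduce to those of balls.\<close>
  define g where "g = (\<lambda>r. \<rho> * (max (R - r) 0 - max (t - r) 0))"
  have mono: "(x ^ (2 * l) \<le> c \<longleftrightarrow> x \<le> r0)" if "0 \<le> x" for x
    unfolding c_def using that r0 t l by (intro power_mono_iff) auto
  \<comment> \<open>\<open>H\<close> freezes \<open>f - g\<close> at radius \<open>r0\<close> on
    every ray, which makes it homogeneous of degree 0. \<open>J\<close> uses it on the shell between
    the radii \<open>t\<close> and \<open>R\<close> and vanishes elsewhere.\<close>
  define H where "H = (\<lambda>x. f (r0 *\<^sub>R sgn x) - g r0)"
  define J where "J = (\<lambda>x::'a. (indicator (cball 0 R) x - indicator (cball 0 t) x) * (norm x ^ (2 * l) - c) * H x)"
  have ramp: "g (norm x) = \<rho> * (indicator (cball 0 R) x * (R - norm x) - indicator (cball 0 t) x * (t - norm x))" for x :: 'a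
    using t by (auto simp: g_def indicator_def)
  \<comment> \<open>Off the shell the two factors on the right have the same sign. On it, the
    Lipschitz bound makes \<open>f - g\<close> nondecreasing along the ray, so its change from
    radius \<open>r0\<close> to \<open>norm x\<close> has the sign of
    \<open>norm x ^ (2 * l) - c\<close>.\<close>
  have pw: "J x \<le> (norm x ^ (2 * l) - c) * (f x - g (norm x))" for x :: 'a
  proof -
    consider "norm x \<le> t" | "t < norm x" "norm x \<le> r0" | "r0 < norm x" "norm x \<le> R" | "R < norm x" by linarith
    then show ?thesis
    proof cases
      case 1
      then have "J x = 0" using t by (auto simp: J_def indicator_def)
      moreover have "norm x ^ (2 * l) \<le> c" using mono[of "norm x"] 1 r0 by auto
      moreover have "f x - g (norm x) \<le> 0" using f(2)[of x] 1 t by (auto simp: g_def \<alpha> algebra_simps)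
      ultimately show ?thesis by (simp add: mult_nonpos_nonpos)
    next
      case 4
      then have "J x = 0" using t by (auto simp: J_def indicator_def)
      moreover have "norm x ^ (2 * l) \<ge> c" using mono[of "norm x"] 4 r0 by auto
      moreover have "f x - g (norm x) \<ge> 0" using f(1)[of x] 4 t by (auto simp: g_def)
      ultimately show ?thesis by simp
    next
      case 2
      have eq: "norm (x - r0 *\<^sub>R sgn x) = r0 - norm x"
      proof -
        have "x - r0 *\<^sub>R sgn x = (norm x - r0) *\<^sub>R sgn x"
          using 2 t by (cases "x = 0") (auto simp: sgn_div_norm algebra_simps)
        then show ?thesis using 2 t by (auto simp: norm_sgn)
      qed
      have "f x - g (norm x) \<le> H x"
        using lip[of x "r0 *\<^sub>R sgn x", unfolded eq] 2 r0 by (auto simp: H_def g_def algebra_simps)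
      moreover have "norm x ^ (2 * l) \<le> c" using mono[of "norm x"] 2 by auto
      moreover have "J x = (norm x ^ (2 * l) - c) * H x"
        using 2 r0 by (auto simp: J_def indicator_def)
      ultimately show ?thesis by (simp add: mult_left_mono_neg)
    next
      case 3
      have eq: "norm (x - r0 *\<^sub>R sgn x) = norm x - r0"
      proof -
        have "x - r0 *\<^sub>R sgn x = (norm x - r0) *\<^sub>R sgn x"
          using 3 t r0 by (cases "x = 0") (auto simp: sgn_div_norm algebra_simps)
        then show ?thesis using 3 t r0 by (auto simp: norm_sgn)
      qed
      have "f x - g (norm x) \<ge> H x"
        using lip[of x "r0 *\<^sub>R sgn x", unfolded eq] 3 r0 by (auto simp: H_def g_def algebra_simps)
      moreover have "norm x ^ (2 * l) \<ge> c" using mono[of "norm x"] 3 t r0 by auto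
      moreover have "J x = (norm x ^ (2 * l) - c) * H x"
        using 3 r0 by (auto simp: J_def indicator_def)
      ultimately show ?thesis by (simp add: mult_left_mono)
    qed
  qed
  have Hm: "H \<in> borel_measurable borel" unfolding H_def by measurable
  have Hh: "H (a *\<^sub>R x) = H x" if "0 < a" for a x using that by (simp add: H_def sgn_scaleR)
  have Hb: "\<bar>H x\<bar> \<le> \<alpha> + \<bar>g r0\<bar>" for x
    using f(1)[of "r0 *\<^sub>R sgn x"] f(2)[of "r0 *\<^sub>R sgn x"] by (auto simp: H_def)
  define K where "K = (LBINT x. indicator (cball 0 1) x * H x)"
  have P1: "integrable lborel (\<lambda>x. indicator (cball 0 r) x * (H x * norm x ^ q))"
    and P2: "(LBINT x. indicator (cball 0 r) x * (H x * norm x ^ q)) = K * real n / (real n + real q) * r ^ (n + q)"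
    if "0 < r" for r q
    unfolding K_def n_def
    by (rule integral_homogeneous_power(1)[OF Hm _ Hb that] integral_homogeneous_power(2)[OF Hm _ Hb that]; rule Hh; assumption)+
  \<comment> \<open>Up to a constant, the integral is that of \<open>H\<close> over the unit ball
    times that of r^(n-1) (r^(2l) - c) over \<open>[t, R]\<close>, and the latter is 0 by the choice
    of \<open>c\<close>.\<close>
  have J: "integrable lborel J \<and> (LBINT x. J x) = 0"
  proof -
    have eq: "J = (\<lambda>x. (indicator (cball 0 R) x * (H x * norm x ^ (2 * l)) - c * (indicator (cball 0 R) x * (H x * norm x ^ 0)))
       - (indicator (cball 0 t) x * (H x * norm x ^ (2 * l)) - c * (indicator (cball 0 t) x * (H x * norm x ^ 0))))"
      by (auto simp: J_def fun_eq_iff algebra_simps)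
    have "(LBINT x. J x) = (K * real n / real p * R ^ p - c * (K * real n / real n * R ^ n))
       - (K * real n / real p * t ^ p - c * (K * real n / real n * t ^ n))"
    proof -
      have li: "(LBINT x. (A1 x - c * A2 x) - (B1 x - c * B2 x)) =
          ((LBINT x. A1 x) - c * (LBINT x. A2 x)) - ((LBINT x. B1 x) - c * (LBINT x. B2 x))"
        if "integrable lborel A1" "integrable lborel A2" "integrable lborel B1" "integrable lborel B2"
        for A1 A2 B1 B2 :: "'a \<Rightarrow> real"
        using that by simp
      show ?thesis
        unfolding eq li[OF P1[OF R] P1[OF R] P1[OF t(1)] P1[OF t(1)]] P2[OF R] P2[OF t(1)] p_def n_def
        by simp
    qed
    also have "\<dots> = K / real p * ((R ^ p - t ^ p) * real n - (R ^ n - t ^ n) * real p * c)"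
      using n0 by (simp add: field_simps)
    also have "\<dots> = 0" using c by simp
    finally show ?thesis unfolding eq by (intro conjI Bochner_Integration.integrable_diff integrable_mult_right P1 R t)
  qed
  note B = integral_cball_power[where 'a='a, folded \<omega>_def n_def]
  have g: "integrable lborel (\<lambda>x::'a. norm x ^ q * g (norm x)) \<and>
     (LBINT x. norm (x::'a) ^ q * g (norm x)) = real n / real (n + q) * \<omega> * \<rho> * (R ^ Suc (n + q) - t ^ Suc (n + q)) / (real (n + q) + 1)" for q
  proof -
    have eq: "(\<lambda>x::'a. norm x ^ q * g (norm x)) = (\<lambda>x. \<rho> * ((R * (indicator (cball 0 R) x * norm x ^ q) - indicator (cball 0 R) x * norm x ^ Suc q)
       - (t * (indicator (cball 0 t) x * norm x ^ q) - indicator (cball 0 t) x * norm x ^ Suc q)))"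
      by (auto simp: ramp fun_eq_iff algebra_simps)
    have "(LBINT x. norm (x::'a) ^ q * g (norm x)) = \<rho> * ((R * (\<omega> * real n / (real n + real q) * R ^ (n + q)) - \<omega> * real n / (real n + real (Suc q)) * R ^ (n + Suc q))
       - (t * (\<omega> * real n / (real n + real q) * t ^ (n + q)) - \<omega> * real n / (real n + real (Suc q)) * t ^ (n + Suc q)))"
      unfolding eq using B[of R q] B[of t q] B[of R "Suc q"] B[of t "Suc q"] R t
      by (simp del: power_Suc of_nat_Suc)
    also have "\<dots> = real n / real (n + q) * \<omega> * \<rho> * (R ^ Suc (n + q) - t ^ Suc (n + q)) / (real (n + q) + 1)"
    proof -
      have nz: "real n + real q \<noteq> 0" "real n + real q + 1 \<noteq> 0" "1 + (real n + real q) \<noteq> 0" using n0 by linarith+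
      have "1 / (real n + real q) - 1 / (real n + real q + 1) = 1 / ((real n + real q) * (real n + real q + 1))"
        using nz by (simp add: field_simps)
      moreover have "\<rho> * ((R * (\<omega> * real n / (real n + real q) * R ^ (n + q)) - \<omega> * real n / (real n + real (Suc q)) * R ^ (n + Suc q))
         - (t * (\<omega> * real n / (real n + real q) * t ^ (n + q)) - \<omega> * real n / (real n + real (Suc q)) * t ^ (n + Suc q)))
         = \<rho> * \<omega> * real n * (R ^ Suc (n + q) - t ^ Suc (n + q)) * (1 / (real n + real q) - 1 / (real n + real q + 1))"
        by (simp add: algebra_simps)
      ultimately show ?thesis by (simp add: mult_ac)
    qed
    finally show ?thesis unfolding eq using B(1)[of R q] B(1)[of t q] B(1)[of R "Suc q"] B(1)[of t "Suc q"] R t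
      by (auto simp del: power_Suc)
  qed
  \<comment> \<open>Equal masses let the terms with \<open>c\<close> cancel at the end.\<close>
  have mass': "(LBINT x. f x) = (LBINT x. g (norm (x::'a)))"
    using g[of 0] n0 by (simp add: mass)
  have "0 = (LBINT x. J x)" using J by simp
  also have "\<dots> \<le> (LBINT x. (norm x ^ (2 * l) - c) * (f x - g (norm x)))"
    using J pw int g[of 0] g[of "2 * l"]
    by (intro integral_mono) (auto simp: algebra_simps)
  also have "\<dots> = (LBINT x. (norm x ^ (2 * l) * f x - c * f x) - (norm x ^ (2 * l) * g (norm x) - c * g (norm x)))"
    by (intro Bochner_Integration.integral_cong) (auto simp: algebra_simps)
  also have "\<dots> = ((LBINT x. norm x ^ (2 * l) * f x) - c * (LBINT x. f x))
      - ((LBINT x. norm (x::'a) ^ (2 * l) * g (norm x)) - c * (LBINT x. g (norm (x::'a))))"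
    using int g[of 0] g[of "2 * l"] by simp
  finally show ?thesis using g[of "2 * l"] mass' by (simp add: p_def n_def)
qed

text \<open>The function |x|^2 - r^2 is nonpositive on the ball and nonnegative outside, so its
  integral over any set is at least that over the ball. As the volumes agree, the term with r^2 is
  the same for both.\<close>

lemma second_moment_ge_ball:
  fixes S :: "'a::euclidean_space set"
  assumes S: "S \<in> sets borel" "bounded S" and r: "0 < r"
    and vol: "measure lborel S = unit_ball_vol (real DIM('a)) * r ^ DIM('a)"
  shows "(LBINT x. indicator S x * (norm x)\<^sup>2) \<ge> real DIM('a) / (real DIM('a) + 2) * measure lborel S * r\<^sup>2"
proof -
  let ?n = "DIM('a)"
  let ?\<omega> = "unit_ball_vol (real ?n)"
  note [measurable] = S(1)
  obtain B where B: "\<And>x. x \<in> S \<Longrightarrow> norm x \<le> B" using S(2) by (auto simp: bounded_iff)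
  have finS: "emeasure lborel S < \<infinity>" using emeasure_bounded_finite[OF S(2)] by simp
  have i1: "integrable lborel (\<lambda>x. indicator S x :: real)" using finS by (simp add: integrable_indicator_iff)
  have i2: "integrable lborel (\<lambda>x. indicator S x * (norm x)\<^sup>2)"
  proof (rule Bochner_Integration.integrable_bound[where f="\<lambda>x. indicator S x * B\<^sup>2"])
    show "integrable lborel (\<lambda>x. indicator S x * B\<^sup>2)" using i1 by simp
    show "AE x in lborel. norm (indicator S x * (norm x)\<^sup>2) \<le> norm (indicator S x * B\<^sup>2)"
      using B by (intro AE_I2) (auto simp: indicator_def intro!: power_mono)
  qed measurable
  note b0 = integral_cball_power[OF r, of 0, where 'a='a] and b2 = integral_cball_power[OF r, of 2, where 'a='a]
  have "(LBINT x. indicator (cball 0 r) x * (norm (x::'a))\<^sup>2 - r\<^sup>2 * (indicator (cball 0 r) x * norm x ^ 0))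
      \<le> (LBINT x. indicator S x * (norm x)\<^sup>2 - r\<^sup>2 * indicator S x)"
  proof (rule integral_mono)
    show "integrable lborel (\<lambda>x. indicator S x * (norm x)\<^sup>2 - r\<^sup>2 * indicator S x)"
      using i1 i2 by simp
    show "integrable lborel (\<lambda>x. indicator (cball 0 r) x * (norm (x::'a))\<^sup>2 - r\<^sup>2 * (indicator (cball 0 r) x * norm x ^ 0))"
      using b0(1) b2(1) by simp
    fix x :: 'a
    have "norm x \<le> r \<Longrightarrow> (norm x)\<^sup>2 \<le> r\<^sup>2" "norm x \<ge> r \<Longrightarrow> (norm x)\<^sup>2 \<ge> r\<^sup>2"
      using r by (auto intro!: power_mono)
    then show "indicator (cball 0 r) x * (norm x)\<^sup>2 - r\<^sup>2 * (indicator (cball 0 r) x * norm x ^ 0)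
      \<le> indicator S x * (norm x)\<^sup>2 - r\<^sup>2 * indicator S x"
      by (auto simp: indicator_def)
  qed
  also have "\<dots> = (LBINT x. indicator S x * (norm x)\<^sup>2) - r\<^sup>2 * measure lborel S"
    using i1 i2 by simp
  also have "(LBINT x. indicator (cball 0 r) x * (norm (x::'a))\<^sup>2 - r\<^sup>2 * (indicator (cball 0 r) x * norm x ^ 0))
      = (LBINT x. indicator (cball 0 r) x * (norm (x::'a))\<^sup>2) - r\<^sup>2 * (LBINT x. indicator (cball 0 r) x * norm (x::'a) ^ 0)"
    using b0(1) b2(1) by simp
  also have "\<dots> = ?\<omega> * ?n / (?n + 2) * r ^ (?n + 2) - r\<^sup>2 * measure lborel S"
    unfolding b0(2) b2(2) vol by simp
  finally show ?thesis by (simp add: vol power_add power2_eq_square mult_ac add.commute)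
qed


section \<open>Plancherel's theorem\<close>

lemma borel_measurable_cis [measurable (raw)]:
  assumes "f \<in> borel_measurable M"
  shows "(\<lambda>x. cis (f x)) \<in> borel_measurable M"
proof -
  have "(cis :: real \<Rightarrow> complex) \<in> borel_measurable borel"
    by (intro borel_measurable_continuous_onI) (auto intro!: continuous_intros simp: cis_conv_exp[abs_def])
  from measurable_compose[OF assms this] show ?thesis .
qed

text \<open>Fubini's theorem over the coordinates, through the description of \<open>lborel\<close>
  as the image of a product measure.\<close>

lemma integral_lborel_prod:
  fixes f :: "'a::euclidean_space \<Rightarrow> real \<Rightarrow> complex"
  assumes f: "\<And>b. b \<in> Basis \<Longrightarrow> integrable lborel (f b)"
  shows "integrable lborel (\<lambda>x::'a. \<Prod>b\<in>Basis. f b (x \<bullet> b))"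
    and "(LBINT x. (\<Prod>b\<in>Basis. f b ((x::'a) \<bullet> b))) = (\<Prod>b\<in>Basis. LBINT y. f b y)"
proof -
  interpret product_sigma_finite "\<lambda>_::'a. lborel :: real measure" ..
  have [measurable]: "f b \<in> borel_measurable borel" if "b \<in> Basis" for b
    using borel_measurable_integrable[OF f[OF that]] by simp
  have m: "(\<lambda>x::'a. \<Prod>b\<in>Basis. f b (x \<bullet> b)) \<in> borel_measurable borel" by measurable
  have T: "(\<lambda>g. \<Sum>b\<in>Basis. g b *\<^sub>R b) \<in> measurable (\<Pi>\<^sub>M b\<in>(Basis::'a set). lborel) borel" by measurable
  have eq: "(\<Prod>b\<in>Basis. f b ((\<Sum>c\<in>Basis. g c *\<^sub>R c) \<bullet> b)) = (\<Prod>b\<in>Basis. f b (g b))" for g :: "'a \<Rightarrow> real"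
    by (intro prod.cong) auto
  show "integrable lborel (\<lambda>x::'a. \<Prod>b\<in>Basis. f b (x \<bullet> b))"
    unfolding lborel_eq[where 'a='a] integrable_distr_eq[OF T m] eq
    by (rule product_integrable_prod) (auto intro: f)
  show "(LBINT x. (\<Prod>b\<in>Basis. f b ((x::'a) \<bullet> b))) = (\<Prod>b\<in>Basis. LBINT y. f b y)"
    unfolding lborel_eq[where 'a='a] integral_distr[OF T m] eq
    by (rule product_integral_prod) (auto intro: f)
qed

section \<open>The Gaussian and its transform\<close>

text \<open>Read off from the characteristic function of the standard normal distribution;
  \<open>sqrt (2 * pi)\<close> undoes the normalization of its density.\<close>

lemma fourier_exp_neg_half_square:
  "integrable lborel (\<lambda>x::real. complex_of_real (exp (- x\<^sup>2 / 2)) * cis (w * x))"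
  "(LBINT x. complex_of_real (exp (- x\<^sup>2 / 2)) * cis (w * x)) = complex_of_real (sqrt (2 * pi) * exp (- w\<^sup>2 / 2))"
proof -
  have eq: "complex_of_real (exp (- x\<^sup>2 / 2)) * cis (w * x) = complex_of_real (sqrt (2 * pi)) * (std_normal_density x *\<^sub>R iexp (w * x))" for x
    by (simp add: normal_density_def cis_conv_exp scaleR_conv_of_real)
  have i: "integrable lborel (\<lambda>x. std_normal_density x *\<^sub>R iexp (w * x))"
    by (rule Bochner_Integration.integrable_bound[OF integrable_normal_density[of 1 0]]) auto
  show "integrable lborel (\<lambda>x::real. complex_of_real (exp (- x\<^sup>2 / 2)) * cis (w * x))"
    unfolding eq by (rule integrable_mult_right[OF i])
  have "(LBINT x. std_normal_density x *\<^sub>R iexp (w * x)) = char std_normal_distribution w"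
    unfolding char_def by (subst integral_density) auto
  then show "(LBINT x. complex_of_real (exp (- x\<^sup>2 / 2)) * cis (w * x)) = complex_of_real (sqrt (2 * pi) * exp (- w\<^sup>2 / 2))"
    unfolding eq integral_mult_right_zero by (simp add: char_std_normal_distribution)
qed

definition gauss :: "'a::euclidean_space \<Rightarrow> real" where
  "gauss x = exp (- (norm x)\<^sup>2 / 2)"

lemma gauss_pos: "0 < gauss x"
  by (simp add: gauss_def)

lemma borel_measurable_gauss [measurable]: "gauss \<in> borel_measurable borel"
  unfolding gauss_def[abs_def] by measurable

lemma gauss_cis_eq_prod:
  "complex_of_real (gauss x) * cis (w \<bullet> x) =
    (\<Prod>b\<in>Basis. complex_of_real (exp (- (x \<bullet> b)\<^sup>2 / 2)) * cis ((w \<bullet> b) * (x \<bullet> b)))"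
proof -
  have "(\<Prod>b\<in>Basis. cis ((w \<bullet> b) * (x \<bullet> b))) = cis (w \<bullet> x)"
    unfolding euclidean_inner[of w x] cis_conv_exp by (simp add: exp_sum sum_distrib_left)
  moreover have "(\<Prod>b\<in>Basis. exp (- (x \<bullet> b)\<^sup>2 / 2)) = gauss x"
    unfolding gauss_def power2_norm_eq_inner euclidean_inner[of x x]
    by (simp add: exp_sum[symmetric] sum_negf sum_divide_distrib[symmetric] power2_eq_square)
  ultimately show ?thesis unfolding prod.distrib of_real_prod[symmetric] by simp
qed

lemma fourier_gauss:
  fixes w :: "'a::euclidean_space"
  shows "integrable lborel (\<lambda>x. complex_of_real (gauss x) * cis (w \<bullet> x))"
    and "(LBINT x. complex_of_real (gauss x) * cis (w \<bullet> x)) = complex_of_real (sqrt (2 * pi) ^ DIM('a) * gauss w)"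
proof -
  show "integrable lborel (\<lambda>x. complex_of_real (gauss x) * cis (w \<bullet> x))"
    unfolding gauss_cis_eq_prod by (rule integral_lborel_prod) (rule fourier_exp_neg_half_square)
  have "(LBINT x. complex_of_real (gauss x) * cis (w \<bullet> x)) =
     (\<Prod>b\<in>Basis. LBINT y. complex_of_real (exp (- y\<^sup>2 / 2)) * cis ((w \<bullet> b) * y))"
    unfolding gauss_cis_eq_prod by (rule integral_lborel_prod) (rule fourier_exp_neg_half_square)
  also have "\<dots> = complex_of_real (sqrt (2 * pi) ^ DIM('a)) * (\<Prod>b\<in>Basis. complex_of_real (exp (- (w \<bullet> b)\<^sup>2 / 2)))"
    unfolding fourier_exp_neg_half_square by (simp add: prod.distrib)
  also have "(\<Prod>b\<in>Basis. complex_of_real (exp (- (w \<bullet> b)\<^sup>2 / 2))) = complex_of_real (gauss w)"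
    using gauss_cis_eq_prod[of w 0] by simp
  finally show "(LBINT x. complex_of_real (gauss x) * cis (w \<bullet> x)) = complex_of_real (sqrt (2 * pi) ^ DIM('a) * gauss w)"
    by simp
qed

lemma integral_gauss:
  "integrable lborel (gauss :: 'a::euclidean_space \<Rightarrow> real)"
  "(LBINT x. gauss (x::'a)) = sqrt (2 * pi) ^ DIM('a)"
proof -
  have i: "integrable lborel (\<lambda>x. complex_of_real (gauss (x::'a)))" using fourier_gauss(1)[of 0] by simp
  then show "integrable lborel (gauss :: 'a \<Rightarrow> real)" by (simp add: complex_of_real_integrable_eq)
  have "complex_of_real (LBINT x. gauss (x::'a)) = complex_of_real (sqrt (2 * pi) ^ DIM('a))"
    using fourier_gauss(2)[of "0::'a"] by (simp add: gauss_def)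
  then show "(LBINT x. gauss (x::'a)) = sqrt (2 * pi) ^ DIM('a)" by (simp only: of_real_eq_iff)
qed

section \<open>Dilations and translations of integrals\<close>

lemma
  fixes f :: "'a::euclidean_space \<Rightarrow> 'b::{banach, second_countable_topology}"
  assumes [measurable]: "f \<in> borel_measurable borel" and c: "0 < c"
  shows integrable_lborel_scaleR: "integrable lborel (\<lambda>x. f (c *\<^sub>R x)) \<longleftrightarrow> integrable lborel f"
    and integral_lborel_scaleR: "(LBINT x. f x) = c ^ DIM('a) *\<^sub>R (LBINT x. f (c *\<^sub>R x))"
proof -
  have L: "lborel = density (distr lborel borel (\<lambda>x::'a. c *\<^sub>R x)) (\<lambda>_. ennreal (c ^ DIM('a)))"
    using lborel_affine[of c "0::'a"] c by simp
  have "integrable lborel f \<longleftrightarrow> integrable (distr lborel borel (\<lambda>x::'a. c *\<^sub>R x)) (\<lambda>x. c ^ DIM('a) *\<^sub>R f x)"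
    by (subst L, subst integrable_density) (use c in auto)
  also have "\<dots> \<longleftrightarrow> integrable lborel (\<lambda>x. c ^ DIM('a) *\<^sub>R f (c *\<^sub>R x))"
    by (subst integrable_distr_eq) auto
  also have "\<dots> \<longleftrightarrow> integrable lborel (\<lambda>x. f (c *\<^sub>R x))"
  proof
    assume "integrable lborel (\<lambda>x. c ^ DIM('a) *\<^sub>R f (c *\<^sub>R x))"
    from integrable_scaleR_right[of "inverse (c ^ DIM('a))", OF this]
    show "integrable lborel (\<lambda>x. f (c *\<^sub>R x))" using c by simp
  qed simp
  finally show "integrable lborel (\<lambda>x. f (c *\<^sub>R x)) \<longleftrightarrow> integrable lborel f" ..
  have "(LBINT x. f x) = (LINT x|distr lborel borel (\<lambda>x::'a. c *\<^sub>R x). c ^ DIM('a) *\<^sub>R f x)"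
    by (subst L, subst integral_density) (use c in auto)
  also have "\<dots> = c ^ DIM('a) *\<^sub>R (LBINT x. f (c *\<^sub>R x))"
    by (subst integral_distr) auto
  finally show "(LBINT x. f x) = c ^ DIM('a) *\<^sub>R (LBINT x. f (c *\<^sub>R x))" .
qed

lemma
  fixes f :: "'a::euclidean_space \<Rightarrow> 'b::{banach, second_countable_topology}"
  assumes [measurable]: "f \<in> borel_measurable borel"
  shows integrable_lborel_translate: "integrable lborel (\<lambda>x. f (c + x)) \<longleftrightarrow> integrable lborel f"
    and integral_lborel_translate: "(LBINT x. f (c + x)) = (LBINT x. f x)"
proof -
  show "integrable lborel (\<lambda>x. f (c + x)) \<longleftrightarrow> integrable lborel f"
    by (subst (2) lborel_distr_plus[of c, symmetric], subst integrable_distr_eq) auto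
  show "(LBINT x. f (c + x)) = (LBINT x. f x)"
    by (subst (2) lborel_distr_plus[of c, symmetric], subst integral_distr) auto
qed

section \<open>The transform of square integrable functions with bounded support\<close>

text \<open>Neither normalized nor with the usual negative exponent: this is why Plancherel's
  identity carries the factor (2 pi)^n and the i-th derivative has the symbol - i \<xi>_i.\<close>

definition fhat :: "('a::euclidean_space \<Rightarrow> real) \<Rightarrow> 'a \<Rightarrow> complex" where
  "fhat u \<xi> = (LBINT x. complex_of_real (u x) * cis (\<xi> \<bullet> x))"

text \<open>Bounded support puts the function into L1 too, so that \<open>fhat\<close> is an
  absolutely convergent integral.\<close>

definition square_integrable_bounded :: "('a::euclidean_space \<Rightarrow> real) \<Rightarrow> bool" where
  "square_integrable_bounded u \<longleftrightarrow> u \<in> borel_measurable borel \<and> integrable lborel (\<lambda>x. (u x)\<^sup>2) \<and> bounded {x. u x \<noteq> 0}"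

lemma square_integrable_mult:
  fixes u v :: "'a \<Rightarrow> real"
  assumes [measurable]: "u \<in> borel_measurable M" "v \<in> borel_measurable M"
    and "integrable M (\<lambda>x. (u x)\<^sup>2)" "integrable M (\<lambda>x. (v x)\<^sup>2)"
  shows "integrable M (\<lambda>x. u x * v x)"
proof (rule Bochner_Integration.integrable_bound[where f="\<lambda>x. (u x)\<^sup>2 + (v x)\<^sup>2"])
  show "integrable M (\<lambda>x. (u x)\<^sup>2 + (v x)\<^sup>2)" using assms by simp
  have "norm (u x * v x) \<le> norm ((u x)\<^sup>2 + (v x)\<^sup>2)" for x
  proof -
    have "2 * (\<bar>u x\<bar> * \<bar>v x\<bar>) \<le> (u x)\<^sup>2 + (v x)\<^sup>2"
      using sum_squares_bound[of "\<bar>u x\<bar>" "\<bar>v x\<bar>"] by simp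
    moreover have "0 \<le> \<bar>u x\<bar> * \<bar>v x\<bar>" by simp
    ultimately have "\<bar>u x\<bar> * \<bar>v x\<bar> \<le> (u x)\<^sup>2 + (v x)\<^sup>2" by linarith
    then show ?thesis by (simp add: abs_mult)
  qed
  then show "AE x in M. norm (u x * v x) \<le> norm ((u x)\<^sup>2 + (v x)\<^sup>2)" by simp
qed simp

lemma square_integrable_lincomb:
  fixes u v :: "'a \<Rightarrow> real"
  assumes [measurable]: "u \<in> borel_measurable M" "v \<in> borel_measurable M"
    and "integrable M (\<lambda>x. (u x)\<^sup>2)" "integrable M (\<lambda>x. (v x)\<^sup>2)"
  shows "integrable M (\<lambda>x. (a * u x + b * v x)\<^sup>2)"
proof -
  have "(a * u x + b * v x)\<^sup>2 = a\<^sup>2 * (u x)\<^sup>2 + 2 * a * b * (u x * v x) + b\<^sup>2 * (v x)\<^sup>2" for x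
    by (simp add: power2_eq_square algebra_simps)
  then show ?thesis using assms square_integrable_mult[OF assms] by simp
qed

lemma bounded_support_lincomb:
  fixes u v :: "'a::euclidean_space \<Rightarrow> real"
  assumes "bounded {x. u x \<noteq> 0}" "bounded {x. v x \<noteq> 0}"
  shows "bounded {x. a * u x + b * v x \<noteq> 0}"
  by (rule bounded_subset[of "{x. u x \<noteq> 0} \<union> {x. v x \<noteq> 0}"]) (use assms in auto)

lemma square_integrable_bounded_lincomb:
  assumes "square_integrable_bounded u" "square_integrable_bounded v"
  shows "square_integrable_bounded (\<lambda>x. a * u x + b * v x)"
proof -
  have [measurable]: "u \<in> borel_measurable borel" "v \<in> borel_measurable borel"
    using assms by (auto simp: square_integrable_bounded_def)
  show ?thesis
    using assms square_integrable_lincomb[of u lborel v a b] bounded_support_lincomb[of u v a b]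
    by (auto simp: square_integrable_bounded_def)
qed

lemma square_integrable_bounded_integrable:
  assumes "square_integrable_bounded u"
  shows "integrable lborel u"
proof -
  have [measurable]: "u \<in> borel_measurable borel" and sq: "integrable lborel (\<lambda>x. (u x)\<^sup>2)"
    and bd: "bounded {x. u x \<noteq> 0}"
    using assms by (auto simp: square_integrable_bounded_def)
  obtain B where B: "\<And>x. u x \<noteq> 0 \<Longrightarrow> x \<in> cball 0 B"
    using bd by (auto simp: bounded_iff)
  have i: "integrable lborel (\<lambda>x. indicator (cball (0::'a) B) x :: real)"
    using emeasure_bounded_finite[of "cball (0::'a) B"] by (simp add: integrable_indicator_iff)
  then have "integrable lborel (\<lambda>x. (indicator (cball (0::'a) B) x :: real)\<^sup>2)"
    by (rule Bochner_Integration.integrable_cong[THEN iffD1, rotated -1]) (auto simp: indicator_def)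
  then have "integrable lborel (\<lambda>x. u x * indicator (cball 0 B) x)"
    by (intro square_integrable_mult sq) auto
  moreover have "u x * indicator (cball 0 B) x = u x" for x
    using B[of x] by (auto simp: indicator_def)
  ultimately show ?thesis by simp
qed

lemma fhat_integrable:
  assumes "integrable lborel u"
  shows "integrable lborel (\<lambda>x. complex_of_real (u x) * cis (\<xi> \<bullet> x))"
proof (rule Bochner_Integration.integrable_bound[OF assms])
  have [measurable]: "u \<in> borel_measurable borel" using borel_measurable_integrable[OF assms] by simp
  show "(\<lambda>x. complex_of_real (u x) * cis (\<xi> \<bullet> x)) \<in> borel_measurable lborel" by measurable
qed (simp add: norm_mult)

lemma fhat_lincomb:
  assumes "integrable lborel u" "integrable lborel v"
  shows "fhat (\<lambda>x. a * u x + b * v x) \<xi> = a * fhat u \<xi> + b * fhat v \<xi>"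
proof -
  have "complex_of_real (a * u x + b * v x) * cis (\<xi> \<bullet> x) = a * (complex_of_real (u x) * cis (\<xi> \<bullet> x)) + b * (complex_of_real (v x) * cis (\<xi> \<bullet> x))" for x
    by (simp add: algebra_simps)
  then show ?thesis unfolding fhat_def
    using fhat_integrable[OF assms(1)] fhat_integrable[OF assms(2)] by simp
qed

lemma borel_measurable_fhat:
  assumes [measurable]: "u \<in> borel_measurable borel"
  shows "fhat u \<in> borel_measurable borel"
proof -
  have "(\<lambda>\<xi>. LBINT x. complex_of_real (u x) * cis (\<xi> \<bullet> x)) \<in> borel_measurable borel"
    by (rule lborel.borel_measurable_lebesgue_integral) measurable
  then show ?thesis by (simp add: fhat_def[abs_def])
qed

section \<open>Autocorrelation and Plancherel's identity\<close>

text \<open>Its transform is the squared modulus of \<open>fhat u\<close> and its value at 0 is the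
  integral of u^2, so Plancherel's identity is Fourier inversion for this function at the
  origin.\<close>

definition autocorr :: "('a::euclidean_space \<Rightarrow> real) \<Rightarrow> 'a \<Rightarrow> real" where
  "autocorr u h = (LBINT x. u x * u (x + h))"

lemma translate_square_integrable:
  fixes u :: "'a::euclidean_space \<Rightarrow> real"
  assumes [measurable]: "u \<in> borel_measurable borel" and sq: "integrable lborel (\<lambda>x. (u x)\<^sup>2)"
  shows "integrable lborel (\<lambda>x. (u (x + h))\<^sup>2)" "(LBINT x. (u (x + h))\<^sup>2) = (LBINT x. (u x)\<^sup>2)"
    "integrable lborel (\<lambda>x. u x * u (x + h))" "integrable lborel (\<lambda>x. (u (x + h) - u x)\<^sup>2)"
proof -
  show 1: "integrable lborel (\<lambda>x. (u (x + h))\<^sup>2)"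
    using integrable_lborel_translate[of "\<lambda>x. (u x)\<^sup>2" h] sq by (simp add: add.commute)
  show "(LBINT x. (u (x + h))\<^sup>2) = (LBINT x. (u x)\<^sup>2)"
    using integral_lborel_translate[of "\<lambda>x. (u x)\<^sup>2" h] by (simp add: add.commute)
  show "integrable lborel (\<lambda>x. u x * u (x + h))"
    by (rule square_integrable_mult) (use 1 sq in auto)
  have "integrable lborel (\<lambda>x. (1 * u (x + h) + (- 1) * u x)\<^sup>2)"
    by (rule square_integrable_lincomb) (use 1 sq in auto)
  then show "integrable lborel (\<lambda>x. (u (x + h) - u x)\<^sup>2)" by simp
qed

text \<open>Reduces continuity of the autocorrelation at 0 to continuity of translations in L2:
  expand the square and use translation invariance.\<close>

lemma autocorr_eq:
  fixes u :: "'a::euclidean_space \<Rightarrow> real"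
  assumes [measurable]: "u \<in> borel_measurable borel" and sq: "integrable lborel (\<lambda>x. (u x)\<^sup>2)"
  shows "autocorr u h = (LBINT x. (u x)\<^sup>2) - (LBINT x. (u (x + h) - u x)\<^sup>2) / 2"
proof -
  note t = translate_square_integrable[OF assms, of h]
  have "(LBINT x. (u (x + h) - u x)\<^sup>2) = (LBINT x. (u (x + h))\<^sup>2 + (u x)\<^sup>2 - 2 * (u x * u (x + h)))"
    by (intro Bochner_Integration.integral_cong) (auto simp: power2_eq_square algebra_simps)
  also have "\<dots> = 2 * (LBINT x. (u x)\<^sup>2) - 2 * autocorr u h"
    unfolding autocorr_def using t sq by simp
  finally show ?thesis by linarith
qed

lemma abs_autocorr_le:
  fixes u :: "'a::euclidean_space \<Rightarrow> real"
  assumes [measurable]: "u \<in> borel_measurable borel" and sq: "integrable lborel (\<lambda>x. (u x)\<^sup>2)"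
  shows "\<bar>autocorr u h\<bar> \<le> (LBINT x. (u x)\<^sup>2)"
proof -
  note t = translate_square_integrable[OF assms, of h]
  have "\<bar>autocorr u h\<bar> \<le> (LBINT x. \<bar>u x * u (x + h)\<bar>)"
    unfolding autocorr_def by (rule integral_abs_bound)
  also have "\<dots> \<le> (LBINT x. ((u x)\<^sup>2 + (u (x + h))\<^sup>2) / 2)"
  proof (rule integral_mono)
    show "\<bar>u x * u (x + h)\<bar> \<le> ((u x)\<^sup>2 + (u (x + h))\<^sup>2) / 2" for x
      using sum_squares_bound[of "\<bar>u x\<bar>" "\<bar>u (x + h)\<bar>"] by (simp add: abs_mult)
  qed (use t sq in auto)
  also have "\<dots> = (LBINT x. (u x)\<^sup>2)" using t sq by simp
  finally show ?thesis .
qed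

text \<open>By Fubini's theorem. For fixed \<open>x\<close>, the wave at \<open>z\<close> is the
  conjugate wave at \<open>x\<close> times the wave at \<open>x + z\<close>, and translation turns
  the inner integral into \<open>fhat u\<close>.\<close>

lemma autocorr_fourier:
  fixes u :: "'a::euclidean_space \<Rightarrow> real"
  assumes u: "integrable lborel u"
  shows "integrable lborel (autocorr u)"
    and "fhat (autocorr u) \<xi> = complex_of_real ((cmod (fhat u \<xi>))\<^sup>2)"
proof -
  let ?K = "\<lambda>x z. complex_of_real (u x * u (x + z)) * cis (\<xi> \<bullet> z)"
  have [measurable]: "u \<in> borel_measurable borel" using borel_measurable_integrable[OF u] by simp
  have tr: "integrable lborel (\<lambda>z. u (x + z))" "(LBINT z. \<bar>u (x + z)\<bar>) = (LBINT z. \<bar>u z\<bar>)" for x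
    using integrable_lborel_translate[of u x] integral_lborel_translate[of "\<lambda>z. \<bar>u z\<bar>" x] u by auto
  have I: "integrable (lborel \<Otimes>\<^sub>M lborel) (\<lambda>(x, z). u x * u (x + z))"
  proof (rule lborel_pair.Fubini_integrable)
    show "integrable lborel (\<lambda>x. LBINT z. norm (case (x, z) of (x, z) \<Rightarrow> u x * u (x + z)))"
      using u tr(2) by (simp add: abs_mult)
    show "AE x in lborel. integrable lborel (\<lambda>z. case (x, z) of (x, z) \<Rightarrow> u x * u (x + z))"
      using tr(1) by simp
  qed measurable
  then show "integrable lborel (autocorr u)"
    unfolding autocorr_def[abs_def] by (rule lborel_pair.integrable_snd)
  have I2: "integrable (lborel \<Otimes>\<^sub>M lborel) (\<lambda>(x, z). ?K x z)"
    by (rule Bochner_Integration.integrable_bound[OF I]) (auto simp: norm_mult split_beta)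
  have "fhat (autocorr u) \<xi> = (LBINT z. LBINT x. ?K x z)"
    unfolding fhat_def autocorr_def integral_complex_of_real[symmetric] integral_mult_left_zero[symmetric] ..
  also have "\<dots> = (LBINT x. LBINT z. ?K x z)"
    by (rule lborel_pair.Fubini_integral[OF I2])
  also have "\<dots> = (LBINT x. complex_of_real (u x) * cnj (cis (\<xi> \<bullet> x)) * fhat u \<xi>)"
  proof (rule Bochner_Integration.integral_cong[OF refl])
    fix x :: 'a
    have sh: "cis (\<xi> \<bullet> z) = cnj (cis (\<xi> \<bullet> x)) * cis (\<xi> \<bullet> (x + z))" for z
      unfolding cis_cnj cis_mult inner_add_right by simp
    have "(LBINT z. ?K x z) =
       (LBINT z. complex_of_real (u x) * cnj (cis (\<xi> \<bullet> x)) * (complex_of_real (u (x + z)) * cis (\<xi> \<bullet> (x + z))))"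
      by (intro Bochner_Integration.integral_cong[OF refl], subst sh) (simp only: of_real_mult mult_ac)
    also have "\<dots> = complex_of_real (u x) * cnj (cis (\<xi> \<bullet> x)) * (LBINT z. complex_of_real (u (x + z)) * cis (\<xi> \<bullet> (x + z)))"
      by simp
    also have "(LBINT z. complex_of_real (u (x + z)) * cis (\<xi> \<bullet> (x + z))) = fhat u \<xi>"
      unfolding fhat_def by (rule integral_lborel_translate) measurable
    finally show "(LBINT z. ?K x z) = complex_of_real (u x) * cnj (cis (\<xi> \<bullet> x)) * fhat u \<xi>" .
  qed
  also have "\<dots> = (LBINT x. cnj (complex_of_real (u x) * cis (\<xi> \<bullet> x))) * fhat u \<xi>"
    unfolding integral_mult_left_zero complex_cnj_mult complex_cnj_complex_of_real ..
  also have "(LBINT x. cnj (complex_of_real (u x) * cis (\<xi> \<bullet> x))) = cnj (fhat u \<xi>)"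
    unfolding fhat_def by (rule Bochner_Integration.integral_cnj)
  finally show "fhat (autocorr u) \<xi> = complex_of_real ((cmod (fhat u \<xi>))\<^sup>2)"
    unfolding complex_norm_square by (simp add: mult.commute)
qed

text \<open>The Gaussian factor makes the integral over \<xi> converge absolutely, so Fubini's
  theorem applies before |fhat u|^2 is known to be integrable; the Gaussian itself is reproduced by
  the transform.\<close>

lemma gauss_weighted_plancherel:
  fixes u :: "'a::euclidean_space \<Rightarrow> real"
  assumes u: "integrable lborel u" and s: "0 < s"
  shows "(LBINT \<xi>. (cmod (fhat u \<xi>))\<^sup>2 * gauss (s *\<^sub>R \<xi>)) =
    sqrt (2 * pi) ^ DIM('a) * (LBINT z. autocorr u (s *\<^sub>R z) * gauss z)"
    and "integrable lborel (\<lambda>\<xi>. (cmod (fhat u \<xi>))\<^sup>2 * gauss (s *\<^sub>R \<xi>))"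
proof -
  let ?n = "DIM('a)"
  let ?c = "sqrt (2 * pi) ^ ?n"
  let ?K = "\<lambda>\<xi> z. complex_of_real (gauss (s *\<^sub>R \<xi>)) * (complex_of_real (autocorr u z) * cis (\<xi> \<bullet> z))"
  have [measurable]: "u \<in> borel_measurable borel" using borel_measurable_integrable[OF u] by simp
  have A: "integrable lborel (autocorr u)" by (rule autocorr_fourier(1)[OF u])
  have [measurable]: "autocorr u \<in> borel_measurable borel" using borel_measurable_integrable[OF A] by simp
  have [measurable]: "fhat u \<in> borel_measurable borel" by (rule borel_measurable_fhat) measurable
  have gi: "integrable lborel (\<lambda>\<xi>::'a. gauss (s *\<^sub>R \<xi>))"
    using integrable_lborel_scaleR[of "gauss :: 'a \<Rightarrow> real" s] integral_gauss(1)[where 'a='a] s by simp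
  have I: "integrable (lborel \<Otimes>\<^sub>M lborel) (\<lambda>(\<xi>, z). ?K \<xi> z)"
  proof (rule lborel_pair.Fubini_integrable)
    show "integrable lborel (\<lambda>\<xi>. LBINT z. norm (case (\<xi>, z) of (\<xi>, z) \<Rightarrow> ?K \<xi> z))"
      using gi gauss_pos by (simp add: norm_mult less_imp_le)
    show "AE \<xi> in lborel. integrable lborel (\<lambda>z. case (\<xi>, z) of (\<xi>, z) \<Rightarrow> ?K \<xi> z)"
      using fhat_integrable[OF A] by simp
  qed measurable
  have fg: "(LBINT \<xi>. complex_of_real (gauss (s *\<^sub>R \<xi>)) * cis (\<xi> \<bullet> z)) = complex_of_real (?c * gauss (z /\<^sub>R s) / s ^ ?n)" for z :: 'a
  proof -
    have "complex_of_real (?c * gauss (z /\<^sub>R s)) = (LBINT \<xi>. complex_of_real (gauss \<xi>) * cis ((z /\<^sub>R s) \<bullet> \<xi>))"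
      unfolding fourier_gauss(2)[of "z /\<^sub>R s"] ..
    also have "\<dots> = s ^ ?n *\<^sub>R (LBINT \<xi>. complex_of_real (gauss (s *\<^sub>R \<xi>)) * cis ((z /\<^sub>R s) \<bullet> (s *\<^sub>R \<xi>)))"
      by (rule integral_lborel_scaleR[OF _ s]) measurable
    also have "\<dots> = s ^ ?n *\<^sub>R (LBINT \<xi>. complex_of_real (gauss (s *\<^sub>R \<xi>)) * cis (\<xi> \<bullet> z))"
    proof -
      have "(z /\<^sub>R s) \<bullet> (s *\<^sub>R \<xi>) = \<xi> \<bullet> z" for \<xi>
        using s by (simp add: inner_commute mult.assoc[symmetric])
      then show ?thesis by (simp only:)
    qed
    finally show ?thesis using s by (simp add: scaleR_conv_of_real field_simps)
  qed
  have e1: "complex_of_real ((cmod (fhat u \<xi>))\<^sup>2 * gauss (s *\<^sub>R \<xi>)) = (LBINT z. ?K \<xi> z)" for \<xi>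
  proof -
    have "complex_of_real ((cmod (fhat u \<xi>))\<^sup>2 * gauss (s *\<^sub>R \<xi>)) = complex_of_real (gauss (s *\<^sub>R \<xi>)) * fhat (autocorr u) \<xi>"
      unfolding autocorr_fourier(2)[OF u] by simp
    then show ?thesis unfolding fhat_def by (simp only: integral_mult_right_zero)
  qed
  have "integrable lborel (\<lambda>\<xi>. complex_of_real ((cmod (fhat u \<xi>))\<^sup>2 * gauss (s *\<^sub>R \<xi>)))"
    unfolding e1 by (rule lborel_pair.integrable_fst[OF I])
  then show "integrable lborel (\<lambda>\<xi>. (cmod (fhat u \<xi>))\<^sup>2 * gauss (s *\<^sub>R \<xi>))"
    by (simp only: complex_of_real_integrable_eq)
  have "complex_of_real (LBINT \<xi>. (cmod (fhat u \<xi>))\<^sup>2 * gauss (s *\<^sub>R \<xi>)) =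
     (LBINT \<xi>. LBINT z. ?K \<xi> z)"
    unfolding integral_complex_of_real[symmetric] e1 ..
  also have "\<dots> = (LBINT z. LBINT \<xi>. ?K \<xi> z)"
    by (rule lborel_pair.Fubini_integral[OF I, symmetric])
  also have "\<dots> = (LBINT z. complex_of_real (autocorr u z * (?c * gauss (z /\<^sub>R s) / s ^ ?n)))"
  proof (rule Bochner_Integration.integral_cong[OF refl])
    fix z :: 'a
    have "(LBINT \<xi>. ?K \<xi> z) =
      (LBINT \<xi>. complex_of_real (autocorr u z) * (complex_of_real (gauss (s *\<^sub>R \<xi>)) * cis (\<xi> \<bullet> z)))"
      by (simp only: mult_ac)
    then show "(LBINT \<xi>. ?K \<xi> z) =
      complex_of_real (autocorr u z * (?c * gauss (z /\<^sub>R s) / s ^ ?n))"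
      by (simp only: integral_mult_right_zero fg of_real_mult)
  qed
  also have "\<dots> = complex_of_real (LBINT z. autocorr u z * (?c * gauss (z /\<^sub>R s) / s ^ ?n))"
    by (rule integral_complex_of_real)
  finally have "(LBINT \<xi>. (cmod (fhat u \<xi>))\<^sup>2 * gauss (s *\<^sub>R \<xi>)) = (LBINT z. autocorr u z * (?c * gauss (z /\<^sub>R s) / s ^ ?n))"
    by (simp only: of_real_eq_iff)
  \<comment> \<open>Rescaling moves the parameter \<open>s\<close> from the Gaussian into the
    argument of the autocorrelation, ready for the limit s -> 0.\<close>
  also have "\<dots> = s ^ ?n *\<^sub>R (LBINT z. autocorr u (s *\<^sub>R z) * (?c * gauss ((s *\<^sub>R z) /\<^sub>R s) / s ^ ?n))"
    by (rule integral_lborel_scaleR[OF _ s]) measurable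
  also have "\<dots> = s ^ ?n * (LBINT z. (?c / s ^ ?n) * (autocorr u (s *\<^sub>R z) * gauss z))"
    using s by (simp add: mult_ac)
  also have "\<dots> = ?c * (LBINT z. autocorr u (s *\<^sub>R z) * gauss z)"
    unfolding integral_mult_right_zero using s by simp
  finally show "(LBINT \<xi>. (cmod (fhat u \<xi>))\<^sup>2 * gauss (s *\<^sub>R \<xi>)) = ?c * (LBINT z. autocorr u (s *\<^sub>R z) * gauss z)" .
qed

text \<open>The limit holds for every square integrable function; it is a hypothesis here because it is easily obtained for
  limits of continuous functions, and only those occur.\<close>

definition translation_continuous :: "('a::euclidean_space \<Rightarrow> real) \<Rightarrow> bool" where
  "translation_continuous u \<longleftrightarrow> square_integrable_bounded u \<and>
     ((\<lambda>h. LBINT x. (u (x + h) - u x)\<^sup>2) \<longlongrightarrow> 0) (at 0)"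

text \<open>The parameter of the Gaussian weight tends to 0. On the side of the autocorrelation,
  dominated convergence and continuity at 0 give the limit; on the other side the integrands
  increase, so monotone convergence yields integrability and value together.\<close>

theorem plancherel:
  fixes u :: "'a::euclidean_space \<Rightarrow> real"
  assumes "translation_continuous u"
  shows "integrable lborel (\<lambda>\<xi>. (cmod (fhat u \<xi>))\<^sup>2)"
    and "(LBINT \<xi>. (cmod (fhat u \<xi>))\<^sup>2) = (2 * pi) ^ DIM('a) * (LBINT x. (u x)\<^sup>2)"
proof -
  have sb: "square_integrable_bounded u" and tc: "((\<lambda>h. LBINT x. (u (x + h) - u x)\<^sup>2) \<longlongrightarrow> 0) (at 0)"
    using assms by (auto simp: translation_continuous_def)
  then have [measurable]: "u \<in> borel_measurable borel" and sq: "integrable lborel (\<lambda>x. (u x)\<^sup>2)"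
    by (auto simp: square_integrable_bounded_def)
  have u: "integrable lborel u" by (rule square_integrable_bounded_integrable[OF sb])
  have A: "integrable lborel (autocorr u)" by (rule autocorr_fourier(1)[OF u])
  have [measurable]: "autocorr u \<in> borel_measurable borel" using borel_measurable_integrable[OF A] by simp
  have [measurable]: "fhat u \<in> borel_measurable borel" by (rule borel_measurable_fhat) measurable
  define S where "S = (LBINT x. (u x)\<^sup>2)"
  let ?c = "sqrt (2 * pi) ^ DIM('a)"
  define s where "s = (\<lambda>j. inverse (real (Suc j)))"
  have s0: "0 < s j" for j by (simp add: s_def)
  have slim: "s \<longlonglongrightarrow> 0" unfolding s_def by (rule LIMSEQ_inverse_real_of_nat)
  have "((\<lambda>h. S - (LBINT x. (u (x + h) - u x)\<^sup>2) / 2) \<longlongrightarrow> S - 0 / 2) (at 0)"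
    by (intro tendsto_intros tc) auto
  then have Alim: "(autocorr u \<longlongrightarrow> S) (at 0)"
    unfolding S_def using autocorr_eq[of u] sq by (subst tendsto_cong[OF always_eventually]) (auto simp: S_def)
  have A0: "autocorr u 0 = S" by (simp add: autocorr_def S_def power2_eq_square)
  have Acont: "isCont (autocorr u) 0" unfolding isCont_def A0 by (rule Alim)
  have ptw: "(\<lambda>j. autocorr u (s j *\<^sub>R z)) \<longlonglongrightarrow> S" for z :: 'a
  proof -
    have "(\<lambda>j. s j *\<^sub>R z) \<longlonglongrightarrow> 0 *\<^sub>R z" by (intro tendsto_intros slim)
    then have "(\<lambda>j. s j *\<^sub>R z) \<longlonglongrightarrow> 0" by simp
    from isCont_tendsto_compose[OF Acont this] show ?thesis by (simp add: A0)
  qed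
  have "(\<lambda>j. LBINT z. autocorr u (s j *\<^sub>R z) * gauss z) \<longlonglongrightarrow> (LBINT z. S * gauss (z::'a))"
  proof (rule integral_dominated_convergence)
    show "integrable lborel (\<lambda>z::'a. S * gauss z)" using integral_gauss(1)[where 'a='a] by simp
    show "AE z in lborel. (\<lambda>j. autocorr u (s j *\<^sub>R z) * gauss z) \<longlonglongrightarrow> S * gauss z"
      by (intro AE_I2 tendsto_intros ptw)
    show "AE z in lborel. norm (autocorr u (s j *\<^sub>R z) * gauss z) \<le> S * gauss z" for j
    proof (rule AE_I2)
      fix z :: 'a
      have "\<bar>autocorr u (s j *\<^sub>R z)\<bar> \<le> S"
        unfolding S_def by (rule abs_autocorr_le) (use sq in auto)
      then have "\<bar>autocorr u (s j *\<^sub>R z)\<bar> * gauss z \<le> S * gauss z"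
        using gauss_pos[of z] by (intro mult_right_mono) auto
      then show "norm (autocorr u (s j *\<^sub>R z) * gauss z) \<le> S * gauss z"
        using gauss_pos[of z] by (simp add: abs_mult)
    qed
  qed measurable
  then have "(\<lambda>j. ?c * (LBINT z. autocorr u (s j *\<^sub>R z) * gauss z)) \<longlonglongrightarrow> ?c * (S * ?c)"
    by (intro tendsto_intros) (simp add: integral_gauss(2))
  moreover have "?c * (S * ?c) = (2 * pi) ^ DIM('a) * S"
  proof -
    have "?c * ?c = (2 * pi) ^ DIM('a)" unfolding power_mult_distrib[symmetric] by simp
    then show ?thesis by (simp only: mult_ac)
  qed
  ultimately have lim: "(\<lambda>j. LBINT \<xi>. (cmod (fhat u \<xi>))\<^sup>2 * gauss (s j *\<^sub>R \<xi>)) \<longlonglongrightarrow> (2 * pi) ^ DIM('a) * S"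
    using gauss_weighted_plancherel(1)[OF u s0] by simp
  have mono: "mono (\<lambda>j. (cmod (fhat u \<xi>))\<^sup>2 * gauss (s j *\<^sub>R \<xi>))" for \<xi>
  proof (rule monoI, rule mult_left_mono)
    fix i j :: nat assume "i \<le> j"
    then have "s j \<le> s i" by (simp add: s_def le_imp_inverse_le)
    then have "(s j * norm \<xi>)\<^sup>2 \<le> (s i * norm \<xi>)\<^sup>2"
      using s0[of j] by (intro power_mono mult_right_mono) auto
    then show "gauss (s i *\<^sub>R \<xi>) \<le> gauss (s j *\<^sub>R \<xi>)"
      using s0[of i] s0[of j] by (simp add: gauss_def)
  qed simp
  have ptw2: "(\<lambda>j. (cmod (fhat u \<xi>))\<^sup>2 * gauss (s j *\<^sub>R \<xi>)) \<longlonglongrightarrow> (cmod (fhat u \<xi>))\<^sup>2" for \<xi>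
  proof -
    have "(\<lambda>j. (cmod (fhat u \<xi>))\<^sup>2 * exp (- (norm (s j *\<^sub>R \<xi>))\<^sup>2 / 2)) \<longlonglongrightarrow> (cmod (fhat u \<xi>))\<^sup>2 * exp (- (norm (0 *\<^sub>R \<xi>))\<^sup>2 / 2)"
      by (intro tendsto_intros slim) auto
    then show ?thesis by (simp add: gauss_def)
  qed
  show "integrable lborel (\<lambda>\<xi>. (cmod (fhat u \<xi>))\<^sup>2)"
    by (rule integrable_monotone_convergence[OF gauss_weighted_plancherel(2)[OF u s0] _ _ lim])
       (use mono ptw2 in auto)
  show "(LBINT \<xi>. (cmod (fhat u \<xi>))\<^sup>2) = (2 * pi) ^ DIM('a) * (LBINT x. (u x)\<^sup>2)"
    unfolding S_def[symmetric]
    by (rule integral_monotone_convergence[OF gauss_weighted_plancherel(2)[OF u s0] _ _ lim])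
       (use mono ptw2 in auto)
qed

section \<open>Functions that are continuous under translation in L2\<close>

lemma translation_continuousI:
  assumes "square_integrable_bounded u" "\<And>h. (LBINT x. (u (x + h) - u x)\<^sup>2) \<le> B h" "(B \<longlongrightarrow> 0) (at 0)"
  shows "translation_continuous u"
  unfolding translation_continuous_def
proof
  show "((\<lambda>h. LBINT x. (u (x + h) - u x)\<^sup>2) \<longlongrightarrow> 0) (at 0)"
  proof (rule tendsto_sandwich[OF _ _ tendsto_const assms(3)])
    show "\<forall>\<^sub>F h in at 0. 0 \<le> (LBINT x. (u (x + h) - u x)\<^sup>2)"
      by (intro always_eventually allI Bochner_Integration.integral_nonneg zero_le_power2)
    show "\<forall>\<^sub>F h in at 0. (LBINT x. (u (x + h) - u x)\<^sup>2) \<le> B h"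
      by (intro always_eventually allI assms(2))
  qed
qed fact

lemma translation_continuousD:
  assumes "translation_continuous u"
  shows "square_integrable_bounded u" "u \<in> borel_measurable borel" "integrable lborel (\<lambda>x. (u x)\<^sup>2)" "integrable lborel u"
    "((\<lambda>h. LBINT x. (u (x + h) - u x)\<^sup>2) \<longlongrightarrow> 0) (at 0)"
proof -
  have u: "square_integrable_bounded u" "((\<lambda>h. LBINT x. (u (x + h) - u x)\<^sup>2) \<longlongrightarrow> 0) (at 0)"
    using assms unfolding translation_continuous_def by (rule conjunct1, rule conjunct2)
  show "square_integrable_bounded u" "((\<lambda>h. LBINT x. (u (x + h) - u x)\<^sup>2) \<longlongrightarrow> 0) (at 0)" by (rule u)+
  show "integrable lborel u" by (rule square_integrable_bounded_integrable[OF u(1)])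
  show "u \<in> borel_measurable borel" "integrable lborel (\<lambda>x. (u x)\<^sup>2)"
    using u(1) unfolding square_integrable_bounded_def by blast+
qed

lemma sum_power2_le: "(a + b)\<^sup>2 \<le> 2 * a\<^sup>2 + 2 * b\<^sup>2" for a b :: real
  using sum_squares_bound[of a b] by (simp add: power2_sum)

lemma sum_power2_le3: "(c + b - a)\<^sup>2 \<le> 4 * a\<^sup>2 + 4 * b\<^sup>2 + 2 * c\<^sup>2" for a b c :: real
  using sum_power2_le[of c "b - a"] sum_power2_le[of b "- a"] by (simp add: add_diff_eq)

lemma translation_continuous_lincomb:
  assumes u: "translation_continuous u" and v: "translation_continuous v"
  shows "translation_continuous (\<lambda>x. a * u x + b * v x)"
proof (rule translation_continuousI)
  note U = translation_continuousD[OF u] and V = translation_continuousD[OF v]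
  let ?D = "\<lambda>w h. LBINT x. (w (x + h) - w x)\<^sup>2"
  show "square_integrable_bounded (\<lambda>x. a * u x + b * v x)"
    by (rule square_integrable_bounded_lincomb[OF U(1) V(1)])
  note t = translate_square_integrable(4)[OF U(2,3)] translate_square_integrable(4)[OF V(2,3)]
    translate_square_integrable(4)[of "\<lambda>x. a * u x + b * v x"]
  show "?D (\<lambda>x. a * u x + b * v x) h \<le> 2 * a\<^sup>2 * ?D u h + 2 * b\<^sup>2 * ?D v h" for h
  proof -
    have "?D (\<lambda>x. a * u x + b * v x) h \<le> (LBINT x. 2 * a\<^sup>2 * (u (x + h) - u x)\<^sup>2 + 2 * b\<^sup>2 * (v (x + h) - v x)\<^sup>2)"
    proof (rule integral_mono)
      show "integrable lborel (\<lambda>x. (a * u (x + h) + b * v (x + h) - (a * u x + b * v x))\<^sup>2)"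
        by (rule t(3)) (use square_integrable_bounded_lincomb[OF U(1) V(1)] in \<open>auto simp: square_integrable_bounded_def\<close>)
      show "integrable lborel (\<lambda>x. 2 * a\<^sup>2 * (u (x + h) - u x)\<^sup>2 + 2 * b\<^sup>2 * (v (x + h) - v x)\<^sup>2)"
        using t(1,2) by simp
      fix x
      have e: "a * u (x + h) + b * v (x + h) - (a * u x + b * v x) = a * (u (x + h) - u x) + b * (v (x + h) - v x)"
        by (simp add: algebra_simps)
      show "(a * u (x + h) + b * v (x + h) - (a * u x + b * v x))\<^sup>2 \<le> 2 * a\<^sup>2 * (u (x + h) - u x)\<^sup>2 + 2 * b\<^sup>2 * (v (x + h) - v x)\<^sup>2"
        unfolding e using sum_power2_le[of "a * (u (x + h) - u x)" "b * (v (x + h) - v x)"]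
        by (simp only: power_mult_distrib mult.assoc)
    qed
    also have "\<dots> = 2 * a\<^sup>2 * ?D u h + 2 * b\<^sup>2 * ?D v h" using t(1,2) by simp
    finally show ?thesis .
  qed
  have "((\<lambda>h. 2 * a\<^sup>2 * ?D u h + 2 * b\<^sup>2 * ?D v h) \<longlongrightarrow> 2 * a\<^sup>2 * 0 + 2 * b\<^sup>2 * 0) (at 0)"
    by (intro tendsto_intros U V)
  then show "((\<lambda>h. 2 * a\<^sup>2 * ?D u h + 2 * b\<^sup>2 * ?D v h) \<longlongrightarrow> 0) (at 0)" by simp
qed

text \<open>An increment of \<open>u\<close> is that of \<open>\<phi> j\<close> up to two copies of
  \<open>\<phi> j - u\<close>, one of them translated; by translation invariance both have the same
  norm.\<close>

lemma translation_continuous_limit: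
  fixes u :: "'a::euclidean_space \<Rightarrow> real"
  assumes p: "\<And>j. translation_continuous (\<phi> j)" and u: "square_integrable_bounded u"
    and lim: "(\<lambda>j. LBINT x. (\<phi> j x - u x)\<^sup>2) \<longlonglongrightarrow> 0"
  shows "translation_continuous u"
  unfolding translation_continuous_def
proof (intro conjI u)
  let ?D = "\<lambda>w h. LBINT x. (w (x + h) - w x)\<^sup>2"
  have sb: "square_integrable_bounded (\<lambda>x. \<phi> j x - u x)" for j
    using square_integrable_bounded_lincomb[OF translation_continuousD(1)[OF p] u, of 1 j "-1"] by simp
  have D: "?D u h \<le> 8 * (LBINT x. (\<phi> j x - u x)\<^sup>2) + 2 * ?D (\<phi> j) h" for j h
  proof -
    note w = translate_square_integrable[of "\<lambda>x. \<phi> j x - u x" h] and P = translate_square_integrable(4)[OF translation_continuousD(2,3)[OF p], of j h]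
      and U = translate_square_integrable(4)[of u h]
    have sb': "(\<lambda>x. \<phi> j x - u x) \<in> borel_measurable borel" "integrable lborel (\<lambda>x. (\<phi> j x - u x)\<^sup>2)"
      "u \<in> borel_measurable borel" "integrable lborel (\<lambda>x. (u x)\<^sup>2)"
      using sb[of j] u by (auto simp: square_integrable_bounded_def)
    have "?D u h \<le> (LBINT x. 4 * (\<phi> j (x + h) - u (x + h))\<^sup>2 + 4 * (\<phi> j x - u x)\<^sup>2 + 2 * (\<phi> j (x + h) - \<phi> j x)\<^sup>2)"
    proof (rule integral_mono)
      show "integrable lborel (\<lambda>x. (u (x + h) - u x)\<^sup>2)" by (rule U) fact+
      show "integrable lborel (\<lambda>x. 4 * (\<phi> j (x + h) - u (x + h))\<^sup>2 + 4 * (\<phi> j x - u x)\<^sup>2 + 2 * (\<phi> j (x + h) - \<phi> j x)\<^sup>2)"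
        using w(1)[OF sb'(1,2)] P sb' by simp
      fix x
      let ?a = "\<phi> j (x + h) - u (x + h)" and ?b = "\<phi> j x - u x" and ?c = "\<phi> j (x + h) - \<phi> j x"
      show "(u (x + h) - u x)\<^sup>2 \<le> 4 * ?a\<^sup>2 + 4 * ?b\<^sup>2 + 2 * ?c\<^sup>2"
        using sum_power2_le3[of ?c ?b ?a] by simp
    qed
    also have "\<dots> = 8 * (LBINT x. (\<phi> j x - u x)\<^sup>2) + 2 * ?D (\<phi> j) h"
      using w(1,2)[OF sb'(1,2)] P sb' by simp
    finally show ?thesis .
  qed
  show "(?D u \<longlongrightarrow> 0) (at 0)"
  proof (rule tendstoI)
    fix e :: real assume e: "0 < e"
    \<comment> \<open>The fractions are chosen to fit \<open>D\<close>: 8 e/16 + 2 e/4 = e.\<close>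
    from order_tendstoD(2)[OF lim, of "e / 16"] e obtain j where j: "(LBINT x. (\<phi> j x - u x)\<^sup>2) < e / 16"
      by (auto simp: eventually_sequentially)
    from order_tendstoD(2)[OF translation_continuousD(5)[OF p[of j]], of "e / 4"] e
    have "eventually (\<lambda>h. ?D (\<phi> j) h < e / 4) (at 0)" by simp
    then show "eventually (\<lambda>h. dist (?D u h) 0 < e) (at 0)"
    proof eventually_elim
      case (elim h)
      have "0 \<le> ?D u h" by (intro integral_nonneg_AE) auto
      then show ?case using D[of h j] j elim by (simp add: dist_real_def)
    qed
  qed
qed

text \<open>Dominated convergence along sequences of shifts. Such a sequence is bounded by some
  \<open>K\<close>, so all differences are supported in the ball of radius
  \<open>B + K\<close>.\<close>

lemma translation_continuous_continuous:
  fixes u :: "'a::euclidean_space \<Rightarrow> real"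
  assumes cont: "continuous_on UNIV u" and bd: "bounded {x. u x \<noteq> 0}"
  shows "translation_continuous u"
proof -
  have [measurable]: "u \<in> borel_measurable borel" using cont by (rule borel_measurable_continuous_onI)
  obtain B where B: "\<And>x. u x \<noteq> 0 \<Longrightarrow> norm x \<le> B" using bd by (auto simp: bounded_iff)
  have "bounded (u ` cball 0 B)"
    by (intro compact_imp_bounded compact_continuous_image continuous_on_subset[OF cont]) auto
  then obtain M where "\<forall>y\<in>u ` cball 0 B. norm y \<le> M" unfolding bounded_iff ..
  then have M: "\<bar>u x\<bar> \<le> M" if "norm x \<le> B" for x using that by simp
  define C where "C = max M 0"
  have C0: "0 \<le> C" by (simp add: C_def)
  have C: "\<bar>u x\<bar> \<le> C" for x
    using M[of x] B[of x] by (cases "u x = 0") (auto simp: C_def)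
  have i: "integrable lborel (\<lambda>x. indicator (cball (0::'a) r) x * c :: real)" for r c
    using emeasure_bounded_finite[of "cball (0::'a) r"] by (intro integrable_mult_left) (simp add: integrable_indicator_iff)
  have sq: "integrable lborel (\<lambda>x. (u x)\<^sup>2)"
  proof (rule Bochner_Integration.integrable_bound[OF i[of B "C\<^sup>2"]])
    show "AE x in lborel. norm ((u x)\<^sup>2) \<le> norm (indicator (cball 0 B) x * C\<^sup>2)"
    proof (rule AE_I2)
      fix x
      have "(u x)\<^sup>2 \<le> C\<^sup>2" using power_mono[OF C[of x] abs_ge_zero, of 2] by simp
      then show "norm ((u x)\<^sup>2) \<le> norm (indicator (cball 0 B) x * C\<^sup>2)"
        using B[of x] by (cases "u x = 0") (auto simp: indicator_def)
    qed
  qed simp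
  show ?thesis unfolding translation_continuous_def
  proof
    show "square_integrable_bounded u" using sq bd by (simp add: square_integrable_bounded_def)
    show "((\<lambda>h. LBINT x. (u (x + h) - u x)\<^sup>2) \<longlongrightarrow> 0) (at 0)"
      unfolding tendsto_at_iff_sequentially comp_def
    proof (intro allI impI)
      fix X :: "nat \<Rightarrow> 'a" assume X: "X \<longlonglongrightarrow> 0"
      obtain K where "\<forall>j. norm (X j) \<le> K"
        using convergent_imp_Bseq[OF convergentI[OF X]] by (rule BseqE)
      then have K: "norm (X j) \<le> K" for j by (rule spec)
      have "(\<lambda>j. LBINT x. (u (x + X j) - u x)\<^sup>2) \<longlonglongrightarrow> (LINT x|(lborel :: 'a measure). (0::real))"
      proof (rule integral_dominated_convergence)
        show "integrable lborel (\<lambda>x. indicator (cball (0::'a) (B + K)) x * (2 * C)\<^sup>2)" by (rule i)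
        show "AE x in lborel. (\<lambda>j. (u (x + X j) - u x)\<^sup>2) \<longlonglongrightarrow> 0"
        proof (rule AE_I2)
          fix x
          have "isCont u (x + 0)" using cont by (simp add: continuous_on_eq_continuous_at)
          then have "(\<lambda>j. u (x + X j)) \<longlonglongrightarrow> u (x + 0)"
            by (rule isCont_tendsto_compose) (rule tendsto_add[OF tendsto_const X])
          then have "(\<lambda>j. (u (x + X j) - u x)\<^sup>2) \<longlonglongrightarrow> (u (x + 0) - u x)\<^sup>2" by (intro tendsto_intros)
          then show "(\<lambda>j. (u (x + X j) - u x)\<^sup>2) \<longlonglongrightarrow> 0" by simp
        qed
        show "AE x in lborel. norm ((u (x + X j) - u x)\<^sup>2) \<le> indicator (cball 0 (B + K)) x * (2 * C)\<^sup>2" for j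
        proof (rule AE_I2)
          fix x
          have "\<bar>u (x + X j) - u x\<bar> \<le> 2 * C" using C[of x] C[of "x + X j"] by linarith
          from power_mono[OF this abs_ge_zero, of 2]
          have *: "(u (x + X j) - u x)\<^sup>2 \<le> (2 * C)\<^sup>2" by simp
          have "norm x \<le> B + K" if "u (x + X j) - u x \<noteq> 0"
          proof -
            have "u (x + X j) \<noteq> 0 \<or> u x \<noteq> 0" using that by auto
            then show ?thesis
            proof
              assume "u (x + X j) \<noteq> 0"
              then have "norm (x + X j) \<le> B" by (rule B)
              moreover have "norm x \<le> norm (x + X j) + norm (X j)" using norm_triangle_ineq4[of "x + X j" "X j"] by simp
              ultimately show ?thesis using K[of j] by linarith
            next
              assume "u x \<noteq> 0"
              then show ?thesis using B[of x] K[of j] norm_ge_zero[of "X j"] by linarith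
            qed
          qed
          then show "norm ((u (x + X j) - u x)\<^sup>2) \<le> indicator (cball 0 (B + K)) x * (2 * C)\<^sup>2"
            using * by (cases "u (x + X j) - u x = 0") (auto simp: indicator_def)
        qed
      qed measurable
      then show "(\<lambda>j. LBINT x. (u (x + X j) - u x)\<^sup>2) \<longlonglongrightarrow> 0" by simp
    qed
  qed
qed

text \<open>Polarization with \<open>u + v\<close> and \<open>u - v\<close>. These two combinations
  determine the real part of the product, which is what the energy identities use.\<close>

theorem parseval:
  fixes u v :: "'a::euclidean_space \<Rightarrow> real"
  assumes u: "translation_continuous u" and v: "translation_continuous v"
  shows "integrable lborel (\<lambda>\<xi>. Re (fhat u \<xi> * cnj (fhat v \<xi>)))"
    and "(LBINT \<xi>. Re (fhat u \<xi> * cnj (fhat v \<xi>))) = (2 * pi) ^ DIM('a) * (LBINT x. u x * v x)"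
proof -
  note U = translation_continuousD[OF u] and V = translation_continuousD[OF v]
  define p where "p = (\<lambda>x. 1 * u x + 1 * v x)"
  define m where "m = (\<lambda>x. 1 * u x + (-1) * v x)"
  have tc: "translation_continuous p" "translation_continuous m"
    unfolding p_def m_def by (rule translation_continuous_lincomb[OF u v])+
  have f: "fhat p \<xi> = fhat u \<xi> + fhat v \<xi>" "fhat m \<xi> = fhat u \<xi> - fhat v \<xi>" for \<xi>
    using fhat_lincomb[OF U(4) V(4), of 1 1 \<xi>] fhat_lincomb[OF U(4) V(4), of 1 "-1" \<xi>]
    unfolding p_def m_def of_real_1 of_real_minus mult_1 mult_minus_left by simp_all
  have "Re (a * cnj b) = ((cmod (a + b))\<^sup>2 - (cmod (a - b))\<^sup>2) / 4" for a b :: complex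
    unfolding cmod_power2 by (simp add: power2_eq_square algebra_simps)
  then have e: "Re (fhat u \<xi> * cnj (fhat v \<xi>)) = ((cmod (fhat p \<xi>))\<^sup>2 - (cmod (fhat m \<xi>))\<^sup>2) / 4" for \<xi>
    by (simp only: f)
  show "integrable lborel (\<lambda>\<xi>. Re (fhat u \<xi> * cnj (fhat v \<xi>)))"
    unfolding e using plancherel(1)[OF tc(1)] plancherel(1)[OF tc(2)] by simp
  have "(LBINT \<xi>. Re (fhat u \<xi> * cnj (fhat v \<xi>))) = ((2 * pi) ^ DIM('a) * (LBINT x. (p x)\<^sup>2) - (2 * pi) ^ DIM('a) * (LBINT x. (m x)\<^sup>2)) / 4"
    unfolding e using plancherel[OF tc(1)] plancherel[OF tc(2)] by simp
  also have "\<dots> = (2 * pi) ^ DIM('a) * (((LBINT x. (p x)\<^sup>2) - (LBINT x. (m x)\<^sup>2)) / 4)"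
    by (simp add: algebra_simps)
  also have "((LBINT x. (p x)\<^sup>2) - (LBINT x. (m x)\<^sup>2)) / 4 = (LBINT x. ((p x)\<^sup>2 - (m x)\<^sup>2) / 4)"
    using translation_continuousD(3)[OF tc(1)] translation_continuousD(3)[OF tc(2)] by simp
  also have "\<dots> = (LBINT x. u x * v x)"
    by (intro Bochner_Integration.integral_cong) (auto simp: p_def m_def power2_eq_square algebra_simps)
  finally show "(LBINT \<xi>. Re (fhat u \<xi> * cnj (fhat v \<xi>))) = (2 * pi) ^ DIM('a) * (LBINT x. u x * v x)" .
qed


section \<open>Orthonormal systems\<close>

definition square_integrable :: "'a measure \<Rightarrow> ('a \<Rightarrow> real) \<Rightarrow> bool" where
  "square_integrable M u \<longleftrightarrow> u \<in> borel_measurable M \<and> integrable M (\<lambda>x. (u x)\<^sup>2)"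

lemma square_integrable_mult_integrable:
  "square_integrable M u \<Longrightarrow> square_integrable M v \<Longrightarrow> integrable M (\<lambda>x. u x * v x)"
  unfolding square_integrable_def by (intro square_integrable_mult) blast+

lemma square_integrable_comb:
  "square_integrable M u \<Longrightarrow> square_integrable M v \<Longrightarrow> square_integrable M (\<lambda>x. a * u x + b * v x)"
  unfolding square_integrable_def by (auto intro!: square_integrable_lincomb)

lemma square_integrable_sum:
  assumes "finite I" "\<And>i. i \<in> I \<Longrightarrow> square_integrable M (u i)"
  shows "square_integrable M (\<lambda>x. \<Sum>i\<in>I. c i * u i x)"
  using assms
proof (induction I rule: finite_induct)
  case (insert i I)
  have "square_integrable M (\<lambda>x. c i * u i x + 1 * (\<Sum>i\<in>I. c i * u i x))"
    by (intro square_integrable_comb insert.IH insert.prems) simp_all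
  then show ?case using insert.hyps by simp
qed (simp add: square_integrable_def)

lemma integral_sum_mult:
  assumes "finite I" "\<And>i. i \<in> I \<Longrightarrow> square_integrable M (u i)" "square_integrable M v"
  shows "(LINT x|M. (\<Sum>i\<in>I. c i * u i x) * v x) = (\<Sum>i\<in>I. c i * (LINT x|M. u i x * v x))"
proof -
  have "(LINT x|M. (\<Sum>i\<in>I. c i * u i x) * v x) = (LINT x|M. (\<Sum>i\<in>I. c i * (u i x * v x)))"
    by (simp add: sum_distrib_right mult.assoc)
  also have "\<dots> = (\<Sum>i\<in>I. LINT x|M. c i * (u i x * v x))"
    using square_integrable_mult_integrable[OF assms(2,3)] by (intro Bochner_Integration.integral_sum) simp
  finally show ?thesis by simp
qed

lemma integral_sum_mult_sum:
  assumes "finite I" "\<And>i. i \<in> I \<Longrightarrow> square_integrable M (u i)" "finite J" "\<And>j. j \<in> J \<Longrightarrow> square_integrable M (v j)"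
  shows "(LINT x|M. (\<Sum>i\<in>I. c i * u i x) * (\<Sum>j\<in>J. d j * v j x)) = (\<Sum>i\<in>I. \<Sum>j\<in>J. c i * d j * (LINT x|M. u i x * v j x))"
proof -
  have "(LINT x|M. u i x * (\<Sum>j\<in>J. d j * v j x)) = (\<Sum>j\<in>J. d j * (LINT x|M. u i x * v j x))" if "i \<in> I" for i
    using integral_sum_mult[OF assms(3,4) assms(2)[OF that], where c=d] by (simp add: mult.commute)
  then show ?thesis
    by (subst integral_sum_mult[OF assms(1,2) square_integrable_sum[OF assms(3,4)]])
       (auto simp: sum_distrib_left mult_ac intro!: sum.cong)
qed

lemma integral_cauchy_schwarz:
  assumes "square_integrable M u" "square_integrable M v"
  shows "(LINT x|M. u x * v x)\<^sup>2 \<le> (LINT x|M. (u x)\<^sup>2) * (LINT x|M. (v x)\<^sup>2)"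
proof -
  define U T V where "U = (LINT x|M. (u x)\<^sup>2)" and "T = (LINT x|M. u x * v x)" and "V = (LINT x|M. (v x)\<^sup>2)"
  have nn: "0 \<le> r\<^sup>2 * U + 2 * r * T + V" for r
  proof -
    have "0 \<le> (LINT x|M. (r * u x + v x)\<^sup>2)" by simp
    also have "\<dots> = (LINT x|M. r\<^sup>2 * (u x)\<^sup>2 + 2 * r * (u x * v x) + (v x)\<^sup>2)"
      by (intro Bochner_Integration.integral_cong) (auto simp: power2_eq_square algebra_simps)
    also have "\<dots> = r\<^sup>2 * U + 2 * r * T + V"
      using assms square_integrable_mult_integrable[OF assms] unfolding U_def T_def V_def square_integrable_def by simp
    finally show ?thesis .
  qed
  have U0: "0 \<le> U" by (simp add: U_def)
  have "T\<^sup>2 \<le> U * V"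
  proof (cases "U = 0")
    case True
    have "T = 0"
    proof (rule ccontr)
      assume "T \<noteq> 0"
      \<comment> \<open>With U = 0 the quadratic is affine in \<open>r\<close>, and this value of
        \<open>r\<close> would make it equal to -1.\<close>
      then show False using nn[of "- (V + 1) / (2 * T)"] True by (simp add: field_simps)
    qed
    then show ?thesis using True by simp
  next
    case False
    then have "0 < U" using U0 by simp
    then show ?thesis using nn[of "- T / U"] by (simp add: power2_eq_square field_simps)
  qed
  then show ?thesis by (simp add: U_def T_def V_def)
qed

lemma integral_mult_tendsto_zero:
  assumes "square_integrable M f" "\<And>j. square_integrable M (w j)" "(\<lambda>j. LINT x|M. (w j x)\<^sup>2) \<longlonglongrightarrow> 0"
  shows "(\<lambda>j. LINT x|M. f x * w j x) \<longlonglongrightarrow> 0"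
proof (rule Lim_null_comparison)
  have "norm (LINT x|M. f x * w j x) \<le> sqrt ((LINT x|M. (f x)\<^sup>2) * (LINT x|M. (w j x)\<^sup>2))" for j
    using integral_cauchy_schwarz[OF assms(1,2)] by (simp add: real_le_rsqrt)
  then show "\<forall>\<^sub>F j in sequentially. norm (LINT x|M. f x * w j x) \<le> sqrt ((LINT x|M. (f x)\<^sup>2) * (LINT x|M. (w j x)\<^sup>2))"
    by (intro always_eventually allI)
  have "(\<lambda>j. sqrt ((LINT x|M. (f x)\<^sup>2) * (LINT x|M. (w j x)\<^sup>2))) \<longlonglongrightarrow> sqrt ((LINT x|M. (f x)\<^sup>2) * 0)"
    by (rule tendsto_real_sqrt, rule tendsto_mult_left, rule assms(3))
  then show "(\<lambda>j. sqrt ((LINT x|M. (f x)\<^sup>2) * (LINT x|M. (w j x)\<^sup>2))) \<longlonglongrightarrow> 0"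
    by (simp only: mult_zero_right real_sqrt_zero)
qed

lemma integral_mult_tendsto:
  assumes f: "square_integrable M f" and p: "\<And>j. square_integrable M (\<phi> j)" and u: "square_integrable M u"
    and lim: "(\<lambda>j. LINT x|M. (\<phi> j x - u x)\<^sup>2) \<longlonglongrightarrow> 0"
  shows "(\<lambda>j. LINT x|M. f x * \<phi> j x) \<longlonglongrightarrow> (LINT x|M. f x * u x)"
proof -
  have w: "square_integrable M (\<lambda>x. \<phi> j x - u x)" for j
    using square_integrable_comb[OF p u, where a=1 and b="-1"] by simp
  have "(LINT x|M. f x * \<phi> j x) = (LINT x|M. f x * (\<phi> j x - u x)) + (LINT x|M. f x * u x)" for j
    using square_integrable_mult_integrable[OF f w, of j] square_integrable_mult_integrable[OF f u]
    by (simp add: right_diff_distrib flip: Bochner_Integration.integral_add)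
  moreover have "(\<lambda>j. (LINT x|M. f x * (\<phi> j x - u x)) + (LINT x|M. f x * u x)) \<longlonglongrightarrow> 0 + (LINT x|M. f x * u x)"
    by (rule tendsto_add[OF integral_mult_tendsto_zero[OF f w lim] tendsto_const])
  ultimately show ?thesis by (simp only: add_0_left)
qed

lemma bessel_inequality:
  assumes I: "finite I" and e: "\<And>i. i \<in> I \<Longrightarrow> square_integrable M (e i)" and f: "square_integrable M f"
    and on: "\<And>i j. i \<in> I \<Longrightarrow> j \<in> I \<Longrightarrow> (LINT x|M. e i x * e j x) = (if i = j then 1 else 0)"
  shows "(\<Sum>i\<in>I. (LINT x|M. e i x * f x)\<^sup>2) \<le> (LINT x|M. (f x)\<^sup>2)"
proof -
  define c where "c i = (LINT x|M. e i x * f x)" for i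
  define s where "s x = (\<Sum>i\<in>I. c i * e i x)" for x
  have s: "square_integrable M s" unfolding s_def[abs_def] by (rule square_integrable_sum[OF I e])
  have sf: "(LINT x|M. s x * f x) = (\<Sum>i\<in>I. (c i)\<^sup>2)"
    unfolding s_def by (subst integral_sum_mult[OF I e f]) (auto simp: c_def power2_eq_square)
  have "(LINT x|M. s x * s x) = (\<Sum>i\<in>I. \<Sum>j\<in>I. c i * c j * (if i = j then 1 else 0))"
    unfolding s_def by (subst integral_sum_mult_sum[OF I e I e]) (auto simp: on intro!: sum.cong)
  also have "\<dots> = (\<Sum>i\<in>I. (c i)\<^sup>2)" using I by (simp add: power2_eq_square if_distrib cong: if_cong)
  finally have ss: "(LINT x|M. s x * s x) = (\<Sum>i\<in>I. (c i)\<^sup>2)" .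
  have "0 \<le> (LINT x|M. (f x - s x)\<^sup>2)" by simp
  also have "\<dots> = (LINT x|M. (f x)\<^sup>2 - 2 * (s x * f x) + s x * s x)"
    by (intro Bochner_Integration.integral_cong) (auto simp: power2_eq_square algebra_simps)
  also have "\<dots> = (LINT x|M. (f x)\<^sup>2) - (\<Sum>i\<in>I. (c i)\<^sup>2)"
    using f square_integrable_mult_integrable[OF s f] square_integrable_mult_integrable[OF s s]
    by (simp add: square_integrable_def sf ss)
  finally show ?thesis by (simp add: c_def)
qed

text \<open>The result is a matrix of coefficients rather than a list of functions, so that the same
  combinations can be applied to every derivative of the eigenfunctions.\<close>

lemma gram_schmidt:
  fixes b :: "nat \<Rightarrow> 'a \<Rightarrow> real"
  assumes "\<And>j. j < m \<Longrightarrow> square_integrable M (b j)"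
    and "\<And>c. AE x in M. (\<Sum>j<m. c j * b j x) = 0 \<Longrightarrow> \<forall>j<m. c j = 0"
  shows "\<exists>C. \<forall>i<m. \<forall>i'<m. (LINT x|M. (\<Sum>j<m. C i j * b j x) * (\<Sum>j<m. C i' j * b j x)) = (if i = i' then 1 else 0 :: real)"
  using assms
proof (induction m)
  case 0
  then show ?case by simp
next
  case (Suc m)
  have b: "\<And>j. j < m \<Longrightarrow> square_integrable M (b j)" and bm: "square_integrable M (b m)"
    using Suc.prems(1) by auto
  have "\<forall>j<m. c j = 0" if c: "AE x in M. (\<Sum>j<m. c j * b j x) = 0" for c
  proof -
    have "(\<Sum>j<Suc m. (c(m := 0)) j * b j x) = (\<Sum>j<m. c j * b j x)" for x by simp
    then have "\<forall>j<Suc m. (c(m := 0)) j = 0" using c by (intro Suc.prems(2)) simp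
    then show ?thesis by (metis fun_upd_other less_Suc_eq less_irrefl)
  qed
  from Suc.IH[OF b this] obtain C where C: "\<And>i i'. i < m \<Longrightarrow> i' < m \<Longrightarrow>
     (LINT x|M. (\<Sum>j<m. C i j * b j x) * (\<Sum>j<m. C i' j * b j x)) = (if i = i' then 1 else 0 :: real)"
    by blast
  define e where "e i x = (\<Sum>j<m. C i j * b j x)" for i x
  have e: "square_integrable M (e i)" for i
    unfolding e_def[abs_def] by (rule square_integrable_sum) (use b in auto)
  have on: "(LINT x|M. e i x * e i' x) = (if i = i' then 1 else 0)" if "i < m" "i' < m" for i i'
    unfolding e_def by (rule C[OF that])
  define a where "a i = (LINT x|M. e i x * b m x)" for i
  define s where "s x = (\<Sum>i<m. a i * e i x)" for x
  have s: "square_integrable M s" unfolding s_def[abs_def] by (rule square_integrable_sum) (use e in auto)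
  define r where "r x = b m x - s x" for x
  have r: "square_integrable M r" using square_integrable_comb[OF bm s, where a=1 and b="-1"] by (simp add: r_def[abs_def])
  \<comment> \<open>The coefficients of the remainder \<open>r\<close> in terms of \<open>b\<close>.
    The last one is 1, so \<open>r\<close> cannot vanish almost everywhere and can be
    normalized.\<close>
  define d where "d j = (if j < m then - (\<Sum>i<m. a i * C i j) else 1)" for j
  have rd: "r x = (\<Sum>j<Suc m. d j * b j x)" for x
  proof -
    have "s x = (\<Sum>i<m. \<Sum>j<m. a i * C i j * b j x)"
      unfolding s_def e_def by (simp add: sum_distrib_left mult.assoc)
    also have "\<dots> = (\<Sum>j<m. \<Sum>i<m. a i * C i j * b j x)" by (rule sum.swap)
    finally show ?thesis by (simp add: r_def d_def sum_negf sum_distrib_right)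
  qed
  define N where "N = (LINT x|M. (r x)\<^sup>2)"
  have "N \<noteq> 0"
  proof
    assume "N = 0"
    then have "AE x in M. (r x)\<^sup>2 = 0"
      using r unfolding N_def square_integrable_def by (subst (asm) integral_nonneg_eq_0_iff_AE) auto
    then have "AE x in M. (\<Sum>j<Suc m. d j * b j x) = 0" unfolding rd by simp
    from Suc.prems(2)[OF this] show False by (auto simp: d_def)
  qed
  moreover have "0 \<le> N" by (simp add: N_def)
  ultimately have N: "0 < N" by simp
  have re: "(LINT x|M. r x * e i x) = 0" if i: "i < m" for i
  proof -
    have "(LINT x|M. s x * e i x) = (\<Sum>i'<m. a i' * (LINT x|M. e i' x * e i x))"
      unfolding s_def by (rule integral_sum_mult) (use e in auto)
    also have "\<dots> = (\<Sum>i'<m. a i' * (if i' = i then 1 else 0))" by (intro sum.cong) (auto simp: on i)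
    also have "\<dots> = a i" using i by (simp add: if_distrib cong: if_cong)
    finally have "(LINT x|M. s x * e i x) = a i" .
    then show ?thesis using square_integrable_mult_integrable[OF bm e[of i]] square_integrable_mult_integrable[OF s e[of i]]
      unfolding r_def left_diff_distrib by (simp add: a_def mult.commute)
  qed
  define C' where "C' i j = (if i < m then (if j < m then C i j else 0) else d j / sqrt N)" for i j
  have C'1: "(\<Sum>j<Suc m. C' i j * b j x) = e i x" if "i < m" for i x
    using that by (simp add: C'_def e_def)
  have C'2: "(\<Sum>j<Suc m. C' m j * b j x) = r x / sqrt N" for x
    unfolding rd by (simp add: C'_def add_divide_distrib sum_divide_distrib)
  have "(LINT x|M. (\<Sum>j<Suc m. C' i j * b j x) * (\<Sum>j<Suc m. C' i' j * b j x)) = (if i = i' then 1 else 0)"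
    if ij: "i < Suc m" "i' < Suc m" for i i'
  proof -
    consider "i < m" "i' < m" | "i < m" "i' = m" | "i = m" "i' < m" | "i = m" "i' = m" using ij by (auto simp: less_Suc_eq)
    then show ?thesis
    proof cases
      case 1
      then show ?thesis unfolding C'1[OF 1(1)] C'1[OF 1(2)] by (rule on)
    next
      case 2
      then show ?thesis unfolding C'1[OF 2(1)] 2(2) C'2 using re[OF 2(1)] by (simp add: mult.commute)
    next
      case 3
      then show ?thesis unfolding C'1[OF 3(2)] 3(1) C'2 using re[OF 3(2)] by simp
    next
      case 4
      have "(LINT x|M. r x / sqrt N * (r x / sqrt N)) = (LINT x|M. (r x)\<^sup>2 / N)"
        using N by (intro Bochner_Integration.integral_cong) (auto simp: power2_eq_square)
      then show ?thesis unfolding 4 C'2 using N by (simp add: N_def)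
    qed
  qed
  then show ?case by blast
qed


section \<open>Fourier transforms of test functions\<close>

lemma partial_derivs_Nil [simp]: "partial_derivs [] f = f"
  and partial_derivs_Cons: "partial_derivs (i # w) f = partial_deriv i (partial_derivs w f)"
  and partial_derivs_append: "partial_derivs (w @ w') f = partial_derivs w (partial_derivs w' f)"
  by (simp_all add: partial_derivs_def)

lemma has_derivative_partial_deriv:
  assumes "f differentiable (at x)"
  shows "((\<lambda>t. f (x + t *\<^sub>R axis i 1)) has_real_derivative partial_deriv i f x) (at 0)"
proof -
  have "(f has_derivative frechet_derivative f (at x)) (at (x + 0 *\<^sub>R axis i 1))"
    using assms by (simp add: frechet_derivative_works)
  moreover have "((\<lambda>t. x + t *\<^sub>R axis i 1) has_derivative (\<lambda>t. t *\<^sub>R axis i 1)) (at 0)"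
    by (auto intro!: derivative_eq_intros)
  ultimately have "((\<lambda>t. f (x + t *\<^sub>R axis i 1)) has_derivative (\<lambda>t. frechet_derivative f (at x) (t *\<^sub>R axis i 1))) (at 0)"
    by (rule has_derivative_compose[rotated])
  moreover have "frechet_derivative f (at x) (t *\<^sub>R axis i 1) = partial_deriv i f x * t" for t
    using linear_frechet_derivative[OF assms] by (simp add: partial_deriv_def linear_cmul)
  ultimately show ?thesis by (simp add: has_field_derivative_def)
qed

lemma partial_deriv_eqI:
  assumes "(f has_derivative f') (at x)"
  shows "partial_deriv i f x = f' (axis i 1)"
  unfolding partial_deriv_def using frechet_derivative_at[OF assms] by simp

text \<open>Off the closed support the function vanishes in a whole neighbourhood; this keeps the
  derivatives of test functions supported in \<Omega>.\<close>

lemma partial_deriv_eq_0: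
  assumes "x \<notin> closure {x. f x \<noteq> 0}"
  shows "partial_deriv i f x = 0"
proof -
  have "(f has_derivative (\<lambda>_. 0)) (at x)"
  proof (rule has_derivative_transform_within_open)
    show "((\<lambda>_. 0) has_derivative (\<lambda>_. 0)) (at x)" by simp
    show "open (- closure {x. f x \<noteq> 0})" by auto
    show "x \<in> - closure {x. f x \<noteq> 0}" using assms by simp
    show "0 = f y" if "y \<in> - closure {x. f x \<noteq> 0}" for y
      using that closure_subset[of "{x. f x \<noteq> 0}"] by auto
  qed
  then show ?thesis by (rule partial_deriv_eqI)
qed

lemma test_function_partial_deriv:
  assumes "test_function \<Omega> \<phi>"
  shows "test_function \<Omega> (partial_deriv i \<phi>)"
proof -
  have sub: "closure {x. partial_deriv i \<phi> x \<noteq> 0} \<subseteq> closure {x. \<phi> x \<noteq> 0}"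
    by (rule closure_minimal) (use partial_deriv_eq_0 in \<open>blast, simp\<close>)
  have "smooth (partial_deriv i \<phi>)"
    unfolding smooth_def
  proof
    fix w
    have "partial_derivs w (partial_deriv i \<phi>) = partial_derivs (w @ [i]) \<phi>"
      by (simp add: partial_derivs_append partial_derivs_Cons)
    then show "partial_derivs w (partial_deriv i \<phi>) differentiable_on UNIV"
      using assms by (simp add: test_function_def smooth_def)
  qed
  moreover have "compact (closure {x. partial_deriv i \<phi> x \<noteq> 0})"
    using compact_Int_closed[of "closure {x. \<phi> x \<noteq> 0}" "closure {x. partial_deriv i \<phi> x \<noteq> 0}"] sub assms by (simp add: test_function_def Int_absorb1)
  ultimately show ?thesis using assms sub by (auto simp: test_function_def)
qed

lemma test_function_partial_derivs:
  assumes "test_function \<Omega> \<phi>"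
  shows "test_function \<Omega> (partial_derivs w \<phi>)"
  by (induction w) (auto simp: assms partial_derivs_Cons intro: test_function_partial_deriv)

lemma test_functionD:
  assumes "test_function \<Omega> \<phi>"
  shows "\<phi> differentiable (at x)" "continuous_on UNIV \<phi>" "bounded {x. \<phi> x \<noteq> 0}" "x \<notin> \<Omega> \<Longrightarrow> \<phi> x = 0"
    "translation_continuous \<phi>"
proof -
  have "partial_derivs [] \<phi> differentiable_on UNIV"
    using assms unfolding test_function_def smooth_def by blast
  then have d: "\<phi> differentiable_on UNIV" by simp
  then show "\<phi> differentiable (at x)" by (simp add: differentiable_on_def)
  show c: "continuous_on UNIV \<phi>" by (rule differentiable_imp_continuous_on[OF d])
  have "bounded (closure {x. \<phi> x \<noteq> 0})"
    using assms by (simp add: test_function_def compact_imp_bounded)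
  then show b: "bounded {x. \<phi> x \<noteq> 0}" by (rule bounded_subset[OF _ closure_subset])
  show "\<phi> x = 0" if "x \<notin> \<Omega>"
    using that assms closure_subset[of "{x. \<phi> x \<noteq> 0}"] by (auto simp: test_function_def)
  show "translation_continuous \<phi>" by (rule translation_continuous_continuous[OF c b])
qed

lemma test_function_bounded:
  assumes "test_function \<Omega> \<phi>"
  shows "\<exists>M. \<forall>x. \<bar>\<phi> x\<bar> \<le> M"
proof -
  let ?S = "closure {x. \<phi> x \<noteq> 0}"
  have "compact ?S" using assms by (simp add: test_function_def)
  then have "bounded (\<phi> ` ?S)"
    by (intro compact_imp_bounded compact_continuous_image continuous_on_subset[OF test_functionD(2)[OF assms]]) auto
  from this[unfolded bounded_iff] obtain M where M: "\<forall>y\<in>\<phi> ` ?S. norm y \<le> M" by (rule exE)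
  have "\<bar>\<phi> x\<bar> \<le> max M 0" for x
  proof (cases "\<phi> x = 0")
    case False
    then have "x \<in> ?S" using closure_subset[of "{x. \<phi> x \<noteq> 0}"] by auto
    then have "norm (\<phi> x) \<le> M" using M by blast
    then show ?thesis by simp
  qed simp
  then show ?thesis by blast
qed

lemma partial_deriv_lincomb:
  assumes "f differentiable (at x)" "g differentiable (at x)"
  shows "partial_deriv i (\<lambda>x. a * f x + b * g x) x = a * partial_deriv i f x + b * partial_deriv i g x"
proof -
  have "((\<lambda>x. a * f x + b * g x) has_derivative (\<lambda>h. a * frechet_derivative f (at x) h + b * frechet_derivative g (at x) h)) (at x)"
    by (intro has_derivative_add has_derivative_mult_right) (use assms in \<open>auto simp: frechet_derivative_works\<close>)
  from partial_deriv_eqI[OF this] show ?thesis by (simp add: partial_deriv_def)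
qed

lemma partial_derivs_lincomb:
  assumes "smooth f" "smooth g"
  shows "partial_derivs w (\<lambda>x. a * f x + b * g x) = (\<lambda>x. a * partial_derivs w f x + b * partial_derivs w g x)"
proof (induction w)
  case (Cons i w)
  have "partial_derivs w f differentiable (at x)" "partial_derivs w g differentiable (at x)" for x
    using assms by (auto simp: smooth_def differentiable_on_def)
  then show ?case unfolding partial_derivs_Cons Cons.IH by (intro ext partial_deriv_lincomb)
qed simp

lemma test_function_lincomb:
  assumes f: "test_function \<Omega> f" and g: "test_function \<Omega> g"
  shows "test_function \<Omega> (\<lambda>x. a * f x + b * g x)"
proof -
  have s: "smooth f" "smooth g" using assms by (auto simp: test_function_def)
  have "smooth (\<lambda>x. a * f x + b * g x)"
    unfolding smooth_def
  proof
    fix w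
    have "partial_derivs w f differentiable_on UNIV" "partial_derivs w g differentiable_on UNIV"
      using s unfolding smooth_def by blast+
    then show "partial_derivs w (\<lambda>x. a * f x + b * g x) differentiable_on UNIV"
      unfolding partial_derivs_lincomb[OF s] by (intro derivative_intros) auto
  qed
  moreover have sub: "closure {x. a * f x + b * g x \<noteq> 0} \<subseteq> closure {x. f x \<noteq> 0} \<union> closure {x. g x \<noteq> 0}"
    unfolding closure_Un[symmetric] by (rule closure_mono) auto
  moreover have "compact (closure {x. a * f x + b * g x \<noteq> 0})"
  proof -
    have "compact (closure {x. f x \<noteq> 0} \<union> closure {x. g x \<noteq> 0})"
      using f g by (simp add: test_function_def compact_Un)
    from compact_Int_closed[OF this, of "closure {x. a * f x + b * g x \<noteq> 0}"] sub
    show ?thesis by (simp add: Int_absorb1)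
  qed
  ultimately show ?thesis using f g unfolding test_function_def by blast
qed

lemma test_function_zero: "test_function \<Omega> (\<lambda>_. 0)"
proof -
  have "partial_deriv i (\<lambda>_. 0) = (\<lambda>_. 0)" for i :: 'a
    by (rule ext) (rule partial_deriv_eqI, simp)
  then have "partial_derivs w (\<lambda>_. 0) = (\<lambda>_. 0)" for w :: "'a list"
    by (induction w) (simp_all add: partial_derivs_Cons)
  then show ?thesis by (simp add: test_function_def smooth_def)
qed

lemma test_function_sum:
  assumes "finite I" "\<And>i. i \<in> I \<Longrightarrow> test_function \<Omega> (f i)"
  shows "test_function \<Omega> (\<lambda>x. \<Sum>i\<in>I. c i * f i x)"
  using assms
proof (induction I rule: finite_induct)
  case (insert i I)
  have "test_function \<Omega> (\<lambda>x. c i * f i x + 1 * (\<Sum>i\<in>I. c i * f i x))"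
    by (intro test_function_lincomb insert.IH insert.prems) simp_all
  then show ?case using insert.hyps by simp
qed (simp add: test_function_zero)

lemma fhat_sum:
  assumes "finite I" "\<And>i. i \<in> I \<Longrightarrow> integrable lborel (u i)"
  shows "fhat (\<lambda>x. \<Sum>i\<in>I. c i * u i x) \<xi> = (\<Sum>i\<in>I. c i * fhat (u i) \<xi>)"
  using assms
proof (induction I rule: finite_induct)
  case (insert i I)
  have int: "integrable lborel (\<lambda>x. \<Sum>i\<in>I. c i * u i x)"
    by (intro Bochner_Integration.integrable_sum integrable_mult_right insert.prems) simp
  have "fhat (\<lambda>x. c i * u i x + 1 * (\<Sum>i\<in>I. c i * u i x)) \<xi> = c i * fhat (u i) \<xi> + 1 * fhat (\<lambda>x. \<Sum>i\<in>I. c i * u i x) \<xi>"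
    using fhat_lincomb[OF insert.prems[of i] int, where a="c i" and b=1] by simp
  then show ?case using insert by simp
qed (simp add: fhat_def)

text \<open>Written as a linear combination so that \<open>test_function_sum\<close> and
  \<open>fhat_sum\<close> apply.\<close>

lemma neg_laplacian_eq_sum: "neg_laplacian f = (\<lambda>x. \<Sum>i\<in>UNIV. (-1) * partial_derivs [i, i] f x)"
  by (rule ext) (simp add: neg_laplacian_def partial_derivs_Cons sum_negf)

lemma test_function_neg_laplacian:
  assumes "test_function \<Omega> \<phi>"
  shows "test_function \<Omega> ((neg_laplacian ^^ l) \<phi>)"
proof (induction l)
  case (Suc l)
  have "test_function \<Omega> (\<lambda>x. \<Sum>i\<in>UNIV. (-1) * partial_derivs [i, i] ((neg_laplacian ^^ l) \<phi>) x)"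
    by (rule test_function_sum) (auto intro: test_function_partial_derivs Suc.IH)
  then show ?case by (simp only: funpow.simps comp_def neg_laplacian_eq_sum[of "(neg_laplacian ^^ l) \<phi>"])
qed (simp add: assms)

text \<open>Difference quotients take the place of integration by parts. A translation along the
  axis multiplies the transform by a phase; the step then tends to 0, under the integral on one side
  and in the phase on the other.\<close>

lemma fhat_partial_deriv:
  fixes \<phi> :: "real^'n::finite \<Rightarrow> real"
  assumes t: "test_function \<Omega> \<phi>"
  shows "fhat (partial_deriv i \<phi>) \<xi> = - \<i> * complex_of_real (\<xi> $ i) * fhat \<phi> \<xi>"
proof -
  let ?e = "axis i (1::real) :: real^'n"
  define s where "s = (\<lambda>j. inverse (real (Suc j)))"
  have s0: "0 < s j" "s j \<le> 1" for j by (simp_all add: s_def inverse_le_1_iff)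
  have slim: "s \<longlonglongrightarrow> 0" unfolding s_def by (rule LIMSEQ_inverse_real_of_nat)
  note T = test_functionD[OF t] and TD = test_functionD[OF test_function_partial_deriv[OF t]]
  have [measurable]: "\<phi> \<in> borel_measurable borel" "partial_deriv i \<phi> \<in> borel_measurable borel"
    by (rule translation_continuousD(2)[OF T(5)] translation_continuousD(2)[OF TD(5)])+
  have \<phi>: "integrable lborel \<phi>" by (rule translation_continuousD(4)[OF T(5)])
  have deriv: "((\<lambda>t. \<phi> (x + t *\<^sub>R ?e)) has_real_derivative partial_deriv i \<phi> (x + t *\<^sub>R ?e)) (at t)" for x t
  proof -
    have "((\<lambda>h. \<phi> (x + t *\<^sub>R ?e + h *\<^sub>R ?e)) has_real_derivative partial_deriv i \<phi> (x + t *\<^sub>R ?e)) (at 0)"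
      by (rule has_derivative_partial_deriv[OF T(1)])
    then have "((\<lambda>h. \<phi> (x + (h + t) *\<^sub>R ?e)) has_real_derivative partial_deriv i \<phi> (x + t *\<^sub>R ?e)) (at 0)"
      by (simp only: scaleR_add_left add_ac)
    then show ?thesis
      using DERIV_shift[of "\<lambda>h. \<phi> (x + h *\<^sub>R ?e)" "partial_deriv i \<phi> (x + t *\<^sub>R ?e)" 0 t] by (simp only: add_0_left)
  qed
  obtain M where M: "\<And>x. \<bar>partial_deriv i \<phi> x\<bar> \<le> M"
    using test_function_bounded[OF test_function_partial_deriv[OF t]] by blast
  obtain B where B: "\<And>x. \<phi> x \<noteq> 0 \<Longrightarrow> norm x \<le> B"
    using T(3) by (auto simp: bounded_iff)
  define D where "D j x = (\<phi> (x + s j *\<^sub>R ?e) - \<phi> x) / s j" for j x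
  have Dlim: "(\<lambda>j. D j x) \<longlonglongrightarrow> partial_deriv i \<phi> x" for x
  proof -
    have "((\<lambda>h. (\<phi> (x + h *\<^sub>R ?e) - \<phi> x) / h) \<longlongrightarrow> partial_deriv i \<phi> x) (at 0)"
      using has_derivative_partial_deriv[OF T(1), of x i] by (simp add: DERIV_def)
    moreover have "filterlim s (at 0) sequentially"
      unfolding filterlim_at using slim s0(1) by (auto intro!: always_eventually simp: less_imp_neq[symmetric])
    ultimately show ?thesis unfolding D_def by (rule filterlim_compose)
  qed
  \<comment> \<open>The mean value theorem bounds the quotients by a bound of the derivative, and as
    all steps are at most 1 they vanish outside the ball of radius \<open>B + 1\<close>.\<close>
  have Dbound: "norm (complex_of_real (D j x) * cis (\<xi> \<bullet> x)) \<le> indicator (cball 0 (B + 1)) x * M" for j x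
  proof -
    obtain z where "\<phi> (x + s j *\<^sub>R ?e) - \<phi> (x + 0 *\<^sub>R ?e) = (s j - 0) * partial_deriv i \<phi> (x + z *\<^sub>R ?e)"
      using MVT2[OF s0(1) deriv] by blast
    then have "D j x = partial_deriv i \<phi> (x + z *\<^sub>R ?e)" using s0(1)[of j] by (simp add: D_def)
    then have 1: "\<bar>D j x\<bar> \<le> M" using M by simp
    have "D j x = 0" if "norm x > B + 1"
    proof -
      have "norm x \<le> norm (x + s j *\<^sub>R ?e) + norm (s j *\<^sub>R ?e)"
        using norm_triangle_ineq4[of "x + s j *\<^sub>R ?e" "s j *\<^sub>R ?e"] by simp
      moreover have "norm (s j *\<^sub>R ?e) \<le> 1" using s0[of j] by simp
      ultimately have "norm (x + s j *\<^sub>R ?e) > B" "norm x > B" using that by linarith+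
      then have "\<phi> (x + s j *\<^sub>R ?e) = 0" "\<phi> x = 0" using B by force+
      then show ?thesis by (simp add: D_def)
    qed
    with 1 show ?thesis by (cases "norm x \<le> B + 1") (auto simp: norm_mult)
  qed
  have DCT: "(\<lambda>j. fhat (D j) \<xi>) \<longlonglongrightarrow> fhat (partial_deriv i \<phi>) \<xi>"
    unfolding fhat_def
  proof (rule integral_dominated_convergence)
    show "integrable lborel (\<lambda>x. indicator (cball (0::real^'n) (B + 1)) x * M)"
      using emeasure_bounded_finite[of "cball (0::real^'n) (B + 1)"]
      by (intro integrable_mult_left) (simp add: integrable_indicator_iff borel_closed)
    show "AE x in lborel. (\<lambda>j. complex_of_real (D j x) * cis (\<xi> \<bullet> x)) \<longlonglongrightarrow> complex_of_real (partial_deriv i \<phi> x) * cis (\<xi> \<bullet> x)"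
      by (intro AE_I2 tendsto_mult_right tendsto_of_real Dlim)
    show "AE x in lborel. norm (complex_of_real (D j x) * cis (\<xi> \<bullet> x)) \<le> indicator (cball 0 (B + 1)) x * M" for j
      by (intro AE_I2 Dbound)
  qed (unfold D_def, measurable)
  have FD: "fhat (D j) \<xi> = (cis (- (s j * \<xi> $ i)) - 1) / s j * fhat \<phi> \<xi>" for j
  proof -
    have tr: "integrable lborel (\<lambda>x. \<phi> (x + s j *\<^sub>R ?e))"
      using integrable_lborel_translate[of \<phi> "s j *\<^sub>R ?e"] \<phi> by (simp add: add.commute)
    have "fhat (\<lambda>x. \<phi> (x + s j *\<^sub>R ?e)) \<xi> = (LBINT x. cis (- (s j * \<xi> $ i)) * (complex_of_real (\<phi> (s j *\<^sub>R ?e + x)) * cis (\<xi> \<bullet> (s j *\<^sub>R ?e + x))))"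
      unfolding fhat_def
    proof (rule Bochner_Integration.integral_cong[OF refl])
      fix x
      have "cis (\<xi> \<bullet> x) = cis (- (s j * \<xi> $ i)) * cis (\<xi> \<bullet> (s j *\<^sub>R ?e + x))"
        by (simp add: cis_mult inner_add_right inner_axis)
      then show "complex_of_real (\<phi> (x + s j *\<^sub>R ?e)) * cis (\<xi> \<bullet> x) =
        cis (- (s j * \<xi> $ i)) * (complex_of_real (\<phi> (s j *\<^sub>R ?e + x)) * cis (\<xi> \<bullet> (s j *\<^sub>R ?e + x)))"
        by (simp only: add.commute[of x] mult_ac)
    qed
    also have "\<dots> = cis (- (s j * \<xi> $ i)) * fhat \<phi> \<xi>"
      unfolding integral_mult_right_zero fhat_def
      by (subst integral_lborel_translate[of "\<lambda>x. complex_of_real (\<phi> x) * cis (\<xi> \<bullet> x)"]) auto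
    finally have 1: "fhat (\<lambda>x. \<phi> (x + s j *\<^sub>R ?e)) \<xi> = cis (- (s j * \<xi> $ i)) * fhat \<phi> \<xi>" .
    have "fhat (D j) \<xi> = fhat (\<lambda>x. (1 / s j) * \<phi> (x + s j *\<^sub>R ?e) + (- 1 / s j) * \<phi> x) \<xi>"
      by (simp add: D_def[abs_def] diff_divide_distrib)
    also have "\<dots> = (1 / s j) * fhat (\<lambda>x. \<phi> (x + s j *\<^sub>R ?e)) \<xi> + (- 1 / s j) * fhat \<phi> \<xi>"
      using fhat_lincomb[OF tr \<phi>, where a="1 / s j" and b="- 1 / s j"] by simp
    finally show ?thesis unfolding 1 using s0(1)[of j] by (simp add: field_simps)
  qed
  \<comment> \<open>If the coordinate of \<xi> is 0, the sequence is constantly 0. Otherwise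
    \<open>z j\<close> tends to 0 without reaching it and the limit is that of (exp z - 1) /
    z.\<close>
  have lim: "(\<lambda>j. (cis (- (s j * \<xi> $ i)) - 1) / s j) \<longlonglongrightarrow> - \<i> * complex_of_real (\<xi> $ i)"
  proof (cases "\<xi> $ i = 0")
    case False
    define z where "z j = - \<i> * complex_of_real (\<xi> $ i) * complex_of_real (s j)" for j
    have "z \<longlonglongrightarrow> - \<i> * complex_of_real (\<xi> $ i) * complex_of_real 0"
      unfolding z_def by (intro tendsto_mult_left tendsto_of_real slim)
    then have z: "filterlim z (at 0) sequentially"
      unfolding filterlim_at using False s0(1) by (auto intro!: always_eventually simp: z_def less_imp_neq[symmetric])
    have "(\<lambda>j. (exp (z j) - 1) / z j) \<longlonglongrightarrow> 1"
      by (rule filterlim_compose[OF lim_exp_minus_1 z])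
    then have "(\<lambda>j. - \<i> * complex_of_real (\<xi> $ i) * ((exp (z j) - 1) / z j)) \<longlonglongrightarrow> - \<i> * complex_of_real (\<xi> $ i) * 1"
      by (rule tendsto_mult_left)
    moreover have "- \<i> * complex_of_real (\<xi> $ i) * ((exp (z j) - 1) / z j) = (cis (- (s j * \<xi> $ i)) - 1) / s j" for j
    proof -
      have "exp (z j) = cis (- (s j * \<xi> $ i))" by (simp add: cis_conv_exp z_def mult_ac)
      then show ?thesis using False s0(1)[of j] by (simp add: z_def)
    qed
    ultimately show ?thesis by (simp only: mult_1_right)
  qed simp
  have "(\<lambda>j. fhat (D j) \<xi>) \<longlonglongrightarrow> - \<i> * complex_of_real (\<xi> $ i) * fhat \<phi> \<xi>"
    unfolding FD by (intro tendsto_mult_right lim)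
  then show ?thesis by (rule LIMSEQ_unique[OF DCT])
qed

section \<open>Symbols of derivatives along words\<close>

definition fourier_symbol :: "'n::finite list \<Rightarrow> real^'n \<Rightarrow> complex" where
  "fourier_symbol w \<xi> = (\<Prod>i\<leftarrow>w. - \<i> * complex_of_real (\<xi> $ i))"

lemma fourier_symbol_Nil [simp]: "fourier_symbol [] \<xi> = 1"
  and fourier_symbol_Cons: "fourier_symbol (i # w) \<xi> = - \<i> * complex_of_real (\<xi> $ i) * fourier_symbol w \<xi>"
  by (simp_all add: fourier_symbol_def)

lemma fhat_partial_derivs:
  assumes "test_function \<Omega> \<phi>"
  shows "fhat (partial_derivs w \<phi>) \<xi> = fourier_symbol w \<xi> * fhat \<phi> \<xi>"
proof (induction w)
  case (Cons i w)
  show ?case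
    unfolding partial_derivs_Cons fhat_partial_deriv[OF test_function_partial_derivs[OF assms]] Cons.IH fourier_symbol_Cons
    by simp
qed simp

lemma test_function_integrable:
  "test_function \<Omega> \<phi> \<Longrightarrow> integrable lborel \<phi>"
  by (rule translation_continuousD(4)[OF test_functionD(5)])

lemma fhat_neg_laplacian:
  assumes "test_function \<Omega> \<phi>"
  shows "fhat ((neg_laplacian ^^ l) \<phi>) \<xi> = complex_of_real (norm \<xi> ^ (2 * l)) * fhat \<phi> \<xi>"
proof (induction l)
  case (Suc l)
  let ?\<psi> = "(neg_laplacian ^^ l) \<phi>"
  have t: "test_function \<Omega> ?\<psi>" by (rule test_function_neg_laplacian[OF assms])
  have "fhat (neg_laplacian ?\<psi>) \<xi> = (\<Sum>i\<in>UNIV. complex_of_real (-1) * fhat (partial_derivs [i, i] ?\<psi>) \<xi>)"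
    unfolding neg_laplacian_eq_sum[of ?\<psi>]
    by (rule fhat_sum) (auto intro: test_function_integrable test_function_partial_derivs[OF t])
  also have "\<dots> = (\<Sum>i\<in>UNIV. complex_of_real ((\<xi> $ i)\<^sup>2) * fhat ?\<psi> \<xi>)"
  proof (rule sum.cong[OF refl])
    fix i
    have "fourier_symbol [i, i] \<xi> = - complex_of_real ((\<xi> $ i)\<^sup>2)"
      by (simp add: fourier_symbol_Cons complex_eq_iff power2_eq_square)
    then show "complex_of_real (-1) * fhat (partial_derivs [i, i] ?\<psi>) \<xi> = complex_of_real ((\<xi> $ i)\<^sup>2) * fhat ?\<psi> \<xi>"
      unfolding fhat_partial_derivs[OF t] by simp
  qed
  also have "\<dots> = complex_of_real (\<Sum>i\<in>UNIV. (\<xi> $ i)\<^sup>2) * fhat ?\<psi> \<xi>"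
    by (simp add: sum_distrib_right)
  also have "(\<Sum>i\<in>UNIV. (\<xi> $ i)\<^sup>2) = (norm \<xi>)\<^sup>2"
    by (simp add: norm_vec_def L2_set_def sum_nonneg)
  finally show ?case unfolding Suc.IH by (simp add: power_add power2_eq_square mult.assoc)
qed simp

lemma finite_words: "finite {w :: 'n::finite list. length w = l}"
  using finite_lists_length_eq[of "UNIV :: 'n set" l] by simp

text \<open>The power multiplied out, with one summand for each word. Words are ordered, so no
  multinomial coefficients occur.\<close>

lemma sum_words_prod_list:
  fixes g :: "'n::finite \<Rightarrow> 'a::comm_semiring_1"
  shows "(\<Sum>w | length w = l. \<Prod>i\<leftarrow>w. g i) = (\<Sum>i\<in>UNIV. g i) ^ l"
proof (induction l)
  case (Suc l)
  have eq: "{w :: 'n list. length w = Suc l} = (\<lambda>(i, w). i # w) ` (UNIV \<times> {w. length w = l})"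
    by (auto simp: length_Suc_conv image_iff)
  have inj: "inj_on (\<lambda>(i, w). i # w) (UNIV \<times> {w :: 'n list. length w = l})"
    by (auto simp: inj_on_def)
  have "(\<Sum>w | length w = Suc l. \<Prod>i\<leftarrow>w. g i) = (\<Sum>(i, w)\<in>UNIV \<times> {w. length w = l}. g i * (\<Prod>i\<leftarrow>w. g i))"
    unfolding eq sum.reindex[OF inj] by (simp add: case_prod_unfold)
  also have "\<dots> = (\<Sum>i\<in>UNIV. \<Sum>w | length w = l. g i * (\<Prod>i\<leftarrow>w. g i))"
    by (rule sum.cartesian_product[symmetric])
  also have "\<dots> = (\<Sum>i\<in>UNIV. g i) * (\<Sum>w | length w = l. \<Prod>i\<leftarrow>w. g i)"
    by (simp add: sum_distrib_left[symmetric] sum_distrib_right)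
  finally show ?case by (simp add: Suc.IH)
qed simp

text \<open>This is why energies are sums over all words of length \<open>l\<close>: the squared
  symbols add up to the symbol of the poly-Laplacian.\<close>

lemma sum_norm_fourier_symbol:
  "(\<Sum>w | length w = l. (cmod (fourier_symbol w \<xi>))\<^sup>2) = norm \<xi> ^ (2 * l)"
proof -
  have "(cmod (fourier_symbol w \<xi>))\<^sup>2 = (\<Prod>i\<leftarrow>w. (\<xi> $ i)\<^sup>2)" for w
    by (induction w) (simp_all add: fourier_symbol_Cons norm_mult power_mult_distrib)
  then have "(\<Sum>w | length w = l. (cmod (fourier_symbol w \<xi>))\<^sup>2) = (\<Sum>i\<in>UNIV. (\<xi> $ i)\<^sup>2) ^ l"
    by (simp add: sum_words_prod_list)
  also have "(\<Sum>i\<in>UNIV. (\<xi> $ i)\<^sup>2) = (norm \<xi>)\<^sup>2"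
    by (simp add: norm_vec_def L2_set_def sum_nonneg)
  finally show ?thesis by (simp add: power_mult)
qed

lemma sum_fourier_symbol_mult:
  "(\<Sum>w | length w = l. Re ((fourier_symbol w \<xi> * a) * cnj (fourier_symbol w \<xi> * b))) = Re (a * cnj (complex_of_real (norm \<xi> ^ (2 * l)) * b))"
proof -
  have "(fourier_symbol w \<xi> * a) * cnj (fourier_symbol w \<xi> * b) = complex_of_real ((cmod (fourier_symbol w \<xi>))\<^sup>2) * (a * cnj b)" for w
    unfolding complex_norm_square by (simp add: mult_ac)
  then have "Re ((fourier_symbol w \<xi> * a) * cnj (fourier_symbol w \<xi> * b)) = (cmod (fourier_symbol w \<xi>))\<^sup>2 * Re (a * cnj b)" for w
    by (simp only: Re_complex_of_real times_complex.sel Im_complex_of_real mult_zero_left diff_zero)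
  then have "(\<Sum>w | length w = l. Re ((fourier_symbol w \<xi> * a) * cnj (fourier_symbol w \<xi> * b))) = norm \<xi> ^ (2 * l) * Re (a * cnj b)"
    by (simp only: sum_distrib_right[symmetric] sum_norm_fourier_symbol)
  also have "\<dots> = Re (a * cnj (complex_of_real (norm \<xi> ^ (2 * l)) * b))"
    by (simp add: algebra_simps)
  finally show ?thesis .
qed

text \<open>Passing to Fourier transforms avoids integration by parts and the commutation of partial derivatives.\<close>

lemma integral_mult_neg_laplacian:
  fixes V :: "'n::finite list \<Rightarrow> real^'n \<Rightarrow> real"
  assumes V: "\<And>w. length w \<le> l \<Longrightarrow> translation_continuous (V w)"
    and hat: "\<And>w \<xi>. length w \<le> l \<Longrightarrow> fhat (V w) \<xi> = fourier_symbol w \<xi> * fhat (V []) \<xi>"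
    and t: "test_function \<Omega> \<phi>"
  shows "(LBINT x. V [] x * (neg_laplacian ^^ l) \<phi> x) = (\<Sum>w | length w = l. LBINT x. V w x * partial_derivs w \<phi> x)"
proof -
  let ?n = "DIM(real^'n)"
  have tl: "translation_continuous ((neg_laplacian ^^ l) \<phi>)"
    by (rule test_functionD(5)[OF test_function_neg_laplacian[OF t]])
  have tw: "translation_continuous (partial_derivs w \<phi>)" for w
    by (rule test_functionD(5)[OF test_function_partial_derivs[OF t]])
  have V0: "translation_continuous (V [])" by (rule V) simp
  have "(2 * pi) ^ ?n * (LBINT x. V [] x * (neg_laplacian ^^ l) \<phi> x) =
      (LBINT \<xi>. Re (fhat (V []) \<xi> * cnj (fhat ((neg_laplacian ^^ l) \<phi>) \<xi>)))"
    by (rule parseval(2)[OF V0 tl, symmetric])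
  also have "\<dots> = (LBINT \<xi>. (\<Sum>w | length w = l. Re (fhat (V w) \<xi> * cnj (fhat (partial_derivs w \<phi>) \<xi>))))"
  proof (rule Bochner_Integration.integral_cong[OF refl])
    fix \<xi> :: "real^'n"
    have "(\<Sum>w | length w = l. Re (fhat (V w) \<xi> * cnj (fhat (partial_derivs w \<phi>) \<xi>))) =
      (\<Sum>w | length w = l. Re ((fourier_symbol w \<xi> * fhat (V []) \<xi>) * cnj (fourier_symbol w \<xi> * fhat \<phi> \<xi>)))"
      by (intro sum.cong refl) (simp only: mem_Collect_eq hat[OF eq_refl] fhat_partial_derivs[OF t])
    then show "Re (fhat (V []) \<xi> * cnj (fhat ((neg_laplacian ^^ l) \<phi>) \<xi>)) =
      (\<Sum>w | length w = l. Re (fhat (V w) \<xi> * cnj (fhat (partial_derivs w \<phi>) \<xi>)))"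
      unfolding sum_fourier_symbol_mult fhat_neg_laplacian[OF t] by simp
  qed
  also have "\<dots> = (\<Sum>w | length w = l. LBINT \<xi>. Re (fhat (V w) \<xi> * cnj (fhat (partial_derivs w \<phi>) \<xi>)))"
    by (rule Bochner_Integration.integral_sum) (rule parseval(1)[OF V tw], simp)
  also have "\<dots> = (\<Sum>w | length w = l. (2 * pi) ^ ?n * (LBINT x. V w x * partial_derivs w \<phi> x))"
    by (intro sum.cong refl parseval(2) V tw) simp
  also have "\<dots> = (2 * pi) ^ ?n * (\<Sum>w | length w = l. LBINT x. V w x * partial_derivs w \<phi> x)"
    by (rule sum_distrib_left[symmetric])
  finally show ?thesis by simp
qed

section \<open>Plane waves cut off to a bounded set\<close>

text \<open>The real part of the plane wave, made square integrable by the cutoff; treating it and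
  the imaginary part separately keeps all function spaces real.\<close>

definition cos_wave :: "'a::euclidean_space set \<Rightarrow> 'a \<Rightarrow> 'a \<Rightarrow> real" where
  "cos_wave S \<xi> x = indicator S x * cos (\<xi> \<bullet> x)"

definition sin_wave :: "'a::euclidean_space set \<Rightarrow> 'a \<Rightarrow> 'a \<Rightarrow> real" where
  "sin_wave S \<xi> x = indicator S x * sin (\<xi> \<bullet> x)"

lemma square_integrable_indicator_bounded:
  assumes S: "S \<in> sets borel" "bounded S" and [measurable]: "f \<in> borel_measurable borel" and b: "\<And>x. x \<in> S \<Longrightarrow> \<bar>f x\<bar> \<le> C"
  shows "square_integrable lborel (\<lambda>x. indicator S x * f x)"
proof -
  note [measurable] = S(1)
  have i: "integrable lborel (\<lambda>x. indicator S x * C\<^sup>2)"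
    using emeasure_bounded_finite[OF S(2)] by (intro integrable_mult_left) (simp add: integrable_indicator_iff)
  have "integrable lborel (\<lambda>x. (indicator S x * f x)\<^sup>2)"
  proof (rule Bochner_Integration.integrable_bound[OF i])
    show "AE x in lborel. norm ((indicator S x * f x)\<^sup>2) \<le> norm (indicator S x * C\<^sup>2)"
    proof (rule AE_I2)
      fix x
      show "norm ((indicator S x * f x)\<^sup>2) \<le> norm (indicator S x * C\<^sup>2)"
        using power_mono[OF b[of x] abs_ge_zero, of 2] by (cases "x \<in> S") simp_all
    qed
  qed simp
  then show ?thesis by (simp add: square_integrable_def)
qed

lemma square_integrable_waves:
  assumes "S \<in> sets borel" "bounded S"
  shows "square_integrable lborel (cos_wave S \<xi>)" "square_integrable lborel (sin_wave S \<xi>)"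
  unfolding cos_wave_def[abs_def] sin_wave_def[abs_def]
  by (rule square_integrable_indicator_bounded[OF assms, where C=1]; simp)+

text \<open>Writes the transform through inner products with square integrable functions. Bessel's
  inequality then applies to it, and it becomes continuous under L2 convergence on
  \<open>S\<close>.\<close>

lemma fhat_waves:
  assumes u: "integrable lborel u" and z: "\<And>x. x \<notin> S \<Longrightarrow> u x = 0"
  shows "fhat u \<xi> = Complex (LBINT x. u x * cos_wave S \<xi> x) (LBINT x. u x * sin_wave S \<xi> x)"
proof (rule complex_eqI)
  have eq: "u x * cos_wave S \<xi> x = Re (complex_of_real (u x) * cis (\<xi> \<bullet> x))"
    "u x * sin_wave S \<xi> x = Im (complex_of_real (u x) * cis (\<xi> \<bullet> x))" for x
    using z[of x] by (cases "x \<in> S"; simp add: cos_wave_def sin_wave_def)+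
  show "Re (fhat u \<xi>) = Re (Complex (LBINT x. u x * cos_wave S \<xi> x) (LBINT x. u x * sin_wave S \<xi> x))"
    unfolding eq complex.sel fhat_def by (rule integral_Re[OF fhat_integrable[OF u], symmetric])
  show "Im (fhat u \<xi>) = Im (Complex (LBINT x. u x * cos_wave S \<xi> x) (LBINT x. u x * sin_wave S \<xi> x))"
    unfolding eq complex.sel fhat_def by (rule integral_Im[OF fhat_integrable[OF u], symmetric])
qed

lemma square_integrable_bounded_support:
  assumes "square_integrable lborel u" "bounded S" "\<And>x. x \<notin> S \<Longrightarrow> u x = 0"
  shows "square_integrable_bounded u"
proof -
  have "bounded {x. u x \<noteq> 0}" by (rule bounded_subset[OF assms(2)]) (use assms(3) in auto)
  then show ?thesis using assms(1) by (simp add: square_integrable_def square_integrable_bounded_def)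
qed

lemma fhat_tendsto:
  assumes S: "S \<in> sets borel" "bounded S"
    and p: "\<And>j. square_integrable lborel (\<phi> j)" "\<And>j x. x \<notin> S \<Longrightarrow> \<phi> j x = 0"
    and u: "square_integrable lborel u" "\<And>x. x \<notin> S \<Longrightarrow> u x = 0"
    and lim: "(\<lambda>j. LBINT x. (\<phi> j x - u x)\<^sup>2) \<longlonglongrightarrow> 0"
  shows "(\<lambda>j. fhat (\<phi> j) \<xi>) \<longlonglongrightarrow> fhat u \<xi>"
proof -
  note W = square_integrable_waves[OF S, of \<xi>]
  have ip: "integrable lborel (\<phi> j)" for j
    by (rule square_integrable_bounded_integrable[OF square_integrable_bounded_support[OF p(1) S(2) p(2)]])
  have iu: "integrable lborel u"
    by (rule square_integrable_bounded_integrable[OF square_integrable_bounded_support[OF u(1) S(2) u(2)]])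
  have c: "(\<lambda>j. LBINT x. \<phi> j x * cos_wave S \<xi> x) \<longlonglongrightarrow> (LBINT x. u x * cos_wave S \<xi> x)"
    using integral_mult_tendsto[OF W(1) p(1) u(1) lim] by (simp only: mult.commute)
  have s: "(\<lambda>j. LBINT x. \<phi> j x * sin_wave S \<xi> x) \<longlonglongrightarrow> (LBINT x. u x * sin_wave S \<xi> x)"
    using integral_mult_tendsto[OF W(2) p(1) u(1) lim] by (simp only: mult.commute)
  have "fhat u \<xi> = Complex (LBINT x. u x * cos_wave S \<xi> x) (LBINT x. u x * sin_wave S \<xi> x)"
    by (rule fhat_waves[OF iu]) (rule u(2))
  moreover have "fhat (\<phi> j) \<xi> = Complex (LBINT x. \<phi> j x * cos_wave S \<xi> x) (LBINT x. \<phi> j x * sin_wave S \<xi> x)" for j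
    by (rule fhat_waves[OF ip]) (rule p(2))
  ultimately show ?thesis using tendsto_Complex[OF c s] by (simp only:)
qed


section \<open>Weak eigenfunctions\<close>

text \<open>\<open>V w\<close> is the derivative of \<open>u = V []\<close> in the directions listed in \<open>w\<close>; all functions are Borel measurable on the
  whole space and vanish outside \<open>\<Omega>\<close>.\<close>

definition weak_eigenfunction :: "nat \<Rightarrow> (real^'n::finite) set \<Rightarrow> real \<Rightarrow> ('n list \<Rightarrow> real^'n \<Rightarrow> real) \<Rightarrow> bool" where
  "weak_eigenfunction l \<Omega> \<mu> V \<longleftrightarrow>
     (\<forall>w. length w \<le> l \<longrightarrow> square_integrable lborel (V w)) \<and>
     (\<forall>w x. length w \<le> l \<longrightarrow> x \<notin> \<Omega> \<longrightarrow> V w x = 0) \<and>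
     (\<exists>\<phi>. (\<forall>j. test_function \<Omega> (\<phi> j)) \<and>
       (\<forall>w. length w \<le> l \<longrightarrow> (\<lambda>j. LBINT x. (partial_derivs w (\<phi> j) x - V w x)\<^sup>2) \<longlonglongrightarrow> 0)) \<and>
     (\<forall>\<phi>. test_function \<Omega> \<phi> \<longrightarrow>
       (LBINT x. V [] x * (neg_laplacian ^^ l) \<phi> x) = \<mu> * (LBINT x. V [] x * \<phi> x))"

lemma weak_eigenfunctionD:
  assumes "weak_eigenfunction l \<Omega> \<mu> V"
  shows "length w \<le> l \<Longrightarrow> square_integrable lborel (V w)"
    and "length w \<le> l \<Longrightarrow> x \<notin> \<Omega> \<Longrightarrow> V w x = 0"
    and "\<exists>\<phi>. (\<forall>j. test_function \<Omega> (\<phi> j)) \<and>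
       (\<forall>w. length w \<le> l \<longrightarrow> (\<lambda>j. LBINT x. (partial_derivs w (\<phi> j) x - V w x)\<^sup>2) \<longlonglongrightarrow> 0)"
    and "test_function \<Omega> \<phi> \<Longrightarrow>
       (LBINT x. V [] x * (neg_laplacian ^^ l) \<phi> x) = \<mu> * (LBINT x. V [] x * \<phi> x)"
  using assms unfolding weak_eigenfunction_def by blast+

lemma test_function_square_integrable:
  assumes "test_function \<Omega> \<phi>"
  shows "square_integrable lborel (partial_derivs w \<phi>)"
  using translation_continuousD(2,3)[OF test_functionD(5)[OF test_function_partial_derivs[OF assms]], of w]
  by (simp add: square_integrable_def)

text \<open>Both properties hold for test functions and survive the approximation: the first by
  \<open>translation_continuous_limit\<close>, the second because L2 convergence on a bounded set
  makes the transforms converge pointwise.\<close>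

lemma weak_eigenfunction_regularity:
  assumes V: "weak_eigenfunction l \<Omega> \<mu> V" and \<Omega>: "\<Omega> \<in> sets borel" "bounded \<Omega>" and w: "length w \<le> l"
  shows "translation_continuous (V w)" "fhat (V w) \<xi> = fourier_symbol w \<xi> * fhat (V []) \<xi>"
proof -
  note VD = weak_eigenfunctionD[OF V]
  from VD(3) obtain \<phi> where t: "\<And>j. test_function \<Omega> (\<phi> j)"
    and lim: "\<And>w. length w \<le> l \<Longrightarrow> (\<lambda>j. LBINT x. (partial_derivs w (\<phi> j) x - V w x)\<^sup>2) \<longlonglongrightarrow> 0"
    by blast
  show "translation_continuous (V w)"
  proof (rule translation_continuous_limit[OF _ _ lim[OF w]])
    show "translation_continuous (partial_derivs w (\<phi> j))" for j
      by (rule test_functionD(5)[OF test_function_partial_derivs[OF t]])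
    show "square_integrable_bounded (V w)"
      by (rule square_integrable_bounded_support[OF VD(1)[OF w] \<Omega>(2) VD(2)[OF w]])
  qed
  have L: "(\<lambda>j. fhat (partial_derivs w (\<phi> j)) \<xi>) \<longlonglongrightarrow> fhat (V w) \<xi>" if w: "length w \<le> l" for w
  proof (rule fhat_tendsto[OF \<Omega> _ _ VD(1)[OF w] VD(2)[OF w] lim[OF w]])
    show "square_integrable lborel (partial_derivs w (\<phi> j))" for j
      by (rule test_function_square_integrable[OF t])
    show "partial_derivs w (\<phi> j) x = 0" if "x \<notin> \<Omega>" for j x
      by (rule test_functionD(4)[OF test_function_partial_derivs[OF t] that])
  qed
  have "(\<lambda>j. fhat (\<phi> j) \<xi>) \<longlonglongrightarrow> fhat (V []) \<xi>" using L[of "[]"] by simp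
  then have "(\<lambda>j. fourier_symbol w \<xi> * fhat (\<phi> j) \<xi>) \<longlonglongrightarrow> fourier_symbol w \<xi> * fhat (V []) \<xi>"
    by (rule tendsto_mult_left)
  then have "(\<lambda>j. fhat (partial_derivs w (\<phi> j)) \<xi>) \<longlonglongrightarrow> fourier_symbol w \<xi> * fhat (V []) \<xi>"
    by (simp only: fhat_partial_derivs[OF t])
  from LIMSEQ_unique[OF L[OF w] this] show "fhat (V w) \<xi> = fourier_symbol w \<xi> * fhat (V []) \<xi>" .
qed

text \<open>The equation for \<open>V\<close> is tested with the sequence approximating
  \<open>W\<close>. Symmetry of the left side will give orthogonality for distinct eigenvalues, and
  the case V = W the moment of order 2l.\<close>

lemma weak_eigenfunction_energy:
  assumes V: "weak_eigenfunction l \<Omega> \<mu> V" and W: "weak_eigenfunction l \<Omega> \<nu> W" and \<Omega>: "\<Omega> \<in> sets borel" "bounded \<Omega>"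
  shows "(\<Sum>w | length w = l. LBINT x. V w x * W w x) = \<mu> * (LBINT x. V [] x * W [] x)"
proof -
  note VD = weak_eigenfunctionD[OF V] and WD = weak_eigenfunctionD[OF W]
  from WD(3) obtain \<phi> where t: "\<And>j. test_function \<Omega> (\<phi> j)"
    and lim: "\<And>w. length w \<le> l \<Longrightarrow> (\<lambda>j. LBINT x. (partial_derivs w (\<phi> j) x - W w x)\<^sup>2) \<longlonglongrightarrow> 0"
    by blast
  have L: "(\<lambda>j. LBINT x. V w x * partial_derivs w (\<phi> j) x) \<longlonglongrightarrow> (LBINT x. V w x * W w x)" if w: "length w \<le> l" for w
    by (rule integral_mult_tendsto[OF VD(1)[OF w] test_function_square_integrable[OF t] WD(1)[OF w] lim[OF w]])
  have "(\<Sum>w | length w = l. LBINT x. V w x * partial_derivs w (\<phi> j) x) = \<mu> * (LBINT x. V [] x * \<phi> j x)" for j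
    using integral_mult_neg_laplacian[OF weak_eigenfunction_regularity[OF V \<Omega>] t, of l j] VD(4)[OF t] by simp
  moreover have "(\<lambda>j. \<Sum>w | length w = l. LBINT x. V w x * partial_derivs w (\<phi> j) x) \<longlonglongrightarrow> (\<Sum>w | length w = l. LBINT x. V w x * W w x)"
    by (rule tendsto_sum) (rule L, simp)
  moreover have "(\<lambda>j. \<mu> * (LBINT x. V [] x * \<phi> j x)) \<longlonglongrightarrow> \<mu> * (LBINT x. V [] x * W [] x)"
    using L[of "[]"] by (intro tendsto_mult_left) simp
  ultimately show ?thesis by (simp only: LIMSEQ_unique)
qed

lemma weak_eigenfunction_lincomb:
  assumes V: "weak_eigenfunction l \<Omega> \<mu> V" and W: "weak_eigenfunction l \<Omega> \<mu> W"
  shows "weak_eigenfunction l \<Omega> \<mu> (\<lambda>w x. a * V w x + b * W w x)"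
  unfolding weak_eigenfunction_def
proof (intro conjI allI impI)
  note VD = weak_eigenfunctionD[OF V] and WD = weak_eigenfunctionD[OF W]
  show "square_integrable lborel (\<lambda>x. a * V w x + b * W w x)" if "length w \<le> l" for w
    by (rule square_integrable_comb[OF VD(1)[OF that] WD(1)[OF that]])
  show "a * V w x + b * W w x = 0" if "length w \<le> l" "x \<notin> \<Omega>" for w x
    using VD(2)[OF that] WD(2)[OF that] by simp
  from VD(3) obtain \<phi> where t: "\<And>j. test_function \<Omega> (\<phi> j)"
    and lim: "\<And>w. length w \<le> l \<Longrightarrow> (\<lambda>j. LBINT x. (partial_derivs w (\<phi> j) x - V w x)\<^sup>2) \<longlonglongrightarrow> 0"
    by blast
  from WD(3) obtain \<psi> where t': "\<And>j. test_function \<Omega> (\<psi> j)"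
    and lim': "\<And>w. length w \<le> l \<Longrightarrow> (\<lambda>j. LBINT x. (partial_derivs w (\<psi> j) x - W w x)\<^sup>2) \<longlonglongrightarrow> 0"
    by blast
  define \<theta> where "\<theta> j = (\<lambda>x. a * \<phi> j x + b * \<psi> j x)" for j
  have "test_function \<Omega> (\<theta> j)" for j unfolding \<theta>_def by (rule test_function_lincomb[OF t t'])
  moreover have "(\<lambda>j. LBINT x. (partial_derivs w (\<theta> j) x - (a * V w x + b * W w x))\<^sup>2) \<longlonglongrightarrow> 0" if w: "length w \<le> l" for w
  proof -
    let ?A = "\<lambda>j x. partial_derivs w (\<phi> j) x - V w x" and ?B = "\<lambda>j x. partial_derivs w (\<psi> j) x - W w x"
    have A: "square_integrable lborel (?A j)" for j
      using square_integrable_comb[OF test_function_square_integrable[OF t, of w j] VD(1)[OF w], where a=1 and b="-1"] by simp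
    have B: "square_integrable lborel (?B j)" for j
      using square_integrable_comb[OF test_function_square_integrable[OF t', of w j] WD(1)[OF w], where a=1 and b="-1"] by simp
    have s: "smooth (\<phi> j)" "smooth (\<psi> j)" for j using t t' by (auto simp: test_function_def)
    have eq: "partial_derivs w (\<theta> j) x - (a * V w x + b * W w x) = a * ?A j x + b * ?B j x" for j x
      unfolding \<theta>_def partial_derivs_lincomb[OF s] by (simp add: algebra_simps)
    have le: "(LBINT x. (partial_derivs w (\<theta> j) x - (a * V w x + b * W w x))\<^sup>2)
       \<le> 2 * a\<^sup>2 * (LBINT x. (?A j x)\<^sup>2) + 2 * b\<^sup>2 * (LBINT x. (?B j x)\<^sup>2)" for j
    proof -
      have "(LBINT x. (a * ?A j x + b * ?B j x)\<^sup>2) \<le> (LBINT x. 2 * a\<^sup>2 * (?A j x)\<^sup>2 + 2 * b\<^sup>2 * (?B j x)\<^sup>2)"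
      proof (rule integral_mono)
        show "integrable lborel (\<lambda>x. (a * ?A j x + b * ?B j x)\<^sup>2)"
          using square_integrable_comb[OF A B, of a j b j] by (simp add: square_integrable_def)
        show "integrable lborel (\<lambda>x. 2 * a\<^sup>2 * (?A j x)\<^sup>2 + 2 * b\<^sup>2 * (?B j x)\<^sup>2)"
          using A[of j] B[of j] by (simp add: square_integrable_def)
        show "(a * ?A j x + b * ?B j x)\<^sup>2 \<le> 2 * a\<^sup>2 * (?A j x)\<^sup>2 + 2 * b\<^sup>2 * (?B j x)\<^sup>2" for x
          using sum_power2_le[of "a * ?A j x" "b * ?B j x"] by (simp only: power_mult_distrib mult.assoc)
      qed
      also have "\<dots> = 2 * a\<^sup>2 * (LBINT x. (?A j x)\<^sup>2) + 2 * b\<^sup>2 * (LBINT x. (?B j x)\<^sup>2)"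
        using A[of j] B[of j] by (simp add: square_integrable_def)
      finally show ?thesis unfolding eq .
    qed
    have "(\<lambda>j. 2 * a\<^sup>2 * (LBINT x. (?A j x)\<^sup>2) + 2 * b\<^sup>2 * (LBINT x. (?B j x)\<^sup>2)) \<longlonglongrightarrow> 2 * a\<^sup>2 * 0 + 2 * b\<^sup>2 * 0"
      by (intro tendsto_add tendsto_mult_left lim lim' w)
    then have lim0: "(\<lambda>j. 2 * a\<^sup>2 * (LBINT x. (?A j x)\<^sup>2) + 2 * b\<^sup>2 * (LBINT x. (?B j x)\<^sup>2)) \<longlonglongrightarrow> 0"
      by (simp only: mult_zero_right add_0_left)
    show ?thesis
    proof (rule tendsto_sandwich[OF _ _ tendsto_const lim0])
      show "\<forall>\<^sub>F j in sequentially. 0 \<le> (LBINT x. (partial_derivs w (\<theta> j) x - (a * V w x + b * W w x))\<^sup>2)"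
        by (intro always_eventually allI Bochner_Integration.integral_nonneg zero_le_power2)
    qed (intro always_eventually allI le)
  qed
  ultimately show "\<exists>\<phi>. (\<forall>j. test_function \<Omega> (\<phi> j)) \<and>
       (\<forall>w. length w \<le> l \<longrightarrow> (\<lambda>j. LBINT x. (partial_derivs w (\<phi> j) x - (a * V w x + b * W w x))\<^sup>2) \<longlonglongrightarrow> 0)"
    by blast
  fix \<eta> assume \<eta>: "test_function \<Omega> \<eta>"
  have V0: "square_integrable lborel (V [])" "square_integrable lborel (W [])" using VD(1) WD(1) by auto
  have lin: "(LBINT x. (a * V [] x + b * W [] x) * g x) = a * (LBINT x. V [] x * g x) + b * (LBINT x. W [] x * g x)"
    if g: "test_function \<Omega> g" for g
  proof -
    have "square_integrable lborel g" using test_function_square_integrable[OF g, of "[]"] by simp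
    note i = square_integrable_mult_integrable[OF V0(1) this] square_integrable_mult_integrable[OF V0(2) this]
    have "(LBINT x. (a * V [] x + b * W [] x) * g x) = (LBINT x. a * (V [] x * g x) + b * (W [] x * g x))"
      by (intro Bochner_Integration.integral_cong) (auto simp: algebra_simps)
    then show ?thesis using i by simp
  qed
  show "(LBINT x. (a * V [] x + b * W [] x) * (neg_laplacian ^^ l) \<eta> x) = \<mu> * (LBINT x. (a * V [] x + b * W [] x) * \<eta> x)"
    unfolding lin[OF test_function_neg_laplacian[OF \<eta>]] lin[OF \<eta>] VD(4)[OF \<eta>] WD(4)[OF \<eta>]
    by (simp add: algebra_simps)
qed

lemma weak_eigenfunction_zero: "weak_eigenfunction l \<Omega> \<mu> (\<lambda>_ _. 0)"
proof -
  have "partial_derivs w (\<lambda>_. 0) = (\<lambda>_. 0)" for w :: "'a list"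
    using partial_derivs_lincomb[of "\<lambda>_::real^'a. 0" "\<lambda>_. 0" w 0 0] test_function_zero[of UNIV]
    by (simp add: test_function_def)
  then show ?thesis
    unfolding weak_eigenfunction_def using test_function_zero[of \<Omega>]
    by (intro conjI exI[of _ "\<lambda>_ _. 0"]) (simp_all add: square_integrable_def)
qed

lemma weak_eigenfunction_sum:
  assumes "finite I" "\<And>i. i \<in> I \<Longrightarrow> weak_eigenfunction l \<Omega> \<mu> (V i)"
  shows "weak_eigenfunction l \<Omega> \<mu> (\<lambda>w x. \<Sum>i\<in>I. c i * V i w x)"
  using assms
proof (induction I rule: finite_induct)
  case (insert i I)
  have "weak_eigenfunction l \<Omega> \<mu> (\<lambda>w x. c i * V i w x + 1 * (\<Sum>i\<in>I. c i * V i w x))"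
    by (intro weak_eigenfunction_lincomb insert.IH insert.prems) simp_all
  then show ?case using insert.hyps by simp
qed (simp add: weak_eigenfunction_zero)

section \<open>From classes of functions on \<Omega> to Borel functions on the whole space\<close>

lemma Int_space_lebesgue: "\<Omega> \<in> sets borel \<Longrightarrow> \<Omega> \<inter> space lebesgue \<in> sets lebesgue"
  by (simp add: sets_completionI_sets)

lemma
  fixes g :: "'a::euclidean_space \<Rightarrow> real"
  assumes \<Omega>: "\<Omega> \<in> sets borel" and g: "g \<in> borel_measurable borel" and z: "\<And>x. x \<notin> \<Omega> \<Longrightarrow> g x = 0"
  shows integral_lebesgue_on_eq_lborel: "(LINT x|lebesgue_on \<Omega>. g x) = (LBINT x. g x)"
    and integrable_lebesgue_on_eq_lborel: "integrable (lebesgue_on \<Omega>) g \<longleftrightarrow> integrable lborel g"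
proof -
  note s = Int_space_lebesgue[OF \<Omega>]
  have e: "(\<lambda>x. indicator \<Omega> x *\<^sub>R g x) = g"
    using z by (auto simp: fun_eq_iff indicator_def)
  have m: "g \<in> borel_measurable lborel" using g by simp
  show "(LINT x|lebesgue_on \<Omega>. g x) = (LBINT x. g x)"
    unfolding integral_restrict_space[OF s] e by (rule integral_completion[OF m])
  show "integrable (lebesgue_on \<Omega>) g \<longleftrightarrow> integrable lborel g"
    unfolding integrable_restrict_space[OF s] e by (rule integrable_completion[OF m])
qed

lemma borel_measurable_lebesgue_onI:
  "g \<in> borel_measurable borel \<Longrightarrow> g \<in> borel_measurable (lebesgue_on \<Omega>)"
  by (intro measurable_restrict_space1 measurable_completion) simp

text \<open>A Lebesgue measurable function agrees almost everywhere with a Borel function, and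
  multiplication by the indicator of \<Omega> restores the value 0 outside.\<close>

lemma L2_representative:
  assumes \<Omega>: "\<Omega> \<in> sets borel" and u: "u \<in> L2 \<Omega>"
  shows "\<exists>u'. square_integrable lborel u' \<and> (\<forall>x. x \<notin> \<Omega> \<longrightarrow> u' x = 0) \<and> (AE x in lebesgue_on \<Omega>. u x = u' x)"
proof -
  note s = Int_space_lebesgue[OF \<Omega>]
  have um: "u \<in> borel_measurable (lebesgue_on \<Omega>)" and ui: "integrable (lebesgue_on \<Omega>) (\<lambda>x. (u x)\<^sup>2)"
    using u by (auto simp: L2_def)
  have "(\<lambda>x. indicator \<Omega> x *\<^sub>R u x) \<in> borel_measurable lebesgue"
    using um unfolding borel_measurable_restrict_space_iff[OF s] .
  then obtain v where v: "v \<in> borel_measurable lborel" and ae: "AE x in lborel. indicator \<Omega> x *\<^sub>R u x = v x"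
    using completion_ex_borel_measurable_real by blast
  define u' where "u' x = indicator \<Omega> x * v x" for x
  have [measurable]: "u' \<in> borel_measurable borel" unfolding u'_def using v \<Omega> by simp
  have z: "u' x = 0" if "x \<notin> \<Omega>" for x using that by (simp add: u'_def)
  have "AE x in lebesgue. indicator \<Omega> x *\<^sub>R u x = v x" using ae by (rule AE_completion)
  then have ae': "AE x in lebesgue_on \<Omega>. u x = u' x"
    unfolding AE_restrict_space_iff[OF s] by (rule eventually_mono) (auto simp: u'_def)
  have "integrable (lebesgue_on \<Omega>) (\<lambda>x. (u' x)\<^sup>2) \<longleftrightarrow> integrable (lebesgue_on \<Omega>) (\<lambda>x. (u x)\<^sup>2)"
  proof (rule integrable_cong_AE)
    show "(\<lambda>x. (u' x)\<^sup>2) \<in> borel_measurable (lebesgue_on \<Omega>)"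
      by (rule borel_measurable_lebesgue_onI) measurable
    show "(\<lambda>x. (u x)\<^sup>2) \<in> borel_measurable (lebesgue_on \<Omega>)" using um by measurable
    show "AE x in lebesgue_on \<Omega>. (u' x)\<^sup>2 = (u x)\<^sup>2" using ae' by (rule eventually_mono) simp
  qed
  then have "integrable lborel (\<lambda>x. (u' x)\<^sup>2)"
    using ui integrable_lebesgue_on_eq_lborel[OF \<Omega>, of "\<lambda>x. (u' x)\<^sup>2"] z by simp
  then show ?thesis using z ae' by (intro exI[of _ u']) (simp add: square_integrable_def)
qed

text \<open>\<open>h\<close> is the integrand as a function of the point and of the value of
  \<open>u\<close>, so that one statement transports both squared distances and pairings with test
  functions.\<close>

lemma integral_lebesgue_on_representative:
  assumes \<Omega>: "\<Omega> \<in> sets borel" and um: "u \<in> borel_measurable (lebesgue_on \<Omega>)"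
    and u'm: "u' \<in> borel_measurable borel" and ae: "AE x in lebesgue_on \<Omega>. u x = u' x"
    and h: "\<And>x. h x (u' x) = g x" "g \<in> borel_measurable borel" "\<And>x. x \<notin> \<Omega> \<Longrightarrow> g x = 0"
    and hm: "(\<lambda>x. h x (u x)) \<in> borel_measurable (lebesgue_on \<Omega>)"
  shows "(LINT x|lebesgue_on \<Omega>. h x (u x)) = (LBINT x. g x :: real)"
proof -
  have "(LINT x|lebesgue_on \<Omega>. h x (u x)) = (LINT x|lebesgue_on \<Omega>. g x)"
  proof (rule integral_cong_AE[OF hm borel_measurable_lebesgue_onI[OF h(2)]])
    show "AE x in lebesgue_on \<Omega>. h x (u x) = g x"
      using ae by (rule eventually_mono) (simp add: h(1))
  qed
  also have "\<dots> = (LBINT x. g x)" by (rule integral_lebesgue_on_eq_lborel[OF \<Omega> h(2,3)])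
  finally show ?thesis .
qed

text \<open>One weak derivative is chosen for each word and replaced by a Borel representative. In
  \<open>sobolev_H0\<close> a single sequence converges to all weak derivatives, hence also to the
  chosen ones.\<close>

lemma eigenspace_representative:
  fixes \<Omega> :: "(real^'n::finite) set"
  assumes \<Omega>: "\<Omega> \<in> sets borel" and u: "u \<in> eigenspace l \<Omega> \<mu>"
  shows "\<exists>V. weak_eigenfunction l \<Omega> \<mu> V \<and> (AE x in lebesgue_on \<Omega>. u x = V [] x)"
proof -
  have uH: "u \<in> sobolev_H l \<Omega>" and eq: "\<And>\<phi>. test_function \<Omega> \<phi> \<Longrightarrow>
      (LINT x|lebesgue_on \<Omega>. u x * (neg_laplacian ^^ l) \<phi> x) = \<mu> * (LINT x|lebesgue_on \<Omega>. u x * \<phi> x)"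
    using u unfolding eigenspace_def sobolev_H0_def by blast+
  obtain \<phi> where t: "\<And>j. test_function \<Omega> (\<phi> j)"
    and lim: "\<And>w v. length w \<le> l \<Longrightarrow> v \<in> L2 \<Omega> \<Longrightarrow> weak_deriv \<Omega> w u v \<Longrightarrow>
       (\<lambda>j. LINT x|lebesgue_on \<Omega>. (partial_derivs w (\<phi> j) x - v x)\<^sup>2) \<longlonglongrightarrow> 0"
    using u unfolding eigenspace_def sobolev_H0_def by blast
  have uL: "u \<in> L2 \<Omega>" and ex: "\<And>w. length w \<le> l \<Longrightarrow> \<exists>v\<in>L2 \<Omega>. weak_deriv \<Omega> w u v"
    using uH unfolding sobolev_H_def by blast+
  \<comment> \<open>For the empty word the choice is \<open>u\<close> itself, so that
    \<open>V []\<close> represents \<open>u\<close>.\<close>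
  have "\<exists>v. v \<in> L2 \<Omega> \<and> weak_deriv \<Omega> w u v \<and> (w = [] \<longrightarrow> v = u)" if "length w \<le> l" for w
  proof (cases "w = []")
    case True
    then show ?thesis using uL by (intro exI[of _ u]) (simp add: weak_deriv_def)
  qed (use ex[OF that] in blast)
  then have "\<forall>w. \<exists>v. length w \<le> l \<longrightarrow> v \<in> L2 \<Omega> \<and> weak_deriv \<Omega> w u v \<and> (w = [] \<longrightarrow> v = u)" by blast
  from choice[OF this] obtain v where vall: "\<forall>w. length w \<le> l \<longrightarrow> v w \<in> L2 \<Omega> \<and> weak_deriv \<Omega> w u (v w) \<and> (w = [] \<longrightarrow> v w = u)"
    by (rule exE)
  then have v: "\<And>w. length w \<le> l \<Longrightarrow> v w \<in> L2 \<Omega>" "\<And>w. length w \<le> l \<Longrightarrow> weak_deriv \<Omega> w u (v w)"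
    by blast+
  have v0: "v [] = u" using vall[rule_format, of "[]"] by simp
  have "\<forall>w. \<exists>u'. length w \<le> l \<longrightarrow> square_integrable lborel u' \<and> (\<forall>x. x \<notin> \<Omega> \<longrightarrow> u' x = 0) \<and> (AE x in lebesgue_on \<Omega>. v w x = u' x)"
    using L2_representative[OF \<Omega> v(1)] by blast
  from choice[OF this] obtain V where V: "\<And>w. length w \<le> l \<Longrightarrow> square_integrable lborel (V w)"
    "\<And>w x. length w \<le> l \<Longrightarrow> x \<notin> \<Omega> \<Longrightarrow> V w x = 0" "\<And>w. length w \<le> l \<Longrightarrow> AE x in lebesgue_on \<Omega>. v w x = V w x"
    by blast
  have Vm: "V w \<in> borel_measurable borel" if "length w \<le> l" for w
    using V(1)[OF that] by (simp add: square_integrable_def)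
  have vm: "v w \<in> borel_measurable (lebesgue_on \<Omega>)" if "length w \<le> l" for w
    using v(1)[OF that] by (simp add: L2_def)
  have tm: "g \<in> borel_measurable borel" if "test_function \<Omega> g" for g
    by (rule translation_continuousD(2)[OF test_functionD(5)[OF that]])
  have c: "(LINT x|lebesgue_on \<Omega>. (partial_derivs w (\<phi> j) x - v w x)\<^sup>2) = (LBINT x. (partial_derivs w (\<phi> j) x - V w x)\<^sup>2)"
    if w: "length w \<le> l" for w j
  proof (rule integral_lebesgue_on_representative[OF \<Omega> vm[OF w] Vm[OF w] V(3)[OF w], where h="\<lambda>x y. (partial_derivs w (\<phi> j) x - y)\<^sup>2"])
    note [measurable] = Vm[OF w] tm[OF test_function_partial_derivs[OF t, of w j]]
    show "(\<lambda>x. (partial_derivs w (\<phi> j) x - V w x)\<^sup>2) \<in> borel_measurable borel" by measurable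
    have [measurable]: "partial_derivs w (\<phi> j) \<in> borel_measurable (lebesgue_on \<Omega>)"
      by (rule borel_measurable_lebesgue_onI) measurable
    note [measurable] = vm[OF w]
    show "(\<lambda>x. (partial_derivs w (\<phi> j) x - v w x)\<^sup>2) \<in> borel_measurable (lebesgue_on \<Omega>)" by measurable
    show "(partial_derivs w (\<phi> j) x - V w x)\<^sup>2 = 0" if "x \<notin> \<Omega>" for x
      using V(2)[OF w that] test_functionD(4)[OF test_function_partial_derivs[OF t] that] by simp
  qed simp
  have d: "(LINT x|lebesgue_on \<Omega>. u x * g x) = (LBINT x. V [] x * g x)" if g: "test_function \<Omega> g" for g
  proof -
    have ae: "AE x in lebesgue_on \<Omega>. u x = V [] x" using V(3)[of "[]"] v0 by simp
    have um: "u \<in> borel_measurable (lebesgue_on \<Omega>)" using vm[of "[]"] v0 by simp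
    have V0: "V [] \<in> borel_measurable borel" by (rule Vm) simp
    show ?thesis
    proof (rule integral_lebesgue_on_representative[OF \<Omega> um V0 ae, where h="\<lambda>x y. y * g x"])
      note [measurable] = V0 tm[OF g] um
      show "(\<lambda>x. V [] x * g x) \<in> borel_measurable borel" by measurable
      have [measurable]: "g \<in> borel_measurable (lebesgue_on \<Omega>)"
        by (rule borel_measurable_lebesgue_onI) measurable
      show "(\<lambda>x. u x * g x) \<in> borel_measurable (lebesgue_on \<Omega>)" by measurable
      show "V [] x * g x = 0" if "x \<notin> \<Omega>" for x using V(2)[of "[]" x] that by simp
    qed simp
  qed
  have "weak_eigenfunction l \<Omega> \<mu> V"
    unfolding weak_eigenfunction_def
  proof (intro conjI allI impI V(1,2) exI[of _ \<phi>])
    show "test_function \<Omega> (\<phi> j)" for j by (rule t)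
    show "(\<lambda>j. LBINT x. (partial_derivs w (\<phi> j) x - V w x)\<^sup>2) \<longlonglongrightarrow> 0" if w: "length w \<le> l" for w
      unfolding c[OF w, symmetric] by (rule lim[OF w v(1)[OF w] v(2)[OF w]])
    show "(LBINT x. V [] x * (neg_laplacian ^^ l) \<psi> x) = \<mu> * (LBINT x. V [] x * \<psi> x)"
      if "test_function \<Omega> \<psi>" for \<psi>
      unfolding d[OF test_function_neg_laplacian[OF that], symmetric] d[OF that, symmetric] by (rule eq[OF that])
  qed
  moreover have "AE x in lebesgue_on \<Omega>. u x = V [] x" using V(3)[of "[]"] v0 by simp
  ultimately show ?thesis by blast
qed

section \<open>Orthonormal eigenfunctions\<close>

text \<open>Orthonormalization is carried out on the functions \<open>B j []\<close>; the resulting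
  coefficients are applied to the derivatives along all words alike.\<close>

lemma orthonormal_eigenbasis:
  fixes \<Omega> :: "(real^'n::finite) set"
  assumes \<Omega>: "\<Omega> \<in> sets borel" and dim: "has_ae_dim \<Omega> (eigenspace l \<Omega> \<mu>) m"
  shows "\<exists>E. (\<forall>j<m. weak_eigenfunction l \<Omega> \<mu> (E j)) \<and>
    (\<forall>i<m. \<forall>j<m. (LBINT x. E i [] x * E j [] x) = (if i = j then 1 else 0))"
proof -
  note s = Int_space_lebesgue[OF \<Omega>]
  obtain b where b: "\<And>j. j < m \<Longrightarrow> b j \<in> eigenspace l \<Omega> \<mu>"
    and ind: "\<And>c. AE x in lebesgue_on \<Omega>. (\<Sum>j<m. c j * b j x) = 0 \<Longrightarrow> \<forall>j<m. c j = 0"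
    using dim unfolding has_ae_dim_def by blast
  have "\<forall>j. \<exists>V. j < m \<longrightarrow> weak_eigenfunction l \<Omega> \<mu> V \<and> (AE x in lebesgue_on \<Omega>. b j x = V [] x)"
    using eigenspace_representative[OF \<Omega> b] by blast
  from choice[OF this] obtain B where B: "\<And>j. j < m \<Longrightarrow> weak_eigenfunction l \<Omega> \<mu> (B j)"
    and Bae: "\<And>j. j < m \<Longrightarrow> AE x in lebesgue_on \<Omega>. b j x = B j [] x"
    by blast
  have sq: "square_integrable lborel (B j [])" if "j < m" for j
    by (rule weak_eigenfunctionD(1)[OF B[OF that]]) simp
  \<comment> \<open>A relation almost everywhere on the whole space restricts to \<Omega>, where the
    finitely many exceptional null sets allow \<open>B j []\<close> to be replaced by
    \<open>b j\<close>.\<close>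
  have ind': "\<forall>j<m. c j = 0" if ae: "AE x in lborel. (\<Sum>j<m. c j * B j [] x) = 0" for c
  proof (rule ind)
    have "AE x in lebesgue_on \<Omega>. (\<Sum>j<m. c j * B j [] x) = 0"
      unfolding AE_restrict_space_iff[OF s] using AE_completion[OF ae] by (rule eventually_mono) simp
    moreover have "AE x in lebesgue_on \<Omega>. \<forall>j\<in>{..<m}. b j x = B j [] x"
      using Bae by (intro AE_finite_allI) auto
    ultimately show "AE x in lebesgue_on \<Omega>. (\<Sum>j<m. c j * b j x) = 0"
      by eventually_elim simp
  qed
  obtain C where C: "\<forall>i<m. \<forall>i'<m. (LBINT x. (\<Sum>j<m. C i j * B j [] x) * (\<Sum>j<m. C i' j * B j [] x)) = (if i = i' then 1 else 0 :: real)"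
    using gram_schmidt[of m lborel "\<lambda>j. B j []", OF sq ind'] by blast
  show ?thesis
  proof (intro exI[of _ "\<lambda>i w x. \<Sum>j<m. C i j * B j w x"] conjI C allI impI)
    show "weak_eigenfunction l \<Omega> \<mu> (\<lambda>w x. \<Sum>j<m. C i j * B j w x)" for i
      by (rule weak_eigenfunction_sum) (use B in auto)
  qed
qed

text \<open>The indices with a given eigenvalue are as many as the dimension of its eigenspace, so
  they can be matched with an orthonormal basis of it. Across distinct eigenvalues, orthogonality
  comes from the symmetry of the energy.\<close>

lemma orthonormal_eigenfunctions:
  fixes \<Omega> :: "(real^'n::finite) set"
  assumes \<Omega>: "\<Omega> \<in> sets borel" "bounded \<Omega>" and ev: "dirichlet_eigenvalues l \<Omega> \<Lambda>"
  shows "\<exists>V. (\<forall>i\<ge>1. weak_eigenfunction l \<Omega> (\<Lambda> i) (V i)) \<and>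
    (\<forall>i\<ge>1. \<forall>j\<ge>1. (LBINT x. V i [] x * V j [] x) = (if i = j then 1 else 0))"
proof -
  define S where "S \<mu> = {i. 1 \<le> i \<and> \<Lambda> i = \<mu>}" for \<mu>
  have fin: "finite (S \<mu>)" and dim: "has_ae_dim \<Omega> (eigenspace l \<Omega> \<mu>) (card (S \<mu>))" for \<mu>
    using ev unfolding dirichlet_eigenvalues_def S_def by blast+
  have "\<exists>f. bij_betw f (S \<mu>) {..<card (S \<mu>)}" for \<mu>
    using ex_bij_betw_finite_nat[OF fin[of \<mu>]] by (simp add: atLeast0LessThan)
  then obtain f where f: "\<And>\<mu>. bij_betw (f \<mu>) (S \<mu>) {..<card (S \<mu>)}" by metis
  have "\<forall>\<mu>. \<exists>E. (\<forall>j<card (S \<mu>). weak_eigenfunction l \<Omega> \<mu> (E j)) \<and>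
    (\<forall>i<card (S \<mu>). \<forall>j<card (S \<mu>). (LBINT x. E i [] x * E j [] x) = (if i = j then 1 else 0))"
    using orthonormal_eigenbasis[OF \<Omega>(1) dim] by blast
  from choice[OF this] obtain E where E: "\<And>\<mu> j. j < card (S \<mu>) \<Longrightarrow> weak_eigenfunction l \<Omega> \<mu> (E \<mu> j)"
    and on: "\<And>\<mu> i j. i < card (S \<mu>) \<Longrightarrow> j < card (S \<mu>) \<Longrightarrow> (LBINT x. E \<mu> i [] x * E \<mu> j [] x) = (if i = j then 1 else 0)"
    by blast
  define V where "V i = E (\<Lambda> i) (f (\<Lambda> i) i)" for i
  have less: "f (\<Lambda> i) i < card (S (\<Lambda> i))" if "1 \<le> i" for i
    using bij_betwE[OF f[of "\<Lambda> i"]] that by (auto simp: S_def)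
  have V: "weak_eigenfunction l \<Omega> (\<Lambda> i) (V i)" if "1 \<le> i" for i
    unfolding V_def by (rule E[OF less[OF that]])
  have "(LBINT x. V i [] x * V j [] x) = (if i = j then 1 else 0)" if ij: "1 \<le> i" "1 \<le> j" for i j
  proof (cases "\<Lambda> i = \<Lambda> j")
    case True
    have "f (\<Lambda> i) i = f (\<Lambda> i) j \<longleftrightarrow> i = j"
      using bij_betw_imp_inj_on[OF f[of "\<Lambda> i"]] ij True by (auto simp: inj_on_def S_def)
    moreover have "V j = E (\<Lambda> i) (f (\<Lambda> i) j)" "f (\<Lambda> i) j < card (S (\<Lambda> i))"
      using less[OF ij(2)] True by (simp_all add: V_def)
    ultimately show ?thesis using on[OF less[OF ij(1)], of "f (\<Lambda> i) j"] by (simp add: V_def[of i])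
  next
    case False
    have "\<Lambda> i * (LBINT x. V i [] x * V j [] x) = (\<Sum>w | length w = l. LBINT x. V i w x * V j w x)"
      by (rule weak_eigenfunction_energy[OF V[OF ij(1)] V[OF ij(2)] \<Omega>, symmetric])
    also have "\<dots> = (\<Sum>w | length w = l. LBINT x. V j w x * V i w x)" by (simp only: mult.commute)
    also have "\<dots> = \<Lambda> j * (LBINT x. V j [] x * V i [] x)"
      by (rule weak_eigenfunction_energy[OF V[OF ij(2)] V[OF ij(1)] \<Omega>])
    also have "\<dots> = \<Lambda> j * (LBINT x. V i [] x * V j [] x)" by (simp only: mult.commute)
    finally show ?thesis using False by auto
  qed
  then show ?thesis using V by blast
qed


section \<open>The spectral density and the eigenvalue bound\<close>

lemma norm_cis_diff_le: "cmod (cis a - cis b) \<le> \<bar>a - b\<bar>"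
proof -
  have "cis a - cis b = cis b * (iexp (a - b) - 1)"
    by (simp add: cis_conv_exp[symmetric] cis_mult algebra_simps flip: of_real_diff)
  then have "cmod (cis a - cis b) = cmod (iexp (a - b) - 1)" by (simp add: norm_mult)
  also have "\<dots> \<le> \<bar>a - b\<bar>" using iexp_approx1[of "a - b" 0] by simp
  finally show ?thesis .
qed

text \<open>Over a real orthonormal system the inequality for a complex function is the sum of those
  for its real and imaginary parts.\<close>

lemma complex_bessel_inequality:
  assumes I: "finite I" and e: "\<And>i. i \<in> I \<Longrightarrow> square_integrable M (e i)"
    and g: "square_integrable M g" "square_integrable M h"
    and on: "\<And>i j. i \<in> I \<Longrightarrow> j \<in> I \<Longrightarrow> (LINT x|M. e i x * e j x) = (if i = j then 1 else 0)"
  shows "(\<Sum>i\<in>I. (cmod (Complex (LINT x|M. e i x * g x) (LINT x|M. e i x * h x)))\<^sup>2) \<le> (LINT x|M. (g x)\<^sup>2 + (h x)\<^sup>2)"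
proof -
  have "(\<Sum>i\<in>I. (cmod (Complex (LINT x|M. e i x * g x) (LINT x|M. e i x * h x)))\<^sup>2)
    = (\<Sum>i\<in>I. (LINT x|M. e i x * g x)\<^sup>2) + (\<Sum>i\<in>I. (LINT x|M. e i x * h x)\<^sup>2)"
    by (simp add: cmod_power2 sum.distrib)
  also have "\<dots> \<le> (LINT x|M. (g x)\<^sup>2) + (LINT x|M. (h x)\<^sup>2)"
    by (intro add_mono bessel_inequality[OF I e _ on] g)
  also have "\<dots> = (LINT x|M. (g x)\<^sup>2 + (h x)\<^sup>2)" using g by (simp add: square_integrable_def)
  finally show ?thesis .
qed

section \<open>The spectral sum: upper bound and Lipschitz constant\<close>

definition spectral_sum :: "(nat \<Rightarrow> 'a::euclidean_space \<Rightarrow> real) \<Rightarrow> nat set \<Rightarrow> 'a \<Rightarrow> real" where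
  "spectral_sum e I \<xi> = (\<Sum>i\<in>I. (cmod (fhat (e i) \<xi>))\<^sup>2)"

context
  fixes \<Omega> :: "'a::euclidean_space set" and e :: "nat \<Rightarrow> 'a \<Rightarrow> real" and I :: "nat set"
  assumes \<Omega>: "\<Omega> \<in> sets borel" "bounded \<Omega>" and I: "finite I"
    and e: "\<And>i. i \<in> I \<Longrightarrow> square_integrable lborel (e i)" and z: "\<And>i x. i \<in> I \<Longrightarrow> x \<notin> \<Omega> \<Longrightarrow> e i x = 0"
    and on: "\<And>i j. i \<in> I \<Longrightarrow> j \<in> I \<Longrightarrow> (LBINT x. e i x * e j x) = (if i = j then 1 else 0)"
begin

lemma spectral_fhat:
  assumes "i \<in> I"
  shows "fhat (e i) \<xi> = Complex (LBINT x. e i x * cos_wave \<Omega> \<xi> x) (LBINT x. e i x * sin_wave \<Omega> \<xi> x)"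
proof (rule fhat_waves)
  show "integrable lborel (e i)"
    by (rule square_integrable_bounded_integrable[OF square_integrable_bounded_support[OF e[OF assms] \<Omega>(2) z[OF assms]]])
qed (rule z[OF assms])

text \<open>The squares of the cosine and the sine wave add up to the indicator of \<Omega>, so
  Bessel's inequality gives the volume.\<close>

lemma spectral_sum_le: "spectral_sum e I \<xi> \<le> measure lborel \<Omega>"
proof -
  have "spectral_sum e I \<xi> = (\<Sum>i\<in>I. (cmod (Complex (LBINT x. e i x * cos_wave \<Omega> \<xi> x) (LBINT x. e i x * sin_wave \<Omega> \<xi> x)))\<^sup>2)"
    unfolding spectral_sum_def by (intro sum.cong refl) (simp only: spectral_fhat)
  also have "\<dots> \<le> (LBINT x. (cos_wave \<Omega> \<xi> x)\<^sup>2 + (sin_wave \<Omega> \<xi> x)\<^sup>2)"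
    by (rule complex_bessel_inequality[OF I e square_integrable_waves[OF \<Omega>] on])
  also have "\<dots> = (LBINT x. indicator \<Omega> x)"
    by (intro Bochner_Integration.integral_cong refl)
       (simp add: cos_wave_def sin_wave_def power_mult_distrib indicator_def)
  also have "\<dots> = measure lborel \<Omega>" using \<Omega> by simp
  finally show ?thesis .
qed

text \<open>The square root of the spectral sum at \<open>\<xi>\<close> is the norm of the projection of the plane wave
  \<open>cis (\<xi> \<bullet> x)\<close> on \<open>\<Omega>\<close>, and that wave is a Lipschitz function of \<open>\<xi>\<close> in \<open>L\<^sup>2\<close>.\<close>

lemma spectral_sum_lipschitz:
  "\<bar>spectral_sum e I \<xi> - spectral_sum e I \<eta>\<bar> \<le>
    2 * sqrt (measure lborel \<Omega> * (LBINT x. indicator \<Omega> x * (norm x)\<^sup>2)) * norm (\<xi> - \<eta>)"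
proof -
  define J where "J = (LBINT x. indicator \<Omega> x * (norm (x::'a))\<^sup>2)"
  define A where "A \<xi> = L2_set (\<lambda>i. cmod (fhat (e i) \<xi>)) I" for \<xi>
  have A: "spectral_sum e I \<xi> = (A \<xi>)\<^sup>2" "0 \<le> A \<xi>" for \<xi>
    by (simp_all add: A_def spectral_sum_def L2_set_def sum_nonneg)
  have A_le: "A \<xi> \<le> sqrt (measure lborel \<Omega>)" for \<xi>
    using spectral_sum_le[of \<xi>] A(1)[of \<xi>] by (simp add: real_le_rsqrt)
  obtain B where B: "\<And>x. x \<in> \<Omega> \<Longrightarrow> norm x \<le> B" using \<Omega>(2) by (auto simp: bounded_iff)
  have "square_integrable lborel (\<lambda>x. indicator \<Omega> x * norm x)"
    by (rule square_integrable_indicator_bounded[OF \<Omega>, where C=B]) (use B in auto)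
  moreover have "(indicator \<Omega> x * norm x)\<^sup>2 = indicator \<Omega> x * (norm x)\<^sup>2" for x :: 'a
    by (simp add: indicator_def)
  ultimately have Ji: "integrable lborel (\<lambda>x. indicator \<Omega> x * (norm (x::'a))\<^sup>2)"
    by (simp add: square_integrable_def)
  have J0: "0 \<le> J" unfolding J_def by (intro Bochner_Integration.integral_nonneg) simp
  \<comment> \<open>Bessel's inequality for the difference of the waves at \<xi> and \<eta>, whose
    modulus at \<open>x\<close> is at most |\<xi> - \<eta>| |x|.\<close>
  have dist: "(\<Sum>i\<in>I. (cmod (fhat (e i) \<xi> - fhat (e i) \<eta>))\<^sup>2) \<le> (norm (\<xi> - \<eta>))\<^sup>2 * J" for \<xi> \<eta>
  proof -
    let ?c = "\<lambda>x. 1 * cos_wave \<Omega> \<xi> x + (-1) * cos_wave \<Omega> \<eta> x"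
    let ?s = "\<lambda>x. 1 * sin_wave \<Omega> \<xi> x + (-1) * sin_wave \<Omega> \<eta> x"
    note W = square_integrable_waves[OF \<Omega>]
    have c: "square_integrable lborel ?c" and s: "square_integrable lborel ?s"
      by (intro square_integrable_comb W)+
    have d: "fhat (e i) \<xi> - fhat (e i) \<eta> = Complex (LBINT x. e i x * ?c x) (LBINT x. e i x * ?s x)" if i: "i \<in> I" for i
      unfolding spectral_fhat[OF i]
      using square_integrable_mult_integrable[OF e[OF i] W(1)] square_integrable_mult_integrable[OF e[OF i] W(2)]
      by (simp add: complex_eq_iff right_diff_distrib)
    have "(\<Sum>i\<in>I. (cmod (fhat (e i) \<xi> - fhat (e i) \<eta>))\<^sup>2) = (\<Sum>i\<in>I. (cmod (Complex (LBINT x. e i x * ?c x) (LBINT x. e i x * ?s x)))\<^sup>2)"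
      by (intro sum.cong refl) (simp only: d)
    also have "\<dots> \<le> (LBINT x. (?c x)\<^sup>2 + (?s x)\<^sup>2)"
      by (rule complex_bessel_inequality[OF I e c s on])
    also have "\<dots> \<le> (LBINT x. (norm (\<xi> - \<eta>))\<^sup>2 * (indicator \<Omega> x * (norm x)\<^sup>2))"
    proof (rule integral_mono)
      show "integrable lborel (\<lambda>x. (?c x)\<^sup>2 + (?s x)\<^sup>2)" using c s by (simp add: square_integrable_def)
      show "integrable lborel (\<lambda>x::'a. (norm (\<xi> - \<eta>))\<^sup>2 * (indicator \<Omega> x * (norm x)\<^sup>2))"
        by (rule integrable_mult_right[OF Ji])
      fix x
      have "(?c x)\<^sup>2 + (?s x)\<^sup>2 = indicator \<Omega> x * (cmod (cis (\<xi> \<bullet> x) - cis (\<eta> \<bullet> x)))\<^sup>2"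
        by (simp add: cos_wave_def sin_wave_def cmod_power2 indicator_def)
      also have "\<dots> \<le> indicator \<Omega> x * (norm (\<xi> - \<eta>) * norm x)\<^sup>2"
      proof (intro mult_left_mono power_mono)
        have "cmod (cis (\<xi> \<bullet> x) - cis (\<eta> \<bullet> x)) \<le> \<bar>(\<xi> - \<eta>) \<bullet> x\<bar>"
          using norm_cis_diff_le[of "\<xi> \<bullet> x" "\<eta> \<bullet> x"] by (simp add: inner_diff_left)
        also have "\<dots> \<le> norm (\<xi> - \<eta>) * norm x" by (rule Cauchy_Schwarz_ineq2)
        finally show "cmod (cis (\<xi> \<bullet> x) - cis (\<eta> \<bullet> x)) \<le> norm (\<xi> - \<eta>) * norm x" .
      qed simp_all
      finally show "(?c x)\<^sup>2 + (?s x)\<^sup>2 \<le> (norm (\<xi> - \<eta>))\<^sup>2 * (indicator \<Omega> x * (norm x)\<^sup>2)"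
        by (simp add: power_mult_distrib mult_ac)
    qed
    also have "\<dots> = (norm (\<xi> - \<eta>))\<^sup>2 * J" by (simp add: J_def)
    finally show ?thesis .
  qed
  have half: "A \<xi> - A \<eta> \<le> norm (\<xi> - \<eta>) * sqrt J" for \<xi> \<eta>
  proof -
    have "A \<xi> \<le> L2_set (\<lambda>i. cmod (fhat (e i) \<eta>) + cmod (fhat (e i) \<xi> - fhat (e i) \<eta>)) I"
      unfolding A_def by (rule L2_set_mono) (simp_all add: norm_triangle_sub)
    also have "\<dots> \<le> A \<eta> + L2_set (\<lambda>i. cmod (fhat (e i) \<xi> - fhat (e i) \<eta>)) I"
      unfolding A_def by (rule L2_set_triangle_ineq)
    also have "L2_set (\<lambda>i. cmod (fhat (e i) \<xi> - fhat (e i) \<eta>)) I \<le> sqrt ((norm (\<xi> - \<eta>))\<^sup>2 * J)"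
      unfolding L2_set_def by (intro real_sqrt_le_mono dist)
    also have "sqrt ((norm (\<xi> - \<eta>))\<^sup>2 * J) = norm (\<xi> - \<eta>) * sqrt J" by (simp add: real_sqrt_mult)
    finally show ?thesis by simp
  qed
  have "\<bar>A \<xi> - A \<eta>\<bar> \<le> norm (\<xi> - \<eta>) * sqrt J"
    using half[of \<xi> \<eta>] half[of \<eta> \<xi>] by (simp add: abs_le_iff norm_minus_commute)
  \<comment> \<open>The spectral sum is \<open>A\<close> squared; factoring the difference of
    squares makes this bound the source of the factor 2 in \<rho>.\<close>
  moreover have "A \<xi> + A \<eta> \<le> 2 * sqrt (measure lborel \<Omega>)" using A_le[of \<xi>] A_le[of \<eta>] by simp
  ultimately have "\<bar>A \<xi> - A \<eta>\<bar> * (A \<xi> + A \<eta>) \<le> (norm (\<xi> - \<eta>) * sqrt J) * (2 * sqrt (measure lborel \<Omega>))"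
    using A(2)[of \<xi>] A(2)[of \<eta>] J0 by (intro mult_mono) auto
  moreover have "\<bar>spectral_sum e I \<xi> - spectral_sum e I \<eta>\<bar> = \<bar>A \<xi> - A \<eta>\<bar> * (A \<xi> + A \<eta>)"
    using A(2)[of \<xi>] A(2)[of \<eta>] unfolding A(1) by (simp add: power2_eq_square square_diff_square_factored abs_mult mult.commute)
  ultimately show ?thesis unfolding J_def[symmetric] by (simp add: real_sqrt_mult mult_ac)
qed

end

text \<open>Plancherel's theorem for \<open>V []\<close> and for every derivative of order
  \<open>l\<close>: the squared symbols add up to |\<xi>|^(2l), the squared norms of the derivatives
  to the energy.\<close>

lemma eigenfunction_spectral_moments:
  fixes \<Omega> :: "(real^'n::finite) set"
  assumes \<Omega>: "\<Omega> \<in> sets borel" "bounded \<Omega>" and V: "weak_eigenfunction l \<Omega> \<mu> V"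
  shows "integrable lborel (\<lambda>\<xi>. (cmod (fhat (V []) \<xi>))\<^sup>2)"
    and "(LBINT \<xi>. (cmod (fhat (V []) \<xi>))\<^sup>2) = (2 * pi) ^ CARD('n) * (LBINT x. V [] x * V [] x)"
    and "integrable lborel (\<lambda>\<xi>. norm \<xi> ^ (2 * l) * (cmod (fhat (V []) \<xi>))\<^sup>2)"
    and "(LBINT \<xi>. norm \<xi> ^ (2 * l) * (cmod (fhat (V []) \<xi>))\<^sup>2) = (2 * pi) ^ CARD('n) * (\<mu> * (LBINT x. V [] x * V [] x))"
proof -
  note R = weak_eigenfunction_regularity[OF V \<Omega>]
  have R0: "translation_continuous (V [])" by (rule R(1)) simp
  show "integrable lborel (\<lambda>\<xi>. (cmod (fhat (V []) \<xi>))\<^sup>2)" by (rule plancherel(1)[OF R0])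
  show "(LBINT \<xi>. (cmod (fhat (V []) \<xi>))\<^sup>2) = (2 * pi) ^ CARD('n) * (LBINT x. V [] x * V [] x)"
    using plancherel(2)[OF R0] by (simp add: power2_eq_square)
  have eq: "norm \<xi> ^ (2 * l) * (cmod (fhat (V []) \<xi>))\<^sup>2 = (\<Sum>w | length w = l. (cmod (fhat (V w) \<xi>))\<^sup>2)" for \<xi>
  proof -
    have "(\<Sum>w | length w = l. (cmod (fhat (V w) \<xi>))\<^sup>2) = (\<Sum>w | length w = l. (cmod (fourier_symbol w \<xi>))\<^sup>2 * (cmod (fhat (V []) \<xi>))\<^sup>2)"
      by (intro sum.cong refl) (simp only: mem_Collect_eq R(2)[OF eq_refl] norm_mult power_mult_distrib)
    then show ?thesis by (simp only: sum_distrib_right[symmetric] sum_norm_fourier_symbol)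
  qed
  have i: "integrable lborel (\<lambda>\<xi>. (cmod (fhat (V w) \<xi>))\<^sup>2)" if "length w = l" for w
    by (rule plancherel(1)[OF R(1)]) (simp add: that)
  show "integrable lborel (\<lambda>\<xi>. norm \<xi> ^ (2 * l) * (cmod (fhat (V []) \<xi>))\<^sup>2)"
    unfolding eq by (rule Bochner_Integration.integrable_sum) (simp add: i)
  have "(LBINT \<xi>. norm \<xi> ^ (2 * l) * (cmod (fhat (V []) \<xi>))\<^sup>2) = (\<Sum>w | length w = l. LBINT \<xi>. (cmod (fhat (V w) \<xi>))\<^sup>2)"
    unfolding eq by (rule Bochner_Integration.integral_sum) (simp add: i)
  also have "\<dots> = (\<Sum>w | length w = l. (2 * pi) ^ CARD('n) * (LBINT x. V w x * V w x))"
  proof (intro sum.cong refl)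
    fix w :: "'n list" assume "w \<in> {w. length w = l}"
    then have "translation_continuous (V w)" by (intro R(1)) simp
    from plancherel(2)[OF this] show "(LBINT \<xi>. (cmod (fhat (V w) \<xi>))\<^sup>2) = (2 * pi) ^ CARD('n) * (LBINT x. V w x * V w x)"
      by (simp add: power2_eq_square)
  qed
  also have "\<dots> = (2 * pi) ^ CARD('n) * (\<mu> * (LBINT x. V [] x * V [] x))"
    unfolding sum_distrib_left[symmetric] weak_eigenfunction_energy[OF V V \<Omega>] ..
  finally show "(LBINT \<xi>. norm \<xi> ^ (2 * l) * (cmod (fhat (V []) \<xi>))\<^sup>2) = (2 * pi) ^ CARD('n) * (\<mu> * (LBINT x. V [] x * V [] x))" .
qed

theorem theorem1p1:
  fixes \<Omega> :: "(real^'n::finite) set" and l k :: nat and \<Lambda> :: "nat \<Rightarrow> real"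
  assumes "CARD('n) \<ge> 5" and "l \<ge> 1"
    and "open \<Omega>" and "connected \<Omega>" and "\<Omega> \<noteq> {}" and "bounded \<Omega>"
    and "dirichlet_eigenvalues l \<Omega> \<Lambda>"
    and "k \<ge> 1"
    and "real k \<ge> Max {k1 CARD('n) powr (real CARD('n) / 2), k2 CARD('n) powr (real CARD('n) / 2),
                       k3 CARD('n) l, k4 CARD('n) l}"
  shows "let n = real CARD('n); L = real l; K = real k; \<omega> = unit_ball_vol n; V = vol \<Omega> in
    (\<Sum>i=1..k. \<Lambda> i) \<ge>
      n / (n + 2 * L) * ((2 * pi) ^ (2 * l) / (\<omega> * V) powr (2 * L / n)) * K powr ((2 * L + n) / n)
      + n * L / (12 * (rho \<Omega>)\<^sup>2) * \<omega> powr (- ((2 * L - 2) / n))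
          * alpha \<Omega> powr ((2 * n - 2 * L + 2) / n) * K powr ((2 * L + n - 2) / n)
      + C1 l \<Omega> * K powr ((2 * L + n - 3) / n)
      + C2 l \<Omega> * K powr ((2 * L + n - 4) / n)
      + C3 l \<Omega> * K powr ((2 * L + n - 5) / n)"
proof -
  let ?n = "CARD('n)"
  let ?\<omega> = "unit_ball_vol (real ?n)"
  have \<Omega>: "\<Omega> \<in> sets borel" "bounded \<Omega>" using assms by auto
  have dimn: "DIM(real^'n) = ?n" by simp
  define v where "v = measure lborel \<Omega>"
  have vol: "vol \<Omega> = v" unfolding vol_def v_def using \<Omega>(1) by (simp add: measure_completion)
  define J where "J = (LBINT x. indicator \<Omega> x * (norm (x::real^'n))\<^sup>2)"
  have sm: "second_moment \<Omega> = J"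
  proof -
    note s = Int_space_lebesgue[OF \<Omega>(1)]
    have m: "(\<lambda>x. indicator \<Omega> x *\<^sub>R (norm x)\<^sup>2 :: real) \<in> borel_measurable lborel" using \<Omega>(1) by simp
    show ?thesis unfolding second_moment_def J_def integral_restrict_space[OF s] integral_completion[OF m] by simp
  qed
  have v0: "0 < v"
  proof -
    have "\<not> negligible \<Omega>" using open_not_negligible[of \<Omega>] assms by blast
    then have "emeasure lborel \<Omega> \<noteq> 0"
      using \<Omega>(1) by (auto simp: negligible_iff_null_sets null_sets_def)
    moreover have "emeasure lborel \<Omega> < \<infinity>" using emeasure_bounded_finite[OF \<Omega>(2)] by simp
    ultimately show ?thesis unfolding v_def measure_def by (simp add: enn2real_positive_iff less_top zero_less_iff_neq_zero)
  qed
  \<comment> \<open>The radius of the ball that has the volume of \<Omega>.\<close>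
  define r where "r = root ?n (v / ?\<omega>)"
  have "0 < ?\<omega>" by simp
  then have r: "0 < r" and vr: "v = ?\<omega> * r ^ ?n"
    using v0 assms(1) by (simp_all add: r_def real_root_pow_pos less_imp_neq[symmetric])
  have J_ge: "J \<ge> real ?n / (real ?n + 2) * v * r\<^sup>2"
    unfolding J_def v_def
    using second_moment_ge_ball[OF \<Omega> r] vr by (simp add: v_def)
  obtain V where V: "\<And>i. 1 \<le> i \<Longrightarrow> weak_eigenfunction l \<Omega> (\<Lambda> i) (V i)"
    and on: "\<And>i j. 1 \<le> i \<Longrightarrow> 1 \<le> j \<Longrightarrow> (LBINT x. V i [] x * V j [] x) = (if i = j then 1 else 0)"
    using orthonormal_eigenfunctions[OF \<Omega> assms(7)] by blast
  define F where "F = spectral_sum (\<lambda>i. V i []) {1..k}"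
  define P where "P = (2 * pi) ^ ?n"
  have P: "0 < P" by (simp add: P_def)
  \<comment> \<open>The division by (2 pi)^n turns the volume bound into \<alpha> and the Lipschitz
    constant into \<rho>.\<close>
  define f where "f \<xi> = F \<xi> / P" for \<xi>
  have E: "square_integrable lborel (V i [])" "x \<notin> \<Omega> \<Longrightarrow> V i [] x = 0" if "i \<in> {1..k}" for i x
    using weak_eigenfunctionD(1,2)[OF V[of i], of "[]"] that by auto
  have on': "(LBINT x. V i [] x * V j [] x) = (if i = j then 1 else 0)" if "i \<in> {1..k}" "j \<in> {1..k}" for i j
    using on that by simp
  have F_le: "F \<xi> \<le> v" for \<xi>
    unfolding F_def v_def by (rule spectral_sum_le[OF \<Omega> finite_atLeastAtMost E on'])
  have F_lip: "\<bar>F \<xi> - F \<eta>\<bar> \<le> 2 * sqrt (v * J) * norm (\<xi> - \<eta>)" for \<xi> \<eta>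
    unfolding F_def v_def J_def by (rule spectral_sum_lipschitz[OF \<Omega> finite_atLeastAtMost E on'])
  note M = eigenfunction_spectral_moments[OF \<Omega> V]
  have f_int: "integrable lborel f" "(LBINT \<xi>. f \<xi>) = real k"
  proof -
    have i: "integrable lborel F" unfolding F_def spectral_sum_def[abs_def]
      by (rule Bochner_Integration.integrable_sum) (use M(1) in auto)
    then show "integrable lborel f" unfolding f_def by simp
    have "(LBINT \<xi>. F \<xi>) = (\<Sum>i\<in>{1..k}. LBINT \<xi>. (cmod (fhat (V i []) \<xi>))\<^sup>2)"
      unfolding F_def spectral_sum_def by (rule Bochner_Integration.integral_sum) (use M(1) in auto)
    also have "\<dots> = (\<Sum>i\<in>{1..k}. P)"
      by (intro sum.cong refl) (use M(2) on in \<open>auto simp: P_def\<close>)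
    finally show "(LBINT \<xi>. f \<xi>) = real k" unfolding f_def using P by simp
  qed
  have f_mom: "integrable lborel (\<lambda>\<xi>. norm \<xi> ^ (2 * l) * f \<xi>)" "(LBINT \<xi>. norm \<xi> ^ (2 * l) * f \<xi>) = (\<Sum>i=1..k. \<Lambda> i)"
  proof -
    have eq: "norm \<xi> ^ (2 * l) * f \<xi> = (\<Sum>i\<in>{1..k}. norm \<xi> ^ (2 * l) * (cmod (fhat (V i []) \<xi>))\<^sup>2) / P" for \<xi>
      unfolding f_def F_def spectral_sum_def by (simp add: sum_distrib_left)
    show "integrable lborel (\<lambda>\<xi>. norm \<xi> ^ (2 * l) * f \<xi>)"
      unfolding eq by (intro integrable_divide Bochner_Integration.integrable_sum) (use M(3) in auto)
    have "(LBINT \<xi>. norm \<xi> ^ (2 * l) * f \<xi>) = (\<Sum>i\<in>{1..k}. LBINT \<xi>. norm \<xi> ^ (2 * l) * (cmod (fhat (V i []) \<xi>))\<^sup>2) / P"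
      unfolding eq integral_divide_zero by (intro arg_cong[of _ _ "\<lambda>x. x / P"] Bochner_Integration.integral_sum) (use M(3) in auto)
    also have "\<dots> = (\<Sum>i\<in>{1..k}. P * \<Lambda> i) / P"
      by (intro arg_cong[of _ _ "\<lambda>x. x / P"] sum.cong refl) (use M(4) on in \<open>auto simp: P_def\<close>)
    finally show "(LBINT \<xi>. norm \<xi> ^ (2 * l) * f \<xi>) = (\<Sum>i=1..k. \<Lambda> i)"
      using P by (simp add: sum_distrib_left[symmetric])
  qed
  define \<alpha> where "\<alpha> = v / (2 * pi) ^ ?n"
  define \<rho> where "\<rho> = 2 / (2 * pi) ^ ?n * sqrt (v * J)"
  have \<alpha>: "alpha \<Omega> = \<alpha>" by (simp add: alpha_def vol \<alpha>_def)
  have \<rho>: "rho \<Omega> = \<rho>" by (simp add: rho_def vol sm \<rho>_def)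
  have J0: "0 < J"
  proof -
    have "0 < real ?n / (real ?n + 2) * v * r\<^sup>2" using v0 r assms(1) by simp
    then show ?thesis using J_ge by linarith
  qed
  have \<rho>0: "0 < \<rho>" using v0 J0 by (simp add: \<rho>_def)
  have kk: "real k \<ge> k4 ?n l" using assms(9) by (simp add: Max_ge_iff)
  \<comment> \<open>Stated for every ramp of mass \<open>k\<close>; suitable endpoints are found in
    \<open>eigenvalue_sum_bound_from_ramp\<close>.\<close>
  have ramp: "(\<Sum>i=1..k. \<Lambda> i) \<ge> real ?n / real (?n + 2 * l) * ?\<omega> * \<rho> * (R ^ Suc (?n + 2 * l) - t ^ Suc (?n + 2 * l)) / (real (?n + 2 * l) + 1)"
    if t: "0 < t" "t < R" "\<alpha> = \<rho> * (R - t)" "real k = ?\<omega> * \<rho> * (R ^ Suc ?n - t ^ Suc ?n) / (real ?n + 1)" for t R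
  proof -
    have f0: "0 \<le> f \<xi>" for \<xi> unfolding f_def F_def spectral_sum_def using P by (simp add: sum_nonneg)
    have f1: "f \<xi> \<le> \<alpha>" for \<xi>
      unfolding f_def \<alpha>_def P_def using F_le[of \<xi>] by (simp add: divide_right_mono)
    have f2: "\<bar>f \<xi> - f \<eta>\<bar> \<le> \<rho> * norm (\<xi> - \<eta>)" for \<xi> \<eta>
    proof -
      have "\<bar>f \<xi> - f \<eta>\<bar> = \<bar>F \<xi> - F \<eta>\<bar> / P" unfolding f_def using P by (simp add: diff_divide_distrib[symmetric])
      also have "\<dots> \<le> 2 * sqrt (v * J) * norm (\<xi> - \<eta>) / P" using F_lip P by (intro divide_right_mono) auto
      finally show ?thesis by (simp add: \<rho>_def P_def)
    qed
    have "(LBINT \<xi>. f \<xi>) = ?\<omega> * \<rho> * (R ^ Suc ?n - t ^ Suc ?n) / (real ?n + 1)"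
      using f_int(2) t(4) by simp
    from ramp_moment_comparison[OF f0 f1 f2 f_int(1) f_mom(1) assms(2) t(1-3) \<rho>0, unfolded dimn, OF this]
    show ?thesis unfolding f_mom(2) .
  qed
  show ?thesis
    unfolding Let_def C1_def C2_def C3_def \<alpha> \<rho> vol
    unfolding \<alpha>_def \<rho>_def
    by (rule eigenvalue_sum_bound_from_ramp[OF assms(1,2,8) kk r vr J_ge])
       (use ramp in \<open>simp add: \<alpha>_def \<rho>_def\<close>)
qed

end
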